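(* Let $k\ge 1$ and let $w$ be any finite word in the alphabet $\{g_1^{\pm1},\ldots,g_k^{\pm1}\}$. Then $\phi(w)=2$ if and only if $\beta(w)=2$.
   Context: Words: $w=g_{i_1}^{\alpha_1}\cdots g_{i_m}^{\alpha_m}$ with $i_j\in\{1,\ldots,k\}$, $\alpha_j\in\{\pm1\}$, $m=|w|$ (not necessarily reduced). For $\sigma_1,\ldots,\sigma_k\in S_n$, $w(\sigma_1,\ldots,\sigma_k)\in S_n$ is obtained by substituting $\sigma_i$ for $g_i$. Definition of $\phi$: let $X_w^{(n)}(\sigma_1,\ldots,\sigma_k)$ be the number of fixed points of $w(\sigma_1,\ldots,\sigma_k)$, where $(\sigma_1,\ldots,\sigma_k)$ is uniform on $S_n^k$. It is known that for $n\ge |w|$ one has $\frac{\mathbb{E}(X_w^{(n)})-1}{n}=\sum_{i\ge 0} a_i(w) n^{-i}$ with integer coefficients $a_i(w)$ depending only on $w$. Define $\phi(w)=\infty$ if $\mathbb{E}(X_w^{(n)})\equiv 1$, and otherwise $\phi(w)$ is the smallest $i$ with $a_i(w)\ne 0$. Definition of $\beta$: the open trail $T_w$ is the path with vertices $s_0,\ldots,s_m$ where for each $1\le j\le m$ there is an edge labeled $i_j$ between $s_{j-1}$ and $s_j$, directed from $s_{j-1}$ to $s_j$ if $\alpha_j=1$ and from $s_j$ to $s_{j-1}$ if $\alpha_j=-1$. A quotient graph of $T_w$ corresponds to a partition of $\{s_0,\ldots,s_m\}$: vertices are blocks, and there is a $j$-labeled directed edge from block $U$ to block $V$ whenever $T_w$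 has a $j$-labeled edge from some element of $U$ to some element of $V$ (parallel identical edges identified). Write $s_h\equiv s_l$ if they lie in the same block. A quotient is realizable if (1) $s_0\equiv s_m$; (2) whenever $i_h=i_l$ and $\alpha_h=\alpha_l$, $s_{h-1}\equiv s_{l-1}\iff s_h\equiv s_l$; (3) whenever $i_h=i_l$ and $\alpha_h=-\alpha_l$, $s_{h-1}\equiv s_l\iff s_h\equiv s_{l-1}$. Let $\mathcal{Q}_w$ be the set of realizable quotients. A realizable quotient $\Gamma$ is generated by a set $E$ of pairs $\{s_a,s_b\}$ if its partition is the finest partition in which every pair in $E$ is in one block and no two edges with the same label share the same origin or the same terminus. For a graph $\Gamma$, $\chi(\Gamma)=e_\Gamma-v_\Gamma+1$ (number of edges minus number of vertices plus one); the smallest size of a generating set of $\Gamma\in\mathcal{Q}_w$ equals $\chi(\Gamma)$. $\Gamma$ has type A if some generating set of smallest size contains the pair $\{s_0,s_m\}$, and type B otherwise. Then $\beta(w)=\min(\{\chi(\Gamma):\Gamma\in\mathcal{Q}_w \text{ of type B}\}\cup\{\infty\})$. *)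

theory Defs
  imports
    "HOL-Library.Disjoint_Sets"
    "HOL-Library.Extended_Nat"
    "HOL-Combinatorics.Permutations"
    "HOL-Probability.Probability"
begin

text \<open>
  A word is the list of its letters, not necessarily reduced. The letter \<open>(i, True)\<close> stands
  for $g_i$ and \<open>(i, False)\<close> for $g_i^{-1}$.
\<close>

type_synonym word = "(nat \<times> bool) list"

definition word_over :: "nat \<Rightarrow> word \<Rightarrow> bool" where
  "word_over k w \<longleftrightarrow> (\<forall>(i, \<alpha>) \<in> set w. i \<in> {1..k})"

fun letter_perm :: "(nat \<Rightarrow> nat \<Rightarrow> nat) \<Rightarrow> nat \<times> bool \<Rightarrow> nat \<Rightarrow> nat" where
  "letter_perm \<sigma> (i, \<alpha>) = (if \<alpha> then \<sigma> i else inv (\<sigma> i))"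

text \<open>
  Permutations act from the right, so the first letter of the word is applied first; this agrees
  with reading the open trail from $s_0$ to $s_m$. With the opposite convention the word permutation
  is the inverse of the present one evaluated at the inverses of the \<open>\<sigma> i\<close>, so the law of
  the number of fixed points is the same.
\<close>

fun word_perm :: "(nat \<Rightarrow> nat \<Rightarrow> nat) \<Rightarrow> word \<Rightarrow> nat \<Rightarrow> nat" where
  "word_perm \<sigma> [] = id"
| "word_perm \<sigma> (l # w) = word_perm \<sigma> w \<circ> letter_perm \<sigma> l"

definition perm_tuples :: "nat \<Rightarrow> nat \<Rightarrow> (nat \<Rightarrow> nat \<Rightarrow> nat) set" where
  "perm_tuples k n = (\<Pi>\<^sub>E i\<in>{1..k}. {p. p permutes {1..n}})"

definition num_fixed_points :: "word \<Rightarrow> nat \<Rightarrow> (nat \<Rightarrow> nat \<Rightarrow> nat) \<Rightarrow> nat" where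
  "num_fixed_points w n \<sigma> = card {x \<in> {1..n}. word_perm \<sigma> w x = x}"

definition expected_fixed_points :: "nat \<Rightarrow> word \<Rightarrow> nat \<Rightarrow> real" where
  "expected_fixed_points k w n =
     measure_pmf.expectation (pmf_of_set (perm_tuples k n)) (\<lambda>\<sigma>. real (num_fixed_points w n \<sigma>))"

text \<open>
  The sequence described below is unique, since a power series is determined by its values at
  the points $1/n$ for large $n$.
\<close>

definition fp_coeff :: "nat \<Rightarrow> word \<Rightarrow> nat \<Rightarrow> int" where
  "fp_coeff k w = (THE a. \<forall>n. 1 \<le> n \<and> length w \<le> n \<longrightarrow>
     (\<lambda>i. real_of_int (a i) / real n ^ i) sums ((expected_fixed_points k w n - 1) / real n))"

text \<open>
  The infimum of the empty set is \<open>\<infinity>\<close>, so it does not matter whether the first case asks for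
  expectation 1 for all \<open>n \<ge> 1\<close> or only for \<open>n \<ge> length w\<close>, where the expansion is valid.
\<close>

definition phi :: "nat \<Rightarrow> word \<Rightarrow> enat" where
  "phi k w = (if \<forall>n\<ge>1. expected_fixed_points k w n = 1 then \<infinity>
     else (INF i \<in> {i. fp_coeff k w i \<noteq> 0}. enat i))"

text \<open>
  The vertex $s_j$ of the open trail is represented by its index \<open>j\<close>. An edge is a triple of
  label, origin and terminus. The letters of the word are numbered from 1 in the mathematics and
  from 0 in the list, so the edge between $s_j$ and $s_{j+1}$ comes from \<open>w ! j\<close>.
\<close>

definition trail_vertices :: "word \<Rightarrow> nat set" where
  "trail_vertices w = {0..length w}"

definition trail_edges :: "word \<Rightarrow> (nat \<times> nat \<times> nat) set" where
  "trail_edges w =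
     (\<lambda>j. case w ! j of (i, \<alpha>) \<Rightarrow> if \<alpha> then (i, j, Suc j) else (i, Suc j, j)) ` {..<length w}"

text \<open>
  A quotient of the open trail is given by a partition \<open>P\<close> of its vertices, the blocks being the
  vertices of the quotient graph.
\<close>

definition quotient_edges :: "word \<Rightarrow> nat set set \<Rightarrow> (nat \<times> nat set \<times> nat set) set" where
  "quotient_edges w P =
     {(i, U, V). U \<in> P \<and> V \<in> P \<and> (\<exists>u\<in>U. \<exists>v\<in>V. (i, u, v) \<in> trail_edges w)}"

definition same_block :: "nat set set \<Rightarrow> nat \<Rightarrow> nat \<Rightarrow> bool" where
  "same_block P a b \<longleftrightarrow> (\<exists>U\<in>P. a \<in> U \<and> b \<in> U)"

definition realizable :: "word \<Rightarrow> nat set set \<Rightarrow> bool" where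
  "realizable w P \<longleftrightarrow>
     partition_on (trail_vertices w) P \<and>
     same_block P 0 (length w) \<and>
     (\<forall>h<length w. \<forall>l<length w. fst (w ! h) = fst (w ! l) \<and> snd (w ! h) = snd (w ! l) \<longrightarrow>
        (same_block P h l \<longleftrightarrow> same_block P (Suc h) (Suc l))) \<and>
     (\<forall>h<length w. \<forall>l<length w. fst (w ! h) = fst (w ! l) \<and> snd (w ! h) \<noteq> snd (w ! l) \<longrightarrow>
        (same_block P h (Suc l) \<longleftrightarrow> same_block P (Suc h) l))"

definition realizable_quotients :: "word \<Rightarrow> nat set set set" where
  "realizable_quotients w = {P. realizable w P}"

definition folded :: "word \<Rightarrow> nat set set \<Rightarrow> bool" where
  "folded w P \<longleftrightarrow>
     (\<forall>i U V U' V'. (i, U, V) \<in> quotient_edges w P \<and> (i, U', V') \<in> quotient_edges w P \<and>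
        (U, V) \<noteq> (U', V') \<longrightarrow> U \<noteq> U' \<and> V \<noteq> V')"

definition admissible :: "word \<Rightarrow> nat set set \<Rightarrow> nat set set \<Rightarrow> bool" where
  "admissible w E P \<longleftrightarrow>
     partition_on (trail_vertices w) P \<and> (\<forall>e\<in>E. \<exists>U\<in>P. e \<subseteq> U) \<and> folded w P"

definition generates :: "word \<Rightarrow> nat set set \<Rightarrow> nat set set \<Rightarrow> bool" where
  "generates w E P \<longleftrightarrow>
     E \<subseteq> {{a, b} | a b. a \<in> trail_vertices w \<and> b \<in> trail_vertices w} \<and>
     admissible w E P \<and>
     (\<forall>Q. admissible w E Q \<longrightarrow> refines (trail_vertices w) P Q)"

definition smallest_generating_set :: "word \<Rightarrow> nat set set \<Rightarrow> nat set set \<Rightarrow> bool" where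
  "smallest_generating_set w E P \<longleftrightarrow>
     generates w E P \<and> (\<forall>E'. generates w E' P \<longrightarrow> card E \<le> card E')"

definition type_A :: "word \<Rightarrow> nat set set \<Rightarrow> bool" where
  "type_A w P \<longleftrightarrow> (\<exists>E. smallest_generating_set w E P \<and> {0, length w} \<in> E)"

definition type_B :: "word \<Rightarrow> nat set set \<Rightarrow> bool" where
  "type_B w P \<longleftrightarrow> \<not> type_A w P"

definition chi :: "word \<Rightarrow> nat set set \<Rightarrow> int" where
  "chi w P = int (card (quotient_edges w P)) - int (card P) + 1"

text \<open>
  Quotients of the open trail are connected, so \<open>chi\<close> is nonnegative on them and the conversion
  to natural numbers loses nothing.
\<close>

definition beta :: "word \<Rightarrow> enat" where
  "beta w = (INF P \<in> {P \<in> realizable_quotients w. type_B w P}. enat (nat (chi w P)))"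

end

theory Submission
  imports Defs "HOL-Computational_Algebra.Formal_Power_Series"
begin

text \<open>
  Sorting the fixed points of $w(\sigma)$ by the coincidences along their trajectories gives
  $E(X_w) = \sum_\Gamma (n)_{v} / \prod_i (n)_{e_i}$, summed over the realizable quotients
  $\Gamma$ with $v$ vertices and $e_i$ edges labelled $i$; the summand of $\Gamma$, divided by $n$, is
  $n^{-\chi}(1 + (\sum_i \binom{e_i}{2} - \binom{v}{2}) / n + \dots)$. Hence $a_0$ counts the
  quotients with $\chi = 0$, and if there are none, $a_1$ counts those of type B with $\chi = 1$,
  because the quotient $\Gamma_0$ generated by $\{s_0, s_m\}$ is the only one of type A.
  If moreover $a_1 = 0$, then $a_2$ is the number of quotients with $\chi = 2$ plus the correction
  of $\Gamma_0$, and it remains to see that this correction is minus the number of quotients of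
  type A.

  Those quotients arise from $\Gamma_0$ by identifying two vertices. Pairs of distinct vertices
  form a graph, in which pairs joined by equally labelled edges are adjacent. Folded quotients
  correspond to subgroups of the free group, and a quotient with $\chi = 2$ generated by two
  pairs corresponds to a subgroup that is freely generated by the two corresponding elements $w$
  and $x$. Freeness implies that the graph of pairs is a forest. As $w^a x^{\pm 1} w^b$ are the
  only elements that generate together with $w$ the same subgroup as $x$ does, its components
  are in bijection with the quotients of type A; in a forest they number vertices minus edges.
\<close>

subsection \<open>The free group\<close>

text \<open>Every fact about free groups is extracted from permutation actions on finite sets: a
  finite graph in which letters act deterministically extends to permutations of its vertices
  (\<open>det_graph_extends\<close>), and words that are equal in the group act equally. The path of
  a reduced word, a lollipop and the quotients of the trail are the graphs to which this is applied.
  Freeness of a subgroup with \<open>chi\<close> equal to 2 comes from counting its actions on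
  finite sets.

  The count of type A quotients rests on no quotient having \<open>chi\<close> 0 and only the one
  generated by the ends of the trail having \<open>chi\<close> 1: then identifying two of its
  vertices raises \<open>chi\<close> to exactly 2. This is what the vanishing of the first two
  coefficients provides.

  In the code the pairs are ordered. The graph of pairs then has v(v - 1) vertices, and its edges
  number the sum of e(e - 1) over the labels, twice the binomial terms of the expansion. Each
  quotient of type A accounts for two components that are exchanged by swapping; they differ because
  no walk swaps a pair.\<close>

definition linv :: "nat \<times> bool \<Rightarrow> nat \<times> bool" where
  "linv l = (fst l, \<not> snd l)"

definition winv :: "word \<Rightarrow> word" where
  "winv z = rev (map linv z)"

lemma linv_linv [simp]: "linv (linv l) = l"
  by (simp add: linv_def)

lemma fst_linv [simp]: "fst (linv l) = fst l"
  by (simp add: linv_def)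

lemma snd_linv [simp]: "snd (linv l) = (\<not> snd l)"
  by (simp add: linv_def)

lemma linv_neq [simp]: "linv l \<noteq> l" "l \<noteq> linv l"
  by (auto simp: linv_def prod_eq_iff)

lemma linv_eq_iff [simp]: "linv l = linv l' \<longleftrightarrow> l = l'"
  by (metis linv_linv)

lemma winv_simps [simp]:
  "winv [] = []" "winv (a @ b) = winv b @ winv a" "winv (l # a) = winv a @ [linv l]"
  by (simp_all add: winv_def)

lemma fst_set_winv [simp]: "fst ` set (winv z) = fst ` set z"
  by (force simp: winv_def)

inductive free_eq :: "word \<Rightarrow> word \<Rightarrow> bool" where
  reflI: "free_eq a a"
| cancel: "free_eq (a @ [l, linv l] @ b) (a @ b)"
| symI: "free_eq a b \<Longrightarrow> free_eq b a"
| transI: "free_eq a b \<Longrightarrow> free_eq b c \<Longrightarrow> free_eq a c"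

lemma free_eq_append:
  assumes "free_eq a b" shows "free_eq (c @ a @ d) (c @ b @ d)"
  using assms
proof (induction rule: free_eq.induct)
  case (cancel a l b)
  show ?case using free_eq.cancel[of "c @ a" l "b @ d"] by simp
qed (auto intro: free_eq.reflI free_eq.symI free_eq.transI)

lemma free_eq_append2: "free_eq a b \<Longrightarrow> free_eq c d \<Longrightarrow> free_eq (a @ c) (b @ d)"
  using free_eq_append[of a b "[]" c] free_eq_append[of c d b "[]"] free_eq.transI by auto

lemma free_eq_winv: "free_eq a b \<Longrightarrow> free_eq (winv a) (winv b)"
proof (induction rule: free_eq.induct)
  case (cancel a l b)
  show ?case using free_eq.cancel[of "winv b" l "winv a"] by simp
qed (auto intro: free_eq.reflI free_eq.symI free_eq.transI)

lemma free_eq_winv_append: "free_eq (winv a @ a) []"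
proof (induction a)
  case (Cons l a)
  have "free_eq (winv a @ [linv l, linv (linv l)] @ a) (winv a @ a)"
    by (rule free_eq.cancel)
  then show ?case using Cons by (auto intro: free_eq.transI)
qed (simp add: free_eq.reflI)

quotient_type fgroup = word / free_eq
  by (rule equivpI) (auto intro!: reflpI sympI transpI intro: free_eq.intros)

text \<open>Additive notation, because \<open>group_add\<close> is the class of groups that may be
  noncommutative.\<close>

instantiation fgroup :: group_add
begin

lift_definition zero_fgroup :: fgroup is "[]" .
lift_definition plus_fgroup :: "fgroup \<Rightarrow> fgroup \<Rightarrow> fgroup" is "(@)"
  by (rule free_eq_append2)
lift_definition uminus_fgroup :: "fgroup \<Rightarrow> fgroup" is winv
  by (rule free_eq_winv)
definition minus_fgroup :: "fgroup \<Rightarrow> fgroup \<Rightarrow> fgroup" where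
  "minus_fgroup a b = a + - b"

instance
proof
  fix a b c :: fgroup
  show "a + b + c = a + (b + c)" by transfer (simp add: free_eq.reflI)
  show "0 + a = a" by transfer (simp add: free_eq.reflI)
  show "a + 0 = a" by transfer (simp add: free_eq.reflI)
  show "- a + a = 0" by transfer (rule free_eq_winv_append)
  show "a + - b = a - b" by (simp add: minus_fgroup_def)
qed

end

lift_definition fr :: "word \<Rightarrow> fgroup" is "\<lambda>z. z" .

lemma fr_eq_iff: "fr a = fr b \<longleftrightarrow> free_eq a b"
  by transfer simp

lemma fr_Nil [simp]: "fr [] = 0"
  by transfer (rule free_eq.reflI)

lemma fr_append [simp]: "fr (a @ b) = fr a + fr b"
  by transfer (rule free_eq.reflI)

lemma fr_winv [simp]: "fr (winv a) = - fr a"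
  by transfer (rule free_eq.reflI)

lemma fr_Cons: "fr (l # a) = fr [l] + fr a"
  using fr_append[of "[l]" a] by simp

lemma fr_linv [simp]: "fr [linv l] = - fr [l]"
  using fr_winv[of "[l]"] by simp

lemma ex_fr: "\<exists>z. fr z = a"
  by transfer (auto intro: free_eq.reflI)

subsection \<open>Actions and labelled graphs\<close>

definition lact :: "(nat \<Rightarrow> 'a \<Rightarrow> 'a) \<Rightarrow> nat \<times> bool \<Rightarrow> 'a \<Rightarrow> 'a" where
  "lact \<sigma> l = (if snd l then \<sigma> (fst l) else inv (\<sigma> (fst l)))"

text \<open>A right action as in \<open>word_perm\<close>: the first letter acts first, so acting by
  a word agrees with walking along it.\<close>

primrec act :: "(nat \<Rightarrow> 'a \<Rightarrow> 'a) \<Rightarrow> word \<Rightarrow> 'a \<Rightarrow> 'a" where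
  "act \<sigma> [] x = x"
| "act \<sigma> (l # z) x = act \<sigma> z (lact \<sigma> l x)"

lemma act_append [simp]: "act \<sigma> (a @ b) x = act \<sigma> b (act \<sigma> a x)"
  by (induction a arbitrary: x) auto

lemma lact_linv:
  assumes "\<And>i. bij (\<sigma> i)"
  shows "lact \<sigma> (linv l) (lact \<sigma> l x) = x" "lact \<sigma> l (lact \<sigma> (linv l) x) = x"
  using bij_is_inj[OF assms] bij_is_surj[OF assms]
  by (auto simp: lact_def surj_f_inv_f)

lemma act_free_eq:
  assumes "free_eq a b" "\<And>i. bij (\<sigma> i)"
  shows "act \<sigma> a x = act \<sigma> b x"
  using assms(1)
proof (induction arbitrary: x rule: free_eq.induct)
  case (cancel a l b)
  then show ?case by (simp add: lact_linv[OF assms(2)])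
qed auto

lemma act_cong_fr: "fr a = fr b \<Longrightarrow> (\<And>i. bij (\<sigma> i)) \<Longrightarrow> act \<sigma> a x = act \<sigma> b x"
  by (rule act_free_eq) (simp_all only: fr_eq_iff)

lemma act_winv:
  assumes "\<And>i. bij (\<sigma> i)"
  shows "act \<sigma> (winv a) (act \<sigma> a x) = x" "act \<sigma> a (act \<sigma> (winv a) x) = x"
  using act_cong_fr[of "a @ winv a" "[]" \<sigma> x] act_cong_fr[of "winv a @ a" "[]" \<sigma> x] assms
  by simp_all

definition step :: "(nat \<times> 'v \<times> 'v) set \<Rightarrow> 'v \<Rightarrow> nat \<times> bool \<Rightarrow> 'v \<Rightarrow> bool" where
  "step R u l v \<longleftrightarrow> (if snd l then (fst l, u, v) \<in> R else (fst l, v, u) \<in> R)"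

primrec walk :: "(nat \<times> 'v \<times> 'v) set \<Rightarrow> 'v \<Rightarrow> word \<Rightarrow> 'v \<Rightarrow> bool" where
  "walk R u [] v \<longleftrightarrow> u = v"
| "walk R u (l # z) v \<longleftrightarrow> (\<exists>u'. step R u l u' \<and> walk R u' z v)"

text \<open>\<open>step\<close> also reads edges against their direction, so this single condition
  forbids two equally labelled edges with a common origin as well as two with a common
  terminus.\<close>

definition det_graph :: "(nat \<times> 'v \<times> 'v) set \<Rightarrow> bool" where
  "det_graph R \<longleftrightarrow> (\<forall>u l v v'. step R u l v \<longrightarrow> step R u l v' \<longrightarrow> v = v')"

lemma step_linv [simp]: "step R u (linv l) v \<longleftrightarrow> step R v l u"
  by (simp add: step_def)

lemma walk_append [simp]: "walk R u (a @ b) v \<longleftrightarrow> (\<exists>t. walk R u a t \<and> walk R t b v)"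
  by (induction a arbitrary: u) auto

lemma walk_winv [simp]: "walk R u (winv a) v \<longleftrightarrow> walk R v a u"
  by (induction a arbitrary: u v) auto

lemma det_graph_iff:
  "det_graph R \<longleftrightarrow> (\<forall>i u v u' v'. (i, u, v) \<in> R \<longrightarrow> (i, u', v') \<in> R \<longrightarrow> (u = u' \<longleftrightarrow> v = v'))"
  (is "_ = ?r")
proof
  assume d: "det_graph R"
  have "v = v'" if "(i, u, v) \<in> R" "(i, u, v') \<in> R" for i u v v'
    using d[unfolded det_graph_def, rule_format, of u "(i, True)" v v'] that
    by (simp add: step_def)
  moreover have "u = u'" if "(i, u, v) \<in> R" "(i, u', v) \<in> R" for i v u u'
    using d[unfolded det_graph_def, rule_format, of v "(i, False)" u u'] that
    by (simp add: step_def)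
  ultimately show ?r by blast
next
  assume r: ?r
  show "det_graph R" unfolding det_graph_def step_def
  proof (intro allI impI)
    fix u l v v'
    assume "if snd l then (fst l, u, v) \<in> R else (fst l, v, u) \<in> R"
      "if snd l then (fst l, u, v') \<in> R else (fst l, v', u) \<in> R"
    then show "v = v'" using r by (cases "snd l"; simp; blast)
  qed
qed

lemma det_graph_subset: "det_graph R \<Longrightarrow> R' \<subseteq> R \<Longrightarrow> det_graph R'"
  unfolding det_graph_iff by blast

text \<open>Domain and range of a finite partial injection have complements of equal size in
  \<open>A\<close>; any bijection between these completes it.\<close>

lemma partial_injection_extends:
  fixes p :: "'v rel"
  assumes "finite A" "p \<subseteq> A \<times> A"
    and "\<And>u v u' v'. (u, v) \<in> p \<Longrightarrow> (u', v') \<in> p \<Longrightarrow> u = u' \<longleftrightarrow> v = v'"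
  shows "\<exists>f. f permutes A \<and> (\<forall>(u, v) \<in> p. f u = v)"
proof -
  define g where "g u = (THE v. (u, v) \<in> p)" for u
  have g: "g u = v" if "(u, v) \<in> p" for u v
    unfolding g_def using that assms(3) by blast
  have fin: "finite (Domain p)" "finite (Range p)"
    using assms(1,2) by (auto intro: finite_subset[of _ A])
  have bg: "bij_betw g (Domain p) (Range p)"
    unfolding bij_betw_def inj_on_def using g assms(3) by (fastforce simp: image_iff)
  have sub: "Domain p \<subseteq> A" "Range p \<subseteq> A" using assms(2) by auto
  have "card (A - Domain p) = card (A - Range p)"
    using bij_betw_same_card[OF bg] fin sub by (simp add: card_Diff_subset)
  then obtain h where bh: "bij_betw h (A - Domain p) (A - Range p)"
    using finite_same_card_bij[of "A - Domain p" "A - Range p"] assms(1) by auto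
  define f where "f u = (if u \<in> Domain p then g u else if u \<in> A then h u else u)" for u
  have "bij_betw f (Domain p \<union> (A - Domain p)) (Range p \<union> (A - Range p))"
  proof (rule bij_betw_combine)
    show "bij_betw f (Domain p) (Range p)"
      using bg by (subst bij_betw_cong[where g = g]) (auto simp: f_def)
    show "bij_betw f (A - Domain p) (A - Range p)"
      using bh by (subst bij_betw_cong[where g = h]) (auto simp: f_def)
  qed auto
  then have "bij_betw f A A" using sub by (simp add: Un_absorb1)
  then have "f permutes A" by (rule bij_imp_permutes) (use sub in \<open>auto simp: f_def\<close>)
  then show ?thesis using g by (intro exI[of _ f]) (auto simp: f_def Domain.simps)
qed

text \<open>The source of the finite actions below: a folded finite graph is completed label by
  label, and \<open>walk_act\<close> then turns walks into the action of words.\<close>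

lemma det_graph_extends:
  assumes "det_graph R" "finite A" "\<And>i u v. (i, u, v) \<in> R \<Longrightarrow> u \<in> A \<and> v \<in> A"
  obtains \<sigma> where "\<And>i. \<sigma> i permutes A" "\<And>i u v. (i, u, v) \<in> R \<Longrightarrow> \<sigma> i u = v"
proof -
  have "\<exists>f. f permutes A \<and> (\<forall>(u, v) \<in> {(u, v). (i, u, v) \<in> R}. f u = v)" for i
    using assms by (intro partial_injection_extends) (auto simp: det_graph_iff)
  then obtain \<sigma> where "\<And>i. \<sigma> i permutes A \<and> (\<forall>(u, v) \<in> {(u, v). (i, u, v) \<in> R}. \<sigma> i u = v)"
    by metis
  then show ?thesis by (intro that[of \<sigma>]) auto
qed

lemma walk_act:
  assumes "\<And>i u v. (i, u, v) \<in> R \<Longrightarrow> \<sigma> i u = v" "\<And>i. bij (\<sigma> i)" "walk R u z v"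
  shows "act \<sigma> z u = v"
  using assms(3)
proof (induction z arbitrary: u)
  case (Cons l z)
  then obtain u' where u': "step R u l u'" "walk R u' z v" by auto
  have "lact \<sigma> l u = u'"
    using u'(1) assms(1) by (auto simp: step_def lact_def split: if_splits
      intro!: inv_f_eq bij_is_inj[OF assms(2)])
  then show ?case using Cons.IH[OF u'(2)] by simp
qed simp

text \<open>With \<open>blk P\<close> for \<open>p\<close> this is the quotient graph, with the
  identity the open trail, and with a map into {1..n} the graph that a trajectory sees.\<close>

definition trail_img :: "word \<Rightarrow> (nat \<Rightarrow> 'v) \<Rightarrow> (nat \<times> 'v \<times> 'v) set" where
  "trail_img z p = (\<lambda>(i, a, b). (i, p a, p b)) ` trail_edges z"

lemma step_trail_img:
  "step (trail_img z p) u l v \<longleftrightarrow> (\<exists>j<length z.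
     u = p j \<and> l = z ! j \<and> v = p (Suc j) \<or> u = p (Suc j) \<and> l = linv (z ! j) \<and> v = p j)"
  (is "?l = ?r")
proof
  assume ?l
  then show ?r
    by (cases l) (fastforce simp: step_def trail_img_def trail_edges_def linv_def
       split: if_splits prod.splits)
next
  assume ?r
  then obtain j where j: "j < length z"
     "u = p j \<and> l = z ! j \<and> v = p (Suc j) \<or> u = p (Suc j) \<and> l = linv (z ! j) \<and> v = p j" by blast
  show ?l
    by (cases "z ! j") (use j in \<open>auto simp: step_def trail_img_def trail_edges_def linv_def
         image_iff intro!: bexI[of _ j]\<close>)
qed

lemma walk_trail_img_take:
  "j \<le> length z \<Longrightarrow> walk (trail_img z p) (p 0) (take j z) (p j)"
proof (induction j)
  case (Suc j)
  then have "step (trail_img z p) (p j) (z ! j) (p (Suc j))"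
    unfolding step_trail_img by (intro exI[of _ j]) simp
  then show ?case using Suc by (auto simp: take_Suc_conv_app_nth)
qed simp

lemma det_graph_trail_img_extends:
  assumes "det_graph (trail_img z p)"
  obtains \<sigma> where "\<And>i. \<sigma> i permutes p ` {..length z}"
    "\<And>i u v. (i, u, v) \<in> trail_img z p \<Longrightarrow> \<sigma> i u = v"
proof (rule det_graph_extends[OF assms, of "p ` {..length z}"])
  show "u \<in> p ` {..length z} \<and> v \<in> p ` {..length z}" if "(i, u, v) \<in> trail_img z p" for i u v
    using that by (auto simp: trail_img_def trail_edges_def split: prod.splits if_splits)
qed auto

subsection \<open>Reduced words\<close>

abbreviation reduced :: "word \<Rightarrow> bool" where
  "reduced z \<equiv> successively (\<lambda>l l'. l' \<noteq> linv l) z"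

lemma reduced_winv [simp]: "reduced (winv z) \<longleftrightarrow> reduced z"
  unfolding winv_def successively_rev successively_map linv_linv
  by (rule successively_cong) auto

text \<open>The trail of a reduced word is already folded, since adjacent edges clash only where
  letters cancel. Completing it yields a finite action that moves one end to the other, so a
  nonempty reduced word is nontrivial in the free group.\<close>

lemma reduced_action:
  assumes "reduced z"
  obtains \<sigma> :: "nat \<Rightarrow> nat \<Rightarrow> nat" where "\<And>i. \<sigma> i permutes {..length z}" "act \<sigma> z 0 = length z"
proof -
  have red: "z ! Suc j \<noteq> linv (z ! j)" if "Suc j < length z" for j
    using assms that by (simp add: successively_conv_nth)
  have "det_graph (trail_img z (\<lambda>j. j))"
    unfolding det_graph_def step_trail_img
    by (intro allI impI; elim exE conjE disjE) (auto, metis red, metis red linv_linv)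
  then obtain \<sigma> where \<sigma>: "\<And>i. \<sigma> i permutes (\<lambda>j. j) ` {..length z}"
    "\<And>i u v. (i, u, v) \<in> trail_img z (\<lambda>j. j) \<Longrightarrow> \<sigma> i u = v"
    by (rule det_graph_trail_img_extends) blast
  have b: "bij (\<sigma> i)" for i using \<sigma>(1) permutes_bij by blast
  have "act \<sigma> z 0 = length z"
    using walk_act[of "trail_img z (\<lambda>j. j)" \<sigma> 0 z "length z", OF \<sigma>(2) b]
      walk_trail_img_take[of "length z" z "\<lambda>j. j"] by simp
  then show ?thesis using that[of \<sigma>] \<sigma>(1) by simp
qed

lemma reduced_fr_eq_0:
  assumes "reduced z" "fr z = 0"
  shows "z = []"
proof -
  obtain \<sigma> :: "nat \<Rightarrow> nat \<Rightarrow> nat" where \<sigma>: "\<And>i. \<sigma> i permutes {..length z}" "act \<sigma> z 0 = length z"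
    using reduced_action[OF assms(1)] by blast
  have "act \<sigma> z 0 = 0"
    using act_cong_fr[of z "[]" \<sigma> 0] permutes_bij[OF \<sigma>(1)] assms(2) by simp
  then show ?thesis using \<sigma>(2) by simp
qed

lemma reduced_fr_inj: "reduced z \<Longrightarrow> reduced z' \<Longrightarrow> fr z = fr z' \<Longrightarrow> z = z'"
proof (induction z arbitrary: z')
  case Nil
  then show ?case using reduced_fr_eq_0[of z'] by simp
next
  case (Cons l y)
  show ?case
  proof (cases z')
    case Nil
    then show ?thesis using Cons.prems reduced_fr_eq_0[of "l # y"] by simp
  next
    case (Cons l' y')
    show ?thesis
    proof (cases "l = l'")
      case True
      have "fr [l] + fr y = fr [l] + fr y'"
        using Cons.prems(3) Cons True fr_Cons[of l' y] fr_Cons[of l' y'] by simp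
      then have "fr y = fr y'" by simp
      moreover have "reduced y" "reduced y'"
        using Cons.prems(1,2) unfolding Cons by (auto simp: successively_Cons)
      ultimately show ?thesis using Cons.IH[of y'] Cons True by simp
    next
      case False
      \<comment> \<open>Distinct first letters do not cancel where the inverse of one word meets the
        other.\<close>
      have "reduced (winv (l # y) @ z')"
        unfolding successively_append_iff reduced_winv using Cons.prems False Cons by simp
      moreover have "fr (winv (l # y) @ z') = 0" using Cons.prems(3) by (simp del: winv_simps(3))
      ultimately show ?thesis using reduced_fr_eq_0 Cons by blast
    qed
  qed
qed

text \<open>When a letter cancels against the next one, determinism brings the walk back to the
  vertex it left, so free reduction never leaves the graph.\<close>

lemma reduced_walk:
  assumes "det_graph R" "walk R u z v"
  shows "\<exists>z'. reduced z' \<and> fr z' = fr z \<and> fst ` set z' \<subseteq> fst ` set z \<and> walk R u z' v"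
  using assms(2)
proof (induction z arbitrary: u)
  case (Cons l z)
  then obtain u' where u': "step R u l u'" "walk R u' z v" by auto
  then obtain z' where z': "reduced z'" "fr z' = fr z" "fst ` set z' \<subseteq> fst ` set z" "walk R u' z' v"
    using Cons.IH by blast
  show ?case
  proof (cases "\<exists>y. z' = linv l # y")
    case True
    then obtain y where y: "z' = linv l # y" by blast
    then obtain u'' where "step R u' (linv l) u''" "walk R u'' y v" using z'(4) by auto
    moreover have "step R u' (linv l) u" using u'(1) by simp
    ultimately have "walk R u y v" using assms(1) unfolding det_graph_def by blast
    moreover have "fr y = fr (l # z)"
    proof -
      have "fr z = - fr [l] + fr y" using z'(2) y fr_Cons[of "linv l" y] by simp
      then show ?thesis using fr_Cons[of l z] by simp
    qed
    ultimately show ?thesis using z' y by (intro exI[of _ y]) (auto simp: successively_Cons)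
  next
    case False
    then have "reduced (l # z')" using z'(1) by (cases z') (auto simp: successively_Cons)
    moreover have "fr (l # z') = fr (l # z)" using z'(2) fr_Cons[of l z] fr_Cons[of l z'] by simp
    ultimately show ?thesis using u' z' by (intro exI[of _ "l # z'"]) auto
  qed
qed auto

lemma ex_reduced: "\<exists>z'. reduced z' \<and> fr z' = fr z \<and> fst ` set z' \<subseteq> fst ` set z"
proof -
  \<comment> \<open>One vertex with a loop for every label: every word is a walk in this graph, so
    \<open>reduced_walk\<close> applies to every word.\<close>
  define R :: "(nat \<times> unit \<times> unit) set" where "R = UNIV"
  have "walk R () z ()" by (induction z) (auto simp: step_def R_def)
  moreover have "det_graph R" by (simp add: det_graph_def)
  ultimately show ?thesis using reduced_walk[of R "()" z "()"] by blast
qed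

subsection \<open>Free pairs\<close>

inductive_set sgp :: "'a::group_add set \<Rightarrow> 'a set" for S where
  zero: "0 \<in> sgp S"
| gen: "s \<in> S \<Longrightarrow> s \<in> sgp S"
| plus: "a \<in> sgp S \<Longrightarrow> b \<in> sgp S \<Longrightarrow> a + b \<in> sgp S"
| uminus: "a \<in> sgp S \<Longrightarrow> - a \<in> sgp S"

lemma sgp_uminus_iff: "- a \<in> sgp S \<longleftrightarrow> a \<in> sgp S"
  using sgp.uminus by fastforce

lemma sgp_least:
  assumes "S \<subseteq> sgp T" shows "sgp S \<subseteq> sgp T"
proof
  show "a \<in> sgp T" if "a \<in> sgp S" for a
    using that by induction (use assms in \<open>auto intro: sgp.intros\<close>)
qed

lemma sgp_mono: "S \<subseteq> T \<Longrightarrow> sgp S \<subseteq> sgp T"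
  by (rule sgp_least) (auto intro: sgp.gen)

text \<open>The letters are abstract generators of a subgroup here, evaluated by
  \<open>\<theta>\<close>; they are unrelated to the letters of \<open>w\<close>.\<close>

primrec word_val :: "(nat \<Rightarrow> 'a::group_add) \<Rightarrow> word \<Rightarrow> 'a" where
  "word_val \<theta> [] = 0"
| "word_val \<theta> (l # z) = (if snd l then \<theta> (fst l) else - \<theta> (fst l)) + word_val \<theta> z"

lemma word_val_append [simp]: "word_val \<theta> (a @ b) = word_val \<theta> a + word_val \<theta> b"
  by (induction a) (auto simp: add.assoc)

lemma word_val_winv [simp]: "word_val \<theta> (winv a) = - word_val \<theta> a"
  by (induction a) (auto simp: minus_add)

lemma word_val_cong_fr:
  assumes "fr a = fr b" shows "word_val \<theta> a = word_val \<theta> b"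
proof -
  have "free_eq a b" using assms by (simp only: fr_eq_iff)
  then show ?thesis by induction (auto simp: add.assoc[symmetric])
qed

lemma word_val_in_sgp: "\<theta> ` fst ` set Y \<subseteq> S \<Longrightarrow> word_val \<theta> Y \<in> sgp S"
  by (induction Y) (auto intro: sgp.intros)

lemma sgp_imp_word_val:
  assumes "a \<in> sgp (\<theta> ` I)"
  shows "\<exists>Y. reduced Y \<and> fst ` set Y \<subseteq> I \<and> word_val \<theta> Y = a"
proof -
  have "\<exists>Y. fst ` set Y \<subseteq> I \<and> word_val \<theta> Y = a" using assms
  proof induction
    case zero
    show ?case by (intro exI[of _ "[]"]) simp
  next
    case (gen s)
    then obtain i where "i \<in> I" "s = \<theta> i" by blast
    then show ?case by (intro exI[of _ "[(i, True)]"]) simp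
  next
    case (plus a b)
    then obtain Y Z where "fst ` set Y \<subseteq> I \<and> word_val \<theta> Y = a" "fst ` set Z \<subseteq> I \<and> word_val \<theta> Z = b" by blast
    then show ?case by (intro exI[of _ "Y @ Z"]) auto
  next
    case (uminus a)
    then obtain Y where "fst ` set Y \<subseteq> I \<and> word_val \<theta> Y = a" by blast
    then show ?case by (intro exI[of _ "winv Y"]) auto
  qed
  then obtain Y where Y: "fst ` set Y \<subseteq> I" "word_val \<theta> Y = a" by blast
  obtain Z where "reduced Z" "fr Z = fr Y" "fst ` set Z \<subseteq> fst ` set Y"
    using ex_reduced[of Y] by blast
  then show ?thesis using Y word_val_cong_fr[of Z Y \<theta>] by (intro exI[of _ Z]) auto
qed

lemma reduced_one_letter:
  "reduced Y \<Longrightarrow> fst ` set Y \<subseteq> {i} \<Longrightarrow> \<exists>k \<alpha>. Y = replicate k (i, \<alpha>)"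
proof (induction Y)
  case (Cons l Y)
  then obtain k \<alpha> where Y: "Y = replicate k (i, \<alpha>)" by (auto simp: successively_Cons)
  show ?case
  proof (cases k)
    case 0
    then show ?thesis using Y Cons.prems by (cases l) (auto intro!: exI[of _ 1])
  next
    case (Suc k')
    then have "l = (i, \<alpha>)"
      using Cons.prems Y by (cases l) (auto simp: linv_def)
    then show ?thesis using Y by (intro exI[of _ "Suc k"] exI[of _ \<alpha>]) simp
  qed
qed simp

text \<open>All positive labels name \<open>x\<close>; \<open>free_pair\<close> restricts words to
  the labels 0 and 1.\<close>

definition pair_val :: "'a \<Rightarrow> 'a \<Rightarrow> nat \<Rightarrow> 'a" where
  "pair_val u x i = (if i = 0 then u else x)"

lemma pair_val_simps [simp]: "pair_val u x 0 = u" "pair_val u x (Suc i) = x"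
  by (simp_all add: pair_val_def)

text \<open>Exponent and sign are the same for all \<open>x\<close>, so the power can be inserted
  into words that involve any second generator.\<close>

lemma sgp_sing_power:
  assumes "a \<in> sgp {u}"
  shows "\<exists>k \<alpha>. \<forall>x. a = word_val (pair_val u x) (replicate k (0, \<alpha>))"
proof -
  obtain Y where Y: "reduced Y" "fst ` set Y \<subseteq> {0}" "word_val (\<lambda>_. u) Y = a"
    using sgp_imp_word_val[of a "\<lambda>_. u" "{0}"] assms by auto
  then obtain k \<alpha> where k: "Y = replicate k (0, \<alpha>)" using reduced_one_letter by blast
  have "word_val (\<lambda>_. u) (replicate k (0, \<alpha>)) = word_val (pair_val u x) (replicate k (0, \<alpha>))" for x
    by (induction k) auto
  then show ?thesis using Y(3) k by metis
qed

definition free_pair :: "'a::group_add \<Rightarrow> 'a \<Rightarrow> bool" where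
  "free_pair u x \<longleftrightarrow>
     (\<forall>Y. reduced Y \<longrightarrow> fst ` set Y \<subseteq> {0, 1} \<longrightarrow> word_val (pair_val u x) Y = 0 \<longrightarrow> Y = [])"

text \<open>Peel off the first and the last letter while they are inverse to each other; reducedness
  keeps the core nonempty. The parts \<open>s\<close> and \<open>c\<close> become the stick and the
  circle of the lollipop below.\<close>

lemma reduced_cyclic_decomposition:
  "reduced Y \<Longrightarrow> Y \<noteq> [] \<Longrightarrow> \<exists>s c. Y = s @ c @ winv s \<and> c \<noteq> [] \<and> hd c \<noteq> linv (last c)"
proof (induction Y rule: length_induct)
  case (1 Y)
  show ?case
  proof (cases "hd Y = linv (last Y)")
    case False
    then show ?thesis using 1(3) by (intro exI[of _ "[]"] exI[of _ Y]) simp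
  next
    case True
    then obtain l Y' where Y: "Y = l # Y'" using 1(3) by (cases Y) auto
    with True have "Y' \<noteq> []" by auto
    then obtain Z where Z: "Y = l # Z @ [linv l]" using True Y
      by (cases Y' rule: rev_cases) auto
    then have "Z \<noteq> []" using 1(2) by auto
    moreover have "reduced Z" using 1(2) Z by (auto simp: successively_Cons successively_append_iff)
    ultimately obtain s c where "Z = s @ c @ winv s \<and> c \<noteq> [] \<and> hd c \<noteq> linv (last c)"
      using 1(1) Z by (metis Suc_lessD length_Cons length_append_singleton less_Suc_eq)
    then show ?thesis using Z by (intro exI[of _ "l # s"] exI[of _ c]) simp
  qed
qed

text \<open>The witness is the lollipop graph that reads \<open>Y\<close>, with a loop labelled 0 at its base point.\<close>

lemma reduced_action_fixing_base:
  assumes red: "reduced Y" and fst1: "fst (hd Y) = 1" "fst (last Y) = 1" and len: "length Y \<ge> 2"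
  obtains \<sigma> :: "nat \<Rightarrow> nat \<Rightarrow> nat"
    where "\<And>i. bij (\<sigma> i)" "\<sigma> 0 0 = 0" "act \<sigma> Y 0 = 0" "\<sigma> 1 0 \<noteq> 0"
proof -
  have "Y \<noteq> []" using len by auto
  then obtain s c where Y: "Y = s @ c @ winv s" and c: "c \<noteq> []" "hd c \<noteq> linv (last c)"
    using reduced_cyclic_decomposition red by blast
  define y where "y = s @ c"
  define L where "L = length y"
  \<comment> \<open>The last vertex of the path reading \<open>s @ c\<close> is glued to the end of
    \<open>s\<close>, which closes the circle.\<close>
  define q where "q j = (if j = L then length s else j)" for j
  define R where "R = insert (0, 0, 0) (trail_img y q)"
  have sL: "length s < L" "L > 0" using c by (auto simp: L_def y_def)
  have redy: "y ! Suc j \<noteq> linv (y ! j)" if "Suc j < L" for j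
  proof -
    have "reduced y" using red unfolding Y y_def append.assoc[symmetric]
      by (simp only: successively_append_iff)
    then show ?thesis using that by (simp add: successively_conv_nth L_def)
  qed
  have "L - 1 = length s + (length c - 1)" using c by (cases c) (auto simp: L_def y_def)
  then have ys: "y ! length s = hd c" "y ! (L - 1) = last c"
    using c by (simp_all add: y_def nth_append hd_conv_nth last_conv_nth)
  have lasts: "last c \<noteq> y ! (length s - 1)" if "s \<noteq> []"
  proof -
    have "y ! (length s - 1) = last s" using that by (simp add: y_def nth_append last_conv_nth)
    moreover have "hd (winv s) = linv (last s)" using that by (simp add: winv_def hd_rev last_map)
    moreover have "hd (winv s) \<noteq> linv (last c)"
      using red that c by (auto simp: Y successively_append_iff winv_def)
    ultimately show ?thesis by auto
  qed
  have y0: "fst (y ! 0) = 1"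
    using fst1(1) c Y by (cases s; cases c) (auto simp: y_def)
  have lastc: "fst (last c) = 1" if "s = []" using fst1(2) Y that by simp
  have stepR: "step R u l v \<longleftrightarrow> u = 0 \<and> v = 0 \<and> fst l = 0 \<or> step (trail_img y q) u l v" for u l v
    by (auto simp: R_def step_def)
  have sdet: "v = v'"
    if "step (trail_img y q) u l v" "step (trail_img y q) u l v'" for u l v v'
  proof -
    obtain j where j: "j < L" "u = q j \<and> l = y ! j \<and> v = q (Suc j) \<or>
        u = q (Suc j) \<and> l = linv (y ! j) \<and> v = q j"
      using \<open>step (trail_img y q) u l v\<close> unfolding step_trail_img L_def by blast
    obtain k where k: "k < L" "u = q k \<and> l = y ! k \<and> v' = q (Suc k) \<or>
        u = q (Suc k) \<and> l = linv (y ! k) \<and> v' = q k"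
      using \<open>step (trail_img y q) u l v'\<close> unfolding step_trail_img L_def by blast
    \<comment> \<open>At the gluing point this is excluded because \<open>c\<close> is cyclically
      reduced, elsewhere because \<open>y\<close> is reduced.\<close>
    have FB: False if "a < L" "b < L" "q a = q (Suc b)" "y ! a = linv (y ! b)" for a b
    proof (cases "Suc b = L")
      case True
      then have "a = length s" "b = L - 1" using that by (auto simp: q_def)
      then show False using that(4) ys c by simp
    next
      case False
      then show False using that redy[of b] by (auto simp: q_def split: if_splits)
    qed
    \<comment> \<open>Two edges enter the gluing point, one from the stick and one from the circle.
      Equal letters on them would cancel between \<open>c\<close> and \<open>winv s\<close>.\<close>
    have BB': False if "a < L" "Suc b = L" "q (Suc a) = length s" "y ! a = y ! b" "Suc a \<noteq> L" for a b
    proof -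
      have "Suc a = length s" "b = L - 1" using that by (auto simp: q_def)
      then have "s \<noteq> []" "a = length s - 1" by auto
      then show False using lasts ys that(4) \<open>b = L - 1\<close> by auto
    qed
    have BB: "a = b" if "a < L" "b < L" "q (Suc a) = q (Suc b)" "y ! a = y ! b" for a b
    proof (cases "Suc a = L \<or> Suc b = L")
      case True
      then show ?thesis using BB'[of a b] BB'[of b a] that by (auto simp: q_def split: if_splits)
    next
      case False
      then show ?thesis using that by (auto simp: q_def)
    qed
    consider "u = q j" "l = y ! j" "v = q (Suc j)" "u = q k" "l = y ! k" "v' = q (Suc k)"
      | "u = q j" "l = y ! j" "u = q (Suc k)" "l = linv (y ! k)"
      | "u = q k" "l = y ! k" "u = q (Suc j)" "l = linv (y ! j)"
      | "u = q (Suc j)" "l = linv (y ! j)" "v = q j" "u = q (Suc k)" "l = linv (y ! k)" "v' = q k"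
      using j(2) k(2) by blast
    then show ?thesis
    proof cases
      case 1
      then show ?thesis using j(1) k(1) by (simp add: q_def)
    next
      case 2
      then show ?thesis using FB[of j k] j(1) k(1) by simp
    next
      case 3
      then show ?thesis using FB[of k j] j(1) k(1) by simp
    next
      case 4
      then show ?thesis using BB[of j k] j(1) k(1) by simp
    qed
  qed
  \<comment> \<open>The edges at the base point carry the first letter of \<open>Y\<close> and, if
    \<open>s\<close> is empty, also its last letter. Both have label 1, so the loop labelled 0
    causes no clash.\<close>
  have no_loop: False if st: "step (trail_img y q) 0 l v" "fst l = 0" for l v
  proof -
    obtain j where j: "j < L" "0 = q j \<and> l = y ! j \<or> 0 = q (Suc j) \<and> l = linv (y ! j)"
      using st(1) unfolding step_trail_img L_def by blast
    then consider "j = 0" "l = y ! j" | "Suc j = L" "s = []" "l = linv (y ! j)"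
      by (auto simp: q_def split: if_splits)
    then show False
    proof cases
      case 1
      then show ?thesis using y0 that(2) by simp
    next
      case 2
      then have "j = L - 1" by simp
      then show ?thesis using 2 lastc ys that(2) by simp
    qed
  qed
  have det: "det_graph R"
    unfolding det_graph_def stepR using sdet no_loop by blast
  have "u \<in> {..L} \<and> v \<in> {..L}" if "(i, u, v) \<in> R" for i u v
    using that sL by (auto simp: R_def trail_img_def trail_edges_def q_def L_def
        split: prod.splits if_splits)
  then obtain \<sigma> where \<sigma>: "\<And>i. \<sigma> i permutes {..L}" "\<And>i u v. (i, u, v) \<in> R \<Longrightarrow> \<sigma> i u = v"
    using det_graph_extends[OF det, of "{..L}"] by (metis finite_atMost)
  have bij: "bij (\<sigma> i)" for i using \<sigma>(1) permutes_bij by blast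
  have mono: "walk R u z v" if "walk (trail_img y q) u z v" for u z v
    using that by (induction z arbitrary: u) (auto simp: stepR)
  have "walk R 0 s (length s)" "walk R 0 (s @ c) (length s)"
    using mono[OF walk_trail_img_take[of "length s" y q]]
      mono[OF walk_trail_img_take[of L y q]] sL
    by (auto simp: q_def y_def L_def)
  then have "walk R 0 Y 0" unfolding Y by auto
  then have act0: "act \<sigma> Y 0 = 0" using walk_act[of R \<sigma>, OF \<sigma>(2) bij] by blast
  \<comment> \<open>With a single edge the letter 1 would fix the base point; this is where
    \<open>length Y \<ge> 2\<close> enters.\<close>
  have "L \<noteq> 1"
  proof
    assume "L = 1"
    then have "s = []" "length c = 1" using c by (auto simp: L_def y_def) (cases c; simp)+
    then show False using len Y by simp
  qed
  then have "q (Suc 0) = 1" "q 0 = 0" using sL by (auto simp: q_def)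
  then have "step R 0 (y ! 0) 1"
    using sL unfolding stepR step_trail_img L_def by (intro disjI2 exI[of _ 0]) auto
  then have "(1, 0, 1) \<in> R \<or> (1, 1, 0) \<in> R" using y0 by (auto simp: step_def split: if_splits)
  then have "\<sigma> 1 0 \<noteq> 0" using \<sigma>(2) bij_is_inj[OF bij, of 1] by (metis injD zero_neq_one)
  moreover have "\<sigma> 0 0 = 0" by (rule \<sigma>(2)) (simp add: R_def)
  ultimately show ?thesis using that bij act0 by blast
qed

lemma word_strip_letter:
  obtains A Z B where "Y = A @ Z @ B" "fst ` set A \<subseteq> {i}" "fst ` set B \<subseteq> {i}"
    "Z = [] \<or> fst (hd Z) \<noteq> i \<and> fst (last Z) \<noteq> i"
proof -
  define P where "P l = (fst l = i)" for l :: "'a \<times> 'b"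
  define A where "A = takeWhile P Y"
  define Y' where "Y' = dropWhile P Y"
  define B where "B = rev (takeWhile P (rev Y'))"
  define Z where "Z = rev (dropWhile P (rev Y'))"
  have Y': "Y' = Z @ B" unfolding Z_def B_def by (simp flip: rev_append)
  have "Y = A @ Z @ B" unfolding Y'[symmetric] by (simp add: A_def Y'_def)
  moreover have "fst ` set A \<subseteq> {i}" "fst ` set B \<subseteq> {i}"
    by (auto simp: A_def B_def P_def dest!: set_takeWhileD)
  moreover have "fst (hd Z) \<noteq> i \<and> fst (last Z) \<noteq> i" if "Z \<noteq> []"
  proof
    have "Y' \<noteq> []" "hd Y' = hd Z" using that Y' by auto
    then show "fst (hd Z) \<noteq> i" using hd_dropWhile[of P Y] by (simp add: Y'_def P_def)
    show "fst (last Z) \<noteq> i" using hd_dropWhile[of P "rev Y'"] that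
      by (simp add: Z_def last_rev P_def)
  qed
  ultimately show ?thesis using that by blast
qed

text \<open>Write \<open>y\<close> as a reduced word in \<open>u\<close> and \<open>x\<close> and
  strip the powers of \<open>u\<close> at both ends. If at least two letters remain, then in the
  lollipop action \<open>u\<close> and \<open>y\<close> fix the base point while \<open>x\<close>
  moves it, which contradicts \<open>x \<in> sgp {u, y}\<close>.\<close>

lemma free_pair_second_generator:
  fixes u x y :: "'a::group_add"
  assumes free: "free_pair u x" and y: "y \<in> sgp {u, x}" and x: "x \<in> sgp {u, y}"
  shows "y \<in> sgp {u} \<or> (\<exists>p\<in>sgp {u}. \<exists>q\<in>sgp {u}. y = p + x + q \<or> y = p + - x + q)"
proof -
  let ?ev = "word_val (pair_val u x)"
  have "y \<in> sgp (pair_val u x ` {0, 1})" using y by simp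
  then obtain Y where Y: "reduced Y" "fst ` set Y \<subseteq> {0, 1}" "?ev Y = y"
    using sgp_imp_word_val by blast
  obtain A Z B where AZB: "Y = A @ Z @ B" "fst ` set A \<subseteq> {0}" "fst ` set B \<subseteq> {0}"
    "Z = [] \<or> fst (hd Z) \<noteq> 0 \<and> fst (last Z) \<noteq> 0"
    by (rule word_strip_letter)
  have inu: "?ev A \<in> sgp {u}" "?ev B \<in> sgp {u}" using AZB by (auto intro!: word_val_in_sgp)
  have redZ: "reduced Z" using Y(1) AZB(1) by (auto simp: successively_append_iff)
  have ysum: "y = ?ev A + ?ev Z + ?ev B" using Y(3) AZB(1) by (simp add: add.assoc)
  consider "Z = []" | "length Z = 1" | "length Z \<ge> 2"
    by (cases Z; cases "tl Z") auto
  then show ?thesis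
  proof cases
    case 1
    then show ?thesis using ysum inu by (auto intro: sgp.plus)
  next
    case 2
    then obtain l where "Z = [l]" by (cases Z) auto
    moreover have "fst l = 1" using Y(2) AZB \<open>Z = [l]\<close> by auto
    ultimately have "?ev Z = x \<or> ?ev Z = - x" by auto
    then show ?thesis using ysum inu by metis
  next
    case 3
    then have "Z \<noteq> []" by auto
    then have "fst (hd Z) \<in> {0, 1}" "fst (last Z) \<in> {0, 1}"
      using Y(2) AZB(1) imageI[OF hd_in_set[of Z], of fst] imageI[OF last_in_set[of Z], of fst]
      by (auto simp del: image_eqI)
    then have "fst (hd Z) = 1" "fst (last Z) = 1" using AZB(4) \<open>Z \<noteq> []\<close> by auto
    then obtain \<sigma> :: "nat \<Rightarrow> nat \<Rightarrow> nat" where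
      \<sigma>: "\<And>i. bij (\<sigma> i)" "\<sigma> 0 0 = 0" "act \<sigma> Z 0 = 0" "\<sigma> 1 0 \<noteq> 0"
      using reduced_action_fixing_base[OF redZ _ _ 3] by blast
    have act0: "act \<sigma> C 0 = 0" if "fst ` set C \<subseteq> {0}" for C
      using that
    proof (induction C)
      case (Cons l C)
      have "inv (\<sigma> 0) 0 = 0" using \<sigma>(2) bij_is_inj[OF \<sigma>(1)] by (simp add: inv_f_eq)
      then show ?case using Cons \<sigma>(2) by (auto simp: lact_def)
    qed simp
    \<comment> \<open>The action is defined on words only and not on elements of \<open>'a\<close>,
      so the induction carries along a word with the right value that fixes the base point.\<close>
    have "\<exists>W. fst ` set W \<subseteq> {0, 1} \<and> ?ev W = z \<and> act \<sigma> W 0 = 0" if "z \<in> sgp {u, y}" for z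
      using that
    proof induction
      case zero
      show ?case by (intro exI[of _ "[]"]) simp
    next
      case (gen s)
      then consider "s = u" | "s = y" by blast
      then show ?case
      proof cases
        case 1
        then show ?thesis using \<sigma>(2) by (intro exI[of _ "[(0, True)]"]) (simp add: lact_def)
      next
        case 2
        then show ?thesis using Y AZB \<sigma>(3) act0 by (intro exI[of _ Y]) simp
      qed
    next
      case (plus a b)
      then obtain V W where "fst ` set V \<subseteq> {0, 1} \<and> ?ev V = a \<and> act \<sigma> V 0 = 0"
        "fst ` set W \<subseteq> {0, 1} \<and> ?ev W = b \<and> act \<sigma> W 0 = 0" by blast
      then show ?case by (intro exI[of _ "V @ W"]) auto
    next
      case (uminus a)
      then obtain V where V: "fst ` set V \<subseteq> {0, 1} \<and> ?ev V = a \<and> act \<sigma> V 0 = 0" by blast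
      then have "act \<sigma> (winv V) 0 = 0" using act_winv(1)[of \<sigma> V 0] \<sigma>(1) by simp
      then show ?case using V by (intro exI[of _ "winv V"]) auto
    qed
    then obtain W where W: "fst ` set W \<subseteq> {0, 1}" "?ev W = x" "act \<sigma> W 0 = 0" using x by blast
    \<comment> \<open>By freeness the word found for \<open>x\<close> equals the letter 1 in the
      free group, so both act alike.\<close>
    obtain W' where W': "reduced W'" "fr W' = fr (W @ [(1, False)])"
        "fst ` set W' \<subseteq> fst ` set (W @ [(1, False)])"
      using ex_reduced[of "W @ [(1, False)]"] by blast
    have "?ev W' = ?ev (W @ [(1, False)])" using W'(2) by (rule word_val_cong_fr)
    also have "\<dots> = 0" using W(2) by simp
    finally have "?ev W' = 0" .
    moreover have "fst ` set W' \<subseteq> {0, 1}" using W'(3) W(1) by fastforce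
    ultimately have "W' = []" using free W'(1) unfolding free_pair_def by blast
    then have "fr (W @ [(1, False)]) = fr []" using W'(2) by simp
    then have "act \<sigma> (W @ [(1, False)]) (0::nat) = act \<sigma> [] 0"
      by (rule act_cong_fr) (rule \<sigma>(1))
    then have "inv (\<sigma> 1) 0 = 0" using W(3) by (simp add: lact_def)
    then have "\<sigma> 1 0 = 0" using bij_is_surj[OF \<sigma>(1), of 1] surj_f_inv_f by metis
    then show ?thesis using \<sigma>(4) by simp
  qed
qed

subsection \<open>Folded partitions and subgroups\<close>

definition blk :: "nat set set \<Rightarrow> nat \<Rightarrow> nat set" where
  "blk P a = {b. same_block P a b}"

definition pre :: "word \<Rightarrow> nat \<Rightarrow> fgroup" where
  "pre w j = fr (take j w)"

lemma pre_0 [simp]: "pre w 0 = 0"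
  by (simp add: pre_def)

lemma pre_length: "pre w (length w) = fr w"
  by (simp add: pre_def)

lemma pre_Suc: "j < length w \<Longrightarrow> pre w (Suc j) = pre w j + fr [w ! j]"
  by (simp add: pre_def take_Suc_conv_app_nth)

lemma trail_vertices_iff [simp]: "a \<in> trail_vertices w \<longleftrightarrow> a \<le> length w"
  by (simp add: trail_vertices_def)

context
  fixes w :: word and P :: "nat set set"
  assumes P: "partition_on (trail_vertices w) P"
begin

lemma blk_eq: "U \<in> P \<Longrightarrow> a \<in> U \<Longrightarrow> blk P a = U"
proof -
  assume U: "U \<in> P" "a \<in> U"
  have "V = U" if "V \<in> P" "a \<in> V" for V
    using partition_onD2[OF P] U that unfolding disjoint_def by blast
  then show "blk P a = U" using U unfolding blk_def same_block_def by blast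
qed

lemma blk_in: "a \<le> length w \<Longrightarrow> blk P a \<in> P \<and> a \<in> blk P a"
proof -
  assume "a \<le> length w"
  then obtain U where "U \<in> P" "a \<in> U" using partition_onD1[OF P] by (metis UnionE trail_vertices_iff)
  then show ?thesis using blk_eq by simp
qed

lemma same_block_iff:
  "a \<le> length w \<Longrightarrow> b \<le> length w \<Longrightarrow> same_block P a b \<longleftrightarrow> blk P a = blk P b"
  using blk_in[of a] blk_in[of b] blk_eq by (auto simp: same_block_def)

lemma mem_partition_iff: "U \<in> P \<longleftrightarrow> (\<exists>a\<le>length w. U = blk P a)"
proof
  assume U: "U \<in> P"
  then obtain a where "a \<in> U" using partition_onD3[OF P] by (metis ex_in_conv)
  moreover have "a \<le> length w" using partition_onD1[OF P] U \<open>a \<in> U\<close>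
    by (metis UnionI trail_vertices_iff)
  ultimately show "\<exists>a\<le>length w. U = blk P a" using blk_eq U by metis
qed (use blk_in in auto)

lemma partition_eq_image: "P = blk P ` {..length w}"
  using mem_partition_iff by auto

lemma quotient_edges_eq: "quotient_edges w P = trail_img w (blk P)"
proof -
  have tr: "u \<le> length w \<and> v \<le> length w" if "(i, u, v) \<in> trail_edges w" for i u v
    using that by (auto simp: trail_edges_def split: prod.splits if_splits)
  show ?thesis
  proof (intro set_eqI iffI)
    fix x assume "x \<in> quotient_edges w P"
    then obtain i U V u v where x: "x = (i, U, V)" "U \<in> P" "V \<in> P" "u \<in> U" "v \<in> V"
      "(i, u, v) \<in> trail_edges w" by (auto simp: quotient_edges_def)
    then have "x = (i, blk P u, blk P v)" using blk_eq by simp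
    then show "x \<in> trail_img w (blk P)" using x(6) by (force simp: trail_img_def)
  next
    fix x assume "x \<in> trail_img w (blk P)"
    then obtain i u v where x: "x = (i, blk P u, blk P v)" "(i, u, v) \<in> trail_edges w"
      by (auto simp: trail_img_def)
    then show "x \<in> quotient_edges w P"
      using blk_in tr[OF x(2)] by (auto simp: quotient_edges_def)
  qed
qed

lemma folded_iff: "folded w P \<longleftrightarrow> det_graph (trail_img w (blk P))"
  unfolding folded_def det_graph_iff quotient_edges_eq by blast

lemma refines_blk:
  assumes "refines (trail_vertices w) P Q" "a \<le> length w" "b \<le> length w" "blk P a = blk P b"
  shows "blk Q a = blk Q b"
proof -
  have Q: "partition_on (trail_vertices w) Q" using assms(1) by (simp add: refines_def)
  obtain U where U: "U \<in> Q" "blk P a \<subseteq> U"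
    using assms(1) blk_in[OF assms(2)] by (auto simp: refines_def)
  then have "a \<in> U" "b \<in> U" using blk_in[OF assms(2)] blk_in[OF assms(3)] assms(4) by auto
  moreover have "V = U" if "V \<in> Q" "c \<in> V" "c \<in> U" for V c
    using partition_onD2[OF Q] U(1) that unfolding disjoint_def by blast
  ultimately show ?thesis using U(1) unfolding blk_def same_block_def by blast
qed

end

lemma partition_eqI:
  assumes "partition_on (trail_vertices w) P" "partition_on (trail_vertices w) Q"
    and "\<And>a b. a \<le> length w \<Longrightarrow> b \<le> length w \<Longrightarrow> blk P a = blk P b \<longleftrightarrow> blk Q a = blk Q b"
  shows "P = Q"
proof -
  have le: "b \<le> length w" if b: "b \<in> blk R a" "partition_on (trail_vertices w) R" for R a b
  proof -
    obtain U where "U \<in> R" "b \<in> U" using b(1) by (auto simp: blk_def same_block_def)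
    then show ?thesis using partition_onD1[OF b(2)] by (metis UnionI trail_vertices_iff)
  qed
  have mem: "b \<in> blk R a \<longleftrightarrow> b \<le> length w \<and> blk R a = blk R b"
    if "a \<le> length w" "partition_on (trail_vertices w) R" for R a b
    using le[OF _ that(2)] same_block_iff[OF that(2,1)] unfolding blk_def by blast
  have "b \<in> blk P a \<longleftrightarrow> b \<in> blk Q a" if "a \<le> length w" for a b
    using mem[OF that assms(1), of b] mem[OF that assms(2), of b] assms(3)[OF that, of b] by auto
  then have "blk P ` {..length w} = blk Q ` {..length w}" by (intro image_cong) auto
  then show ?thesis
    by (rule trans[OF partition_eq_image[OF assms(1)] trans[OF _ partition_eq_image[OF assms(2), symmetric]]])
qed

text \<open>Conditions (2) and (3) compare two traversals of one label in equal and in opposite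
  directions. Together they say that a letter, read forwards or backwards, leads from a block to
  only one block, which is foldedness.\<close>

lemma realizable_iff:
  "realizable w P \<longleftrightarrow> partition_on (trail_vertices w) P \<and> blk P 0 = blk P (length w) \<and> folded w P"
proof (cases "partition_on (trail_vertices w) P")
  case True
  note sb = same_block_iff[OF True]
  have "det_graph (trail_img w (blk P)) \<longleftrightarrow>
     (\<forall>h<length w. \<forall>l<length w. fst (w ! h) = fst (w ! l) \<and> snd (w ! h) = snd (w ! l) \<longrightarrow>
        (same_block P h l \<longleftrightarrow> same_block P (Suc h) (Suc l))) \<and>
     (\<forall>h<length w. \<forall>l<length w. fst (w ! h) = fst (w ! l) \<and> snd (w ! h) \<noteq> snd (w ! l) \<longrightarrow>
        (same_block P h (Suc l) \<longleftrightarrow> same_block P (Suc h) l))" (is "?d = (?A \<and> ?B)")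
  proof
    assume d: ?d
    have s: "step (trail_img w (blk P)) (blk P h) (w ! h) (blk P (Suc h))" if "h < length w" for h
      using that by (auto simp: step_trail_img)
    then have s': "step (trail_img w (blk P)) (blk P (Suc h)) (linv (w ! h)) (blk P h)"
      if "h < length w" for h using that by simp
    have ?A
    proof (intro allI impI)
      fix h l assume hl: "h < length w" "l < length w" "fst (w ! h) = fst (w ! l) \<and> snd (w ! h) = snd (w ! l)"
      then have "w ! h = w ! l" by (simp add: prod_eq_iff)
      then show "same_block P h l \<longleftrightarrow> same_block P (Suc h) (Suc l)"
        using s[of h] s[of l] s'[of h] s'[of l] d hl sb unfolding det_graph_def by (metis Suc_leI less_imp_le)
    qed
    moreover have ?B
    proof (intro allI impI)
      fix h l assume hl: "h < length w" "l < length w" "fst (w ! h) = fst (w ! l) \<and> snd (w ! h) \<noteq> snd (w ! l)"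
      then have "w ! h = linv (w ! l)" by (simp add: prod_eq_iff)
      then show "same_block P h (Suc l) \<longleftrightarrow> same_block P (Suc h) l"
        using s[of h] s[of l] s'[of h] s'[of l] d hl sb unfolding det_graph_def
        by (metis Suc_leI less_imp_le linv_linv)
    qed
    ultimately show "?A \<and> ?B" by blast
  next
    assume AB: "?A \<and> ?B"
    have A: "blk P h = blk P l \<longleftrightarrow> blk P (Suc h) = blk P (Suc l)"
      if "h < length w" "l < length w" "w ! h = w ! l" for h l
      using AB that sb by (metis Suc_leI less_imp_le)
    have B: "blk P h = blk P (Suc l) \<longleftrightarrow> blk P (Suc h) = blk P l"
      if "h < length w" "l < length w" "w ! h = linv (w ! l)" for h l
      using AB that sb by (metis Suc_leI less_imp_le fst_linv snd_linv)
    show ?d unfolding det_graph_def step_trail_img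
    proof (intro allI impI)
      fix u l v v'
      assume "\<exists>j<length w. u = blk P j \<and> l = w ! j \<and> v = blk P (Suc j) \<or>
              u = blk P (Suc j) \<and> l = linv (w ! j) \<and> v = blk P j"
        and "\<exists>j<length w. u = blk P j \<and> l = w ! j \<and> v' = blk P (Suc j) \<or>
              u = blk P (Suc j) \<and> l = linv (w ! j) \<and> v' = blk P j"
      then show "v = v'"
        by (elim exE conjE disjE) (use A B in \<open>auto; metis linv_linv\<close>)+
    qed
  qed
  then show ?thesis using True sb[of 0 "length w"] folded_iff[OF True] by (auto simp: realizable_def)
qed (simp add: realizable_def)

section \<open>Prefixes along walks and coset partitions\<close>

lemma step_pre:
  assumes "step (trail_img w p) u l v"
  shows "\<exists>a b. a \<le> length w \<and> b \<le> length w \<and> u = p a \<and> v = p b \<and> pre w b = pre w a + fr [l]"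
proof -
  obtain j where j: "j < length w"
    "u = p j \<and> l = w ! j \<and> v = p (Suc j) \<or> u = p (Suc j) \<and> l = linv (w ! j) \<and> v = p j"
    using assms by (auto simp: step_trail_img)
  from j(2) show ?thesis
  proof
    assume "u = p j \<and> l = w ! j \<and> v = p (Suc j)"
    then show ?thesis using j(1) by (intro exI[of _ j] exI[of _ "Suc j"]) (simp add: pre_Suc)
  next
    assume "u = p (Suc j) \<and> l = linv (w ! j) \<and> v = p j"
    then show ?thesis using j(1)
      by (intro exI[of _ "Suc j"] exI[of _ j]) (simp add: pre_Suc add.assoc)
  qed
qed

lemma sgp_trans: "a - b \<in> sgp S \<Longrightarrow> b - c \<in> sgp S \<Longrightarrow> a - c \<in> sgp S"
  using sgp.plus[of "a - b" S "b - c"] by (simp add: add_diff_eq)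

lemma sgp_sym: "a - b \<in> sgp S \<Longrightarrow> b - a \<in> sgp S"
  using sgp.uminus[of "a - b" S] by simp

lemma diff_add_right_cancel: "(a + c) - (b + c) = a - (b::'a::group_add)"
  by (metis add_diff_cancel diff_diff_add diff_add_eq_diff_diff_swap)

text \<open>Every letter of a walk multiplies the prefix on the right, while a change of
  representative within a block multiplies it on the left by an element of the subgroup.\<close>

lemma walk_pre:
  assumes H: "\<And>a b. a \<le> length w \<Longrightarrow> b \<le> length w \<Longrightarrow> p a = p b \<Longrightarrow> pre w a - pre w b \<in> sgp S"
    and "walk (trail_img w p) (p a) z (p b)" "a \<le> length w" "b \<le> length w"
  shows "pre w a + fr z - pre w b \<in> sgp S"
  using assms(2,3)
proof (induction z arbitrary: a)
  case Nil
  then show ?case using H[of a b] assms(4) by simp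
next
  case (Cons l z)
  then obtain u where u: "step (trail_img w p) (p a) l u" "walk (trail_img w p) u z (p b)" by auto
  then obtain c d where cd: "c \<le> length w" "d \<le> length w" "p a = p c" "u = p d" "pre w d = pre w c + fr [l]"
    using step_pre[OF u(1)] by blast
  have "pre w a - pre w c \<in> sgp S" using H cd Cons.prems by simp
  moreover have "pre w d + fr z - pre w b \<in> sgp S" using Cons.IH[of d] u cd by simp
  ultimately have "(pre w a - pre w c) + (pre w d + fr z - pre w b) \<in> sgp S" by (rule sgp.plus)
  moreover have "(pre w a - pre w c) + (pre w d + fr z - pre w b) = pre w a + fr (l # z) - pre w b"
    unfolding cd(5) fr_Cons[of l z] by (simp add: add.assoc flip: add_uminus_conv_diff)
  ultimately show ?case by simp
qed

text \<open>The difference of two prefixes lies in the subgroup iff both represent the same right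
  coset, so this is the part of the Schreier coset graph that the trail visits. Every folded
  quotient has this form by \<open>ex_generating_set\<close> and
  \<open>generates_iff\<close>.\<close>

definition coset_part :: "word \<Rightarrow> fgroup set \<Rightarrow> nat set set" where
  "coset_part w S =
     (\<lambda>a. {b. b \<le> length w \<and> pre w a - pre w b \<in> sgp S}) ` {..length w}"

lemma partition_coset: "partition_on (trail_vertices w) (coset_part w S)"
proof (rule partition_onI)
  show "\<Union> (coset_part w S) = trail_vertices w"
    by (auto simp: coset_part_def intro!: exI[of _ "x::nat" for x] sgp.zero)
next
  fix U V assume "U \<in> coset_part w S" "V \<in> coset_part w S" "U \<noteq> V"
  then obtain a b where U: "U = {c. c \<le> length w \<and> pre w a - pre w c \<in> sgp S}"
    and V: "V = {c. c \<le> length w \<and> pre w b - pre w c \<in> sgp S}" by (auto simp: coset_part_def)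
  show "disjnt U V"
  proof (rule ccontr)
    assume "\<not> disjnt U V"
    then obtain c where "pre w a - pre w c \<in> sgp S" "pre w b - pre w c \<in> sgp S"
      by (auto simp: disjnt_def U V)
    then have "pre w a - pre w b \<in> sgp S" "pre w b - pre w a \<in> sgp S" by (meson sgp_trans sgp_sym)+
    then have "U = V" unfolding U V using sgp_trans by blast
    then show False using \<open>U \<noteq> V\<close> by simp
  qed
next
  have "a \<in> {b. b \<le> length w \<and> pre w a - pre w b \<in> sgp S}" if "a \<le> length w" for a
    using that by (simp add: sgp.zero)
  then show "{} \<notin> coset_part w S" unfolding coset_part_def by blast
qed

lemma blk_coset:
  assumes "a \<le> length w" "b \<le> length w"
  shows "blk (coset_part w S) a = blk (coset_part w S) b \<longleftrightarrow> pre w a - pre w b \<in> sgp S"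
proof -
  have U: "{c. c \<le> length w \<and> pre w a - pre w c \<in> sgp S} \<in> coset_part w S"
    using assms by (auto simp: coset_part_def)
  have "same_block (coset_part w S) a b \<longleftrightarrow> pre w a - pre w b \<in> sgp S"
  proof
    assume "same_block (coset_part w S) a b"
    then obtain c where "pre w c - pre w a \<in> sgp S" "pre w c - pre w b \<in> sgp S"
      by (auto simp: same_block_def coset_part_def)
    then show "pre w a - pre w b \<in> sgp S" by (meson sgp_trans sgp_sym)
  next
    assume "pre w a - pre w b \<in> sgp S"
    then show "same_block (coset_part w S) a b"
      unfolding same_block_def using U assms by (intro bexI[OF _ U]) (auto intro: sgp.zero)
  qed
  then show ?thesis using same_block_iff[OF partition_coset assms] by blast
qed

text \<open>Right multiplication by a letter is a bijection on right cosets.\<close>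

lemma folded_coset: "folded w (coset_part w S)"
  unfolding folded_iff[OF partition_coset] det_graph_def
proof (intro allI impI)
  let ?p = "blk (coset_part w S)"
  fix u l v v' assume st: "step (trail_img w ?p) u l v" "step (trail_img w ?p) u l v'"
  obtain a b where ab: "a \<le> length w" "b \<le> length w" "u = ?p a" "v = ?p b" "pre w b = pre w a + fr [l]"
    using step_pre[OF st(1)] by blast
  obtain a' b' where ab': "a' \<le> length w" "b' \<le> length w" "u = ?p a'" "v' = ?p b'"
      "pre w b' = pre w a' + fr [l]"
    using step_pre[OF st(2)] by blast
  have "pre w a - pre w a' \<in> sgp S" using ab(3) ab'(3) blk_coset[OF ab(1) ab'(1), of S] by simp
  then have "pre w b - pre w b' \<in> sgp S" unfolding ab ab' diff_add_right_cancel .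
  then show "v = v'" using ab(4) ab'(4) blk_coset[OF ab(2) ab'(2), of S] by simp
qed

text \<open>Pairs are unordered, so each one contributes an element together with its
  inverse.\<close>

definition pair_gens :: "word \<Rightarrow> nat set set \<Rightarrow> fgroup set" where
  "pair_gens w E = {pre w a - pre w b |a b. {a, b} \<in> E}"

definition vertex_pairs :: "word \<Rightarrow> nat set set" where
  "vertex_pairs w = {{a, b} |a b. a \<in> trail_vertices w \<and> b \<in> trail_vertices w}"

lemma sgp_stabilizer:
  assumes "x \<in> sgp S" "\<And>i. bij (\<sigma> i)" "\<And>z. fr z \<in> S \<Longrightarrow> act \<sigma> z b = b" "fr z = x"
  shows "act \<sigma> z b = b"
  using assms(1,4)
proof (induction arbitrary: z)
  case zero
  then show ?case using act_cong_fr[of z "[]" \<sigma> b] assms(2) by simp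
next
  case (gen s)
  then show ?case using assms(3) by blast
next
  case (plus x y)
  obtain zx zy where "fr zx = x" "fr zy = y" using ex_fr by metis
  then show ?case using plus act_cong_fr[of z "zx @ zy" \<sigma> b] assms(2) by simp
next
  case (uminus x)
  have "act \<sigma> (winv z) b = b" using uminus by simp
  then show ?case using act_winv(2)[of \<sigma> z b] assms(2) by simp
qed

text \<open>The graph of the folded \<open>Q\<close> extends to permutations. Each generator labels
  a closed walk at the block of 0 and hence fixes this block; so does the whole subgroup, and then
  the prefixes of \<open>a\<close> and \<open>b\<close> lead from it to the same block.\<close>

lemma admissible_sgp:
  assumes adm: "admissible w E Q" and E: "E \<subseteq> vertex_pairs w"
    and ab: "a \<le> length w" "b \<le> length w" "pre w a - pre w b \<in> sgp (pair_gens w E)"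
  shows "blk Q a = blk Q b"
proof -
  have Q: "partition_on (trail_vertices w) Q" using adm by (simp add: admissible_def)
  have det: "det_graph (trail_img w (blk Q))"
    using adm folded_iff[OF Q] by (simp add: admissible_def)
  then obtain \<sigma> where \<sigma>: "\<And>i. \<sigma> i permutes blk Q ` {..length w}"
    "\<And>i u v. (i, u, v) \<in> trail_img w (blk Q) \<Longrightarrow> \<sigma> i u = v"
    by (rule det_graph_trail_img_extends) blast
  have bij: "bij (\<sigma> i)" for i using \<sigma>(1) permutes_bij by blast
  have act: "act \<sigma> (take j w) (blk Q 0) = blk Q j" if "j \<le> length w" for j
    by (rule walk_act[of "trail_img w (blk Q)" \<sigma>, OF \<sigma>(2) bij walk_trail_img_take[OF that]])
  have inv: "act \<sigma> (winv (take j w)) (blk Q j) = blk Q 0" if "j \<le> length w" for j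
    using act_winv(1)[of \<sigma> "take j w" "blk Q 0", OF bij] act[OF that] by simp
  have stab: "act \<sigma> z (blk Q 0) = blk Q 0" if z: "fr z \<in> pair_gens w E" for z
  proof -
    obtain c d where cd: "fr z = pre w c - pre w d" "{c, d} \<in> E"
      using z by (auto simp: pair_gens_def)
    have le: "c \<le> length w" "d \<le> length w"
      using E cd(2) by (auto simp: vertex_pairs_def doubleton_eq_iff)
    obtain U where "U \<in> Q" "{c, d} \<subseteq> U" using adm cd(2) by (auto simp: admissible_def)
    then have "blk Q c = blk Q d" using blk_eq[OF Q, of U c] blk_eq[OF Q, of U d] by simp
    moreover have "act \<sigma> z (blk Q 0) = act \<sigma> (take c w @ winv (take d w)) (blk Q 0)"
      using cd(1) by (intro act_cong_fr bij) (simp add: pre_def)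
    ultimately show ?thesis using act[OF le(1)] inv[OF le(2)] by simp
  qed
  have "act \<sigma> (take a w @ winv (take b w)) (blk Q 0) = blk Q 0"
    by (rule sgp_stabilizer[OF ab(3) bij stab]) (simp_all add: pre_def)
  then have "act \<sigma> (winv (take b w)) (blk Q a) = blk Q 0" using act[OF ab(1)] by simp
  then show ?thesis using act_winv(2)[of \<sigma> "take b w" "blk Q a", OF bij] act[OF ab(2)] by simp
qed

lemma admissible_coset:
  assumes "E \<subseteq> vertex_pairs w" shows "admissible w E (coset_part w (pair_gens w E))"
  unfolding admissible_def
proof (intro conjI ballI partition_coset folded_coset)
  fix e assume "e \<in> E"
  then obtain a b where e: "e = {a, b}" "a \<le> length w" "b \<le> length w"
    using assms by (auto simp: vertex_pairs_def)
  then have "pre w a - pre w b \<in> sgp (pair_gens w E)"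
    using \<open>e \<in> E\<close> by (auto simp: pair_gens_def intro!: sgp.gen)
  then have "same_block (coset_part w (pair_gens w E)) a b"
    using blk_coset[OF e(2,3), of "pair_gens w E"] same_block_iff[OF partition_coset e(2,3)] by simp
  then show "\<exists>U\<in>coset_part w (pair_gens w E). e \<subseteq> U" using e by (auto simp: same_block_def)
qed

text \<open>The coset partition is admissible by \<open>admissible_coset\<close> and refines every
  admissible one by \<open>admissible_sgp\<close>. Which quotient a set of pairs generates is thus
  decided by its subgroup.\<close>

lemma generates_iff:
  "generates w E P \<longleftrightarrow> E \<subseteq> vertex_pairs w \<and> P = coset_part w (pair_gens w E)"
proof
  assume g: "generates w E P"
  then have E: "E \<subseteq> vertex_pairs w" and adm: "admissible w E P"
    and ref: "refines (trail_vertices w) P (coset_part w (pair_gens w E))"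
    using admissible_coset by (auto simp: generates_def vertex_pairs_def)
  have P: "partition_on (trail_vertices w) P" using adm by (simp add: admissible_def)
  have "P = coset_part w (pair_gens w E)"
  proof (rule partition_eqI[OF P partition_coset])
    fix a b assume ab: "a \<le> length w" "b \<le> length w"
    show "blk P a = blk P b \<longleftrightarrow>
        blk (coset_part w (pair_gens w E)) a = blk (coset_part w (pair_gens w E)) b"
      using refines_blk[OF P ref ab] admissible_sgp[OF adm E ab] blk_coset[OF ab] by blast
  qed
  then show "E \<subseteq> vertex_pairs w \<and> P = coset_part w (pair_gens w E)" using E by blast
next
  assume EP: "E \<subseteq> vertex_pairs w \<and> P = coset_part w (pair_gens w E)"
  have "refines (trail_vertices w) (coset_part w (pair_gens w E)) Q" if "admissible w E Q" for Q
    unfolding refines_def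
  proof (intro conjI partition_coset ballI)
    show Q: "partition_on (trail_vertices w) Q" using that by (simp add: admissible_def)
    fix U assume "U \<in> coset_part w (pair_gens w E)"
    then obtain a where U: "U = {b. b \<le> length w \<and> pre w a - pre w b \<in> sgp (pair_gens w E)}" "a \<le> length w"
      by (auto simp: coset_part_def)
    have "b \<in> blk Q a" if "b \<in> U" for b
      using that admissible_sgp[OF \<open>admissible w E Q\<close> _ U(2)] EP U blk_in[OF Q] by auto
    then show "\<exists>V\<in>Q. U \<subseteq> V" using blk_in[OF Q U(2)] by blast
  qed
  then show "generates w E P"
    using EP admissible_coset by (auto simp: generates_def vertex_pairs_def)
qed

subsection \<open>Euler characteristic and freeness\<close>

definition qedge :: "word \<Rightarrow> (nat \<Rightarrow> 'v) \<Rightarrow> nat \<Rightarrow> nat \<times> 'v \<times> 'v" where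
  "qedge w p j = (if snd (w ! j) then (fst (w ! j), p j, p (Suc j)) else (fst (w ! j), p (Suc j), p j))"

lemma trail_img_eq: "trail_img w p = qedge w p ` {..<length w}"
  unfolding trail_img_def trail_edges_def image_image
  by (rule image_cong) (auto simp: qedge_def split: prod.splits)

lemma qedge_eqD:
  "qedge w p j = qedge w p l \<Longrightarrow>
     w ! j = w ! l \<and> p j = p l \<and> p (Suc j) = p (Suc l) \<or>
     w ! j = linv (w ! l) \<and> p j = p (Suc l) \<and> p (Suc j) = p l"
  by (auto simp: qedge_def prod_eq_iff split: if_splits)

text \<open>
  The trail traverses the edges of the quotient one after the other; those edges whose first
  traversal leads to a vertex not visited before form a spanning tree.
\<close>

definition nontree :: "word \<Rightarrow> (nat \<Rightarrow> 'v) \<Rightarrow> nat set" where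
  "nontree w p = {j. j < length w \<and> qedge w p j \<notin> qedge w p ` {..<j} \<and> p (Suc j) \<in> p ` {..j}}"

lemma finite_nontree [simp]: "finite (nontree w p)"
  by (simp add: nontree_def)

lemma card_image_first: "card (f ` {..<n}) = card {j. j < n \<and> f j \<notin> f ` {..<j}}" for n :: nat
proof (induction n)
  case (Suc n)
  have eq: "{j. j < Suc n \<and> f j \<notin> f ` {..<j}} =
      (if f n \<in> f ` {..<n} then {} else {n}) \<union> {j. j < n \<and> f j \<notin> f ` {..<j}}"
    by (auto simp: less_Suc_eq)
  show ?case
    using Suc by (auto simp: eq lessThan_Suc insert_absorb card_insert_if)
qed simp

text \<open>Each vertex but the first is discovered by exactly one letter, each edge is first
  traversed by exactly one letter, and a letter that discovers a vertex runs over a new edge. The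
  letters over new edges that discover nothing are the surplus of edges over vertices.\<close>

lemma chi_eq_card_nontree:
  assumes "partition_on (trail_vertices w) P"
  shows "chi w P = int (card (nontree w (blk P)))"
proof -
  let ?m = "length w" and ?p = "blk P"
  define A where "A = {j. j < ?m \<and> ?p (Suc j) \<notin> ?p ` {..j}}"
  have "P = ?p ` {..<Suc ?m}" using partition_eq_image[OF assms] by (simp add: lessThan_Suc_atMost)
  then have "card P = card {j. j < Suc ?m \<and> ?p j \<notin> ?p ` {..<j}}"
    using card_image_first[of ?p "Suc ?m"] by simp
  \<comment> \<open>Letter \<open>j\<close> leads to vertex \<open>Suc j\<close>, hence the shift; 0
    is the start of the trail, which no letter discovers.\<close>
  also have "{j. j < Suc ?m \<and> ?p j \<notin> ?p ` {..<j}} = insert 0 (Suc ` A)"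
  proof (rule set_eqI)
    show "j \<in> {j. j < Suc ?m \<and> ?p j \<notin> ?p ` {..<j}} \<longleftrightarrow> j \<in> insert 0 (Suc ` A)" for j
      by (cases j) (auto simp: A_def lessThan_Suc_atMost)
  qed
  also have "card \<dots> = Suc (card A)" by (subst card_insert_disjoint) (auto simp: A_def card_image)
  finally have cP: "card P = Suc (card A)" .
  have "card (quotient_edges w P) = card {j. j < ?m \<and> qedge w ?p j \<notin> qedge w ?p ` {..<j}}"
    unfolding quotient_edges_eq[OF assms] trail_img_eq by (rule card_image_first)
  also have "{j. j < ?m \<and> qedge w ?p j \<notin> qedge w ?p ` {..<j}} = A \<union> nontree w ?p"
  proof -
    have "qedge w ?p j \<notin> qedge w ?p ` {..<j}" if "j \<in> A" for j
    proof
      assume "qedge w ?p j \<in> qedge w ?p ` {..<j}"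
      then obtain l where "l < j" "qedge w ?p j = qedge w ?p l" by auto
      then have "?p (Suc j) \<in> ?p ` {..j}" using qedge_eqD[of w ?p j l] by auto
      then show False using that by (simp add: A_def)
    qed
    then show ?thesis by (auto simp: A_def nontree_def)
  qed
  also have "card \<dots> = card A + card (nontree w ?p)"
    by (rule card_Un_disjoint) (auto simp: A_def nontree_def)
  finally show ?thesis using cP by (simp add: chi_def)
qed

text \<open>One pair for each letter outside the tree: its end and an earlier vertex of the same
  block. All other coincidences are forced by folding.\<close>

lemma ex_generating_set:
  assumes P: "partition_on (trail_vertices w) P" and fol: "folded w P"
  shows "\<exists>E. generates w E P \<and> finite E \<and> int (card E) = chi w P"
proof -
  let ?p = "blk P"
  define bk where "bk j = (SOME i. i \<le> j \<and> ?p i = ?p (Suc j))" for j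
  define E where "E = (\<lambda>j. {bk j, Suc j}) ` nontree w ?p"
  have bk: "bk j \<le> j \<and> ?p (bk j) = ?p (Suc j)" if "j \<in> nontree w ?p" for j
    unfolding bk_def by (rule someI_ex) (use that in \<open>force simp: nontree_def\<close>)
  have "inj_on (\<lambda>j. {bk j, Suc j}) (nontree w ?p)"
  proof (rule inj_onI)
    fix j k assume jk: "j \<in> nontree w ?p" "k \<in> nontree w ?p" "{bk j, Suc j} = {bk k, Suc k}"
    then show "j = k" using bk[of j] bk[of k] by (auto simp: doubleton_eq_iff)
  qed
  then have cE: "int (card E) = chi w P"
    by (simp add: E_def card_image chi_eq_card_nontree[OF P])
  have le: "j < length w" if "j \<in> nontree w ?p" for j using that by (simp add: nontree_def)
  have Ev: "E \<subseteq> vertex_pairs w"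
  proof
    fix e assume "e \<in> E"
    then obtain j where j: "j \<in> nontree w ?p" "e = {bk j, Suc j}" by (auto simp: E_def)
    then show "e \<in> vertex_pairs w" using bk[of j] le[of j] unfolding vertex_pairs_def
      by (intro CollectI exI[of _ "bk j"] exI[of _ "Suc j"]) auto
  qed
  have adm: "admissible w E P"
    unfolding admissible_def
  proof (intro conjI ballI P fol)
    fix e assume "e \<in> E"
    then obtain j where j: "j \<in> nontree w ?p" "e = {bk j, Suc j}" by (auto simp: E_def)
    then show "\<exists>U\<in>P. e \<subseteq> U"
      using bk[of j] le[of j] blk_in[OF P, of "Suc j"] blk_in[OF P, of "bk j"]
      by (intro bexI[of _ "?p (Suc j)"]) auto
  qed
  let ?H = "sgp (pair_gens w E)"
  \<comment> \<open>Induction along the trail, where only coincidences of the new vertex with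
    earlier ones are at stake. If the edge was traversed before, they are inherited from that
    traversal; otherwise the letter lies outside the tree and its pair is a generator.\<close>
  have all: "pre w a - pre w b \<in> ?H" if "n \<le> length w" "a \<le> n" "b \<le> n" "?p a = ?p b" for n a b
    using that
  proof (induction n arbitrary: a b)
    case 0
    then show ?case by (simp add: sgp.zero)
  next
    case (Suc n)
    have IH: "pre w a - pre w b \<in> ?H" if "a \<le> n" "b \<le> n" "?p a = ?p b" for a b
      using Suc.IH that Suc.prems(1) by simp
    have new: "pre w (Suc n) - pre w b \<in> ?H" if b: "b \<le> n" "?p (Suc n) = ?p b" for b
    proof (cases "qedge w ?p n \<in> qedge w ?p ` {..<n}")
      case True
      then obtain l where l: "l < n" "qedge w ?p n = qedge w ?p l" by auto
      from qedge_eqD[OF l(2)] show ?thesis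
      proof
        assume e: "w ! n = w ! l \<and> ?p n = ?p l \<and> ?p (Suc n) = ?p (Suc l)"
        have "pre w n - pre w l \<in> ?H" using e l IH by simp
        then have "pre w (Suc n) - pre w (Suc l) \<in> ?H"
          using e l Suc.prems(1) by (simp add: pre_Suc diff_add_right_cancel)
        moreover have "pre w (Suc l) - pre w b \<in> ?H" using e l IH b by simp
        ultimately show ?thesis by (rule sgp_trans)
      next
        assume e: "w ! n = linv (w ! l) \<and> ?p n = ?p (Suc l) \<and> ?p (Suc n) = ?p l"
        have "pre w n - pre w (Suc l) \<in> ?H" using e l IH by simp
        moreover have "pre w (Suc n) - pre w l = pre w n - pre w (Suc l)"
          using e l Suc.prems(1) by (simp add: pre_Suc diff_add_eq_diff_diff_swap)
        ultimately have "pre w (Suc n) - pre w l \<in> ?H" by simp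
        moreover have "pre w l - pre w b \<in> ?H" using e l IH b by simp
        ultimately show ?thesis by (rule sgp_trans)
      qed
    next
      case False
      then have n: "n \<in> nontree w ?p" using Suc.prems(1) b by (auto simp: nontree_def)
      then have "{Suc n, bk n} \<in> E" by (auto simp: E_def insert_commute)
      then have "pre w (Suc n) - pre w (bk n) \<in> ?H" by (auto simp: pair_gens_def intro!: sgp.gen)
      moreover have "pre w (bk n) - pre w b \<in> ?H" using bk[OF n] b IH by simp
      ultimately show ?thesis by (rule sgp_trans)
    qed
    consider "a = b" | "a = Suc n" "b \<le> n" | "b = Suc n" "a \<le> n" | "a \<le> n" "b \<le> n"
      using Suc.prems(2,3) by linarith
    then show ?case
    proof cases
      case 1
      then show ?thesis by (simp add: sgp.zero)
    next
      case 2
      then show ?thesis using new[of b] Suc.prems(4) by simp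
    next
      case 3
      then show ?thesis using sgp_sym[OF new[of a]] Suc.prems(4) by simp
    next
      case 4
      then show ?thesis using IH[of a b] Suc.prems(4) by simp
    qed
  qed
  have "P = coset_part w (pair_gens w E)"
  proof (rule partition_eqI[OF P partition_coset])
    fix a b assume ab: "a \<le> length w" "b \<le> length w"
    show "?p a = ?p b \<longleftrightarrow>
        blk (coset_part w (pair_gens w E)) a = blk (coset_part w (pair_gens w E)) b"
      unfolding blk_coset[OF ab] using all[of "length w" a b] admissible_sgp[OF adm Ev ab] ab by auto
  qed
  then have "generates w E P" using Ev generates_iff[of w E P] by simp
  moreover have "finite E" by (simp add: E_def)
  ultimately show ?thesis using cE by (intro exI[of _ E] conjI)
qed

text \<open>The covering of the graph given by permutation voltages: a copy of the fibre
  \<open>'a\<close> sits over each vertex, and traversing an edge applies the permutation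
  \<open>V\<close> of that edge.\<close>

definition skew :: "(nat \<Rightarrow> 'v \<Rightarrow> 'v) \<Rightarrow> (nat \<times> 'v \<times> 'v \<Rightarrow> 'a \<Rightarrow> 'a) \<Rightarrow> nat \<Rightarrow> 'v \<times> 'a \<Rightarrow> 'v \<times> 'a" where
  "skew \<pi> V i = (\<lambda>(B, t). (\<pi> i B, V (i, B, \<pi> i B) t))"

text \<open>The voltage collected along an initial piece of the trail, that is, how the fibre over
  its start is carried to the fibre over vertex \<open>j\<close>.\<close>

primrec pot :: "word \<Rightarrow> (nat \<Rightarrow> 'v) \<Rightarrow> (nat \<times> 'v \<times> 'v \<Rightarrow> 'a \<Rightarrow> 'a) \<Rightarrow> nat \<Rightarrow> 'a \<Rightarrow> 'a" where
  "pot w p V 0 = id"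
| "pot w p V (Suc j) =
     (if snd (w ! j) then V (qedge w p j) else inv (V (qedge w p j))) \<circ> pot w p V j"

lemma bij_skew:
  assumes "\<And>i. bij (\<pi> i)" "\<And>e. bij (V e)"
  shows "bij (skew \<pi> V i)"
proof (rule bijI)
  show "inj (skew \<pi> V i)"
  proof (rule injI)
    fix x y assume eq: "skew \<pi> V i x = skew \<pi> V i y"
    obtain B t C s where xy: "x = (B, t)" "y = (C, s)" by (metis surj_pair)
    with eq have "\<pi> i B = \<pi> i C" by (simp add: skew_def)
    then have "B = C" using bij_is_inj[OF assms(1)] by (metis injD)
    moreover have "t = s" using eq xy \<open>B = C\<close> injD[OF bij_is_inj[OF assms(2)]] by (auto simp: skew_def)
    ultimately show "x = y" using xy by simp
  qed
  show "surj (skew \<pi> V i)"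
  proof (rule surjI)
    show "skew \<pi> V i (let B = inv (\<pi> i) (fst x) in (B, inv (V (i, B, \<pi> i B)) (snd x))) = x" for x
      using bij_is_surj[OF assms(1)] bij_is_surj[OF assms(2)]
      by (simp add: skew_def Let_def surj_f_inv_f)
  qed
qed

lemma bij_pot:
  assumes "\<And>e. bij (V e)"
  shows "bij (pot w p V j)"
proof (induction j)
  case 0
  show ?case by (simp only: pot.simps bij_id)
next
  case (Suc j)
  then show ?case unfolding pot.simps by (intro bij_comp) (simp_all add: assms bij_imp_bij_inv)
qed

lemma pot_permutes:
  assumes "\<And>e. V e permutes A"
  shows "pot w p V j permutes A"
proof (induction j)
  case 0
  show ?case by (simp only: pot.simps permutes_id)
next
  case (Suc j)
  then show ?case unfolding pot.simps
    by (intro permutes_compose) (simp_all add: assms permutes_inv)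
qed

context
  fixes w :: word and p :: "nat \<Rightarrow> 'v" and \<pi> :: "nat \<Rightarrow> 'v \<Rightarrow> 'v"
  assumes \<pi>: "\<And>i. bij (\<pi> i)" "\<And>i u v. (i, u, v) \<in> trail_img w p \<Longrightarrow> \<pi> i u = v"
begin

lemma act_skew_take:
  assumes V: "\<And>e. bij (V e)" and "j \<le> length w"
  shows "act (skew \<pi> V) (take j w) (p 0, t) = (p j, pot w p V j t)"
  using assms(2)
proof (induction j)
  case (Suc j)
  have e: "qedge w p j \<in> trail_img w p" using Suc.prems by (auto simp: trail_img_eq)
  have "lact (skew \<pi> V) (w ! j) (p j, s) =
      (p (Suc j), (if snd (w ! j) then V (qedge w p j) else inv (V (qedge w p j))) s)" for s
  proof (cases "snd (w ! j)")
    case True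
    then have "\<pi> (fst (w ! j)) (p j) = p (Suc j)" using \<pi>(2) e by (simp add: qedge_def)
    then show ?thesis using True by (simp add: lact_def skew_def qedge_def)
  next
    case False
    then have s: "\<pi> (fst (w ! j)) (p (Suc j)) = p j" using \<pi>(2) e by (simp add: qedge_def)
    have "skew \<pi> V (fst (w ! j)) (p (Suc j), inv (V (qedge w p j)) s) = (p j, s)"
      using False s bij_is_surj[OF V] by (simp add: skew_def qedge_def surj_f_inv_f)
    then show ?thesis
      using False bij_is_inj[OF bij_skew[where \<pi> = \<pi> and V = V, OF \<pi>(1) V]] by (simp add: lact_def inv_f_eq)
  qed
  then show ?case using Suc by (simp add: take_Suc_conv_app_nth)
qed simp

text \<open>Out along the prefix of \<open>a\<close> and back along that of \<open>b\<close> is a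
  closed walk since \<open>p a = p b\<close>, so it acts on the fibre over the base.\<close>

lemma act_skew_pair:
  assumes V: "\<And>e. bij (V e)" and ab: "a \<le> length w" "b \<le> length w" "p a = p b"
  shows "act (skew \<pi> V) (take a w @ winv (take b w)) (p 0, t) =
     (p 0, inv (pot w p V b) (pot w p V a t))"
proof -
  let ?s = "inv (pot w p V b) (pot w p V a t)"
  have "act (skew \<pi> V) (take b w) (p 0, ?s) = (p a, pot w p V a t)"
    using act_skew_take[OF V ab(2)] ab(3) bij_is_surj[OF bij_pot[of V w p b, OF V]]
    by (simp add: surj_f_inv_f)
  then show ?thesis
    using act_skew_take[OF V ab(1), where t = t]
      act_winv(1)[of "skew \<pi> V" "take b w" "(p 0, ?s)", OF bij_skew[where \<pi> = \<pi> and V = V, OF \<pi>(1) V]]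
    by simp
qed

end

text \<open>Two actions that agree on generators agree on the subgroup, here on the fibre over
  \<open>b\<close> only. That \<open>\<tau>\<close> is bijective and common to both actions carries
  the induction through inverses.\<close>

lemma sgp_intertwine:
  assumes "x \<in> sgp S" "\<And>i. bij (\<sigma> i)" "\<And>i. bij (\<sigma>' i)"
    and gens: "\<And>z. fr z \<in> S \<Longrightarrow>
      \<exists>\<tau>. bij \<tau> \<and> (\<forall>t. act \<sigma> z (b, t) = (b, \<tau> t) \<and> act \<sigma>' z (b, t) = (b, \<tau> t))"
    and "fr z = x"
  shows "\<exists>\<tau>. bij \<tau> \<and> (\<forall>t. act \<sigma> z (b, t) = (b, \<tau> t) \<and> act \<sigma>' z (b, t) = (b, \<tau> t))"
  using assms(1,5)
proof (induction arbitrary: z)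
  case zero
  then have "fr z = fr []" by simp
  then show ?case using act_cong_fr[of z "[]" \<sigma>, OF _ assms(2)] act_cong_fr[of z "[]" \<sigma>', OF _ assms(3)]
    by (intro exI[of _ id] conjI bij_id) simp
next
  case (gen s)
  then show ?case using gens by blast
next
  case (plus x y)
  obtain zx zy where z: "fr zx = x" "fr zy = y" using ex_fr by metis
  obtain f g where f: "bij f" "\<forall>t. act \<sigma> zx (b, t) = (b, f t) \<and> act \<sigma>' zx (b, t) = (b, f t)"
    and g: "bij g" "\<forall>t. act \<sigma> zy (b, t) = (b, g t) \<and> act \<sigma>' zy (b, t) = (b, g t)"
    using plus.IH(1)[OF z(1)] plus.IH(2)[OF z(2)] by blast
  have "fr z = fr (zx @ zy)" using plus.prems z by simp
  then show ?case using f(2) g(2)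
      act_cong_fr[of z "zx @ zy" \<sigma>, OF _ assms(2)] act_cong_fr[of z "zx @ zy" \<sigma>', OF _ assms(3)]
    by (intro exI[of _ "g \<circ> f"] conjI bij_comp[OF f(1) g(1)]) simp
next
  case (uminus x)
  then have "fr (winv z) = x" by simp
  then obtain f where f: "bij f" "\<And>t. act \<sigma> (winv z) (b, t) = (b, f t) \<and> act \<sigma>' (winv z) (b, t) = (b, f t)"
    using uminus.IH[of "winv z"] by blast
  have "act \<sigma> z (b, t) = (b, inv f t) \<and> act \<sigma>' z (b, t) = (b, inv f t)" for t
    using f(2)[of "inv f t"] bij_is_surj[OF f(1)]
      act_winv(2)[of \<sigma> z "(b, inv f t)", OF assms(2)] act_winv(2)[of \<sigma>' z "(b, inv f t)", OF assms(3)]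
    by (simp add: surj_f_inv_f)
  then show ?case using f(1) bij_imp_bij_inv by blast
qed


text \<open>Voltages on the spanning tree are normalised to the identity, so the permutations
  indexed by \<open>nontree\<close> are the free parameters.\<close>

definition volt :: "word \<Rightarrow> (nat \<Rightarrow> 'v) \<Rightarrow> (nat \<Rightarrow> 'a \<Rightarrow> 'a) \<Rightarrow> nat \<times> 'v \<times> 'v \<Rightarrow> 'a \<Rightarrow> 'a" where
  "volt w p c e =
     (if e \<in> qedge w p ` nontree w p then c (inv_into (nontree w p) (qedge w p) e) else id)"

lemma inj_on_qedge_nontree: "inj_on (qedge w p) (nontree w p)"
proof (rule inj_onI)
  fix j k assume jk: "j \<in> nontree w p" "k \<in> nontree w p" "qedge w p j = qedge w p k"
  have "qedge w p j \<notin> qedge w p ` {..<j}" "qedge w p k \<notin> qedge w p ` {..<k}"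
    using jk(1,2) by (simp_all add: nontree_def)
  then have "\<not> j < k" "\<not> k < j" using jk(3) by (metis imageI lessThan_iff)+
  then show "j = k" by simp
qed

lemma volt_nontree: "j \<in> nontree w p \<Longrightarrow> volt w p c (qedge w p j) = c j"
  by (simp add: volt_def inv_into_f_f[OF inj_on_qedge_nontree[of w p]])

definition vdiff :: "word \<Rightarrow> nat \<times> nat \<Rightarrow> fgroup" where
  "vdiff w ab = pre w (fst ab) - pre w (snd ab)"

text \<open>
  A family of permutations indexed by the edges outside the spanning tree gives a permutation
  representation of the subgroup, and the representation determines the family. Comparing the
  number of families with the number of possible images of the generators yields both the bound
  on the number of generators and, in case of equality, that these images are arbitrary.
\<close>

context
  fixes w :: word and P :: "nat set set" and A :: "(nat \<times> nat) set"
  assumes P: "partition_on (trail_vertices w) P" and fol: "folded w P"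
    and A: "A \<subseteq> {..length w} \<times> {..length w}"
    and AP: "\<And>a b. (a, b) \<in> A \<Longrightarrow> blk P a = blk P b"
    and PA: "\<And>a b. a \<le> length w \<Longrightarrow> b \<le> length w \<Longrightarrow> blk P a = blk P b \<Longrightarrow>
        pre w a - pre w b \<in> sgp (vdiff w ` A)"
begin

lemma finite_pairs: "finite A"
  using A finite_subset by blast

text \<open>Induction along the trail. Tree edges carry equal voltages by assumption; a letter
  outside the tree closes a walk whose action on the fibre is the same in both representations, and
  this gives its voltage.\<close>

lemma representation_determines_voltage:
  assumes V: "\<And>e. bij (V e :: 'a \<Rightarrow> 'a)" and V': "\<And>e. bij (V' e)"
    and tree: "\<And>e. e \<notin> qedge w (blk P) ` nontree w (blk P) \<Longrightarrow> V e = V' e"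
    and eq: "\<And>a b. (a, b) \<in> A \<Longrightarrow> inv (pot w (blk P) V b) \<circ> pot w (blk P) V a =
        inv (pot w (blk P) V' b) \<circ> pot w (blk P) V' a"
    and "j < length w"
  shows "V (qedge w (blk P) j) = V' (qedge w (blk P) j)"
proof -
  let ?p = "blk P"
  let ?q = "pot w (blk P) V" and ?q' = "pot w (blk P) V'"
  obtain \<pi> where \<pi>: "\<And>i. \<pi> i permutes ?p ` {..length w}"
    "\<And>i u v. (i, u, v) \<in> trail_img w ?p \<Longrightarrow> \<pi> i u = v"
    using fol unfolding folded_iff[OF P] by (rule det_graph_trail_img_extends) blast
  have bij\<pi>: "bij (\<pi> i)" for i using \<pi>(1) permutes_bij by blast
  have pair: "act (skew \<pi> U) (take a w @ winv (take b w)) (?p 0, t) =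
      (?p 0, inv (pot w ?p U b) (pot w ?p U a t))"
    if "\<And>e. bij (U e)" "a \<le> length w" "b \<le> length w" "?p a = ?p b"
    for U :: "nat \<times> nat set \<times> nat set \<Rightarrow> 'a \<Rightarrow> 'a" and a b t
    by (rule act_skew_pair) (use bij\<pi> \<pi>(2) that in auto)
  note bs = bij_skew[where \<pi> = \<pi> and V = V, OF bij\<pi> V]
  note bs' = bij_skew[where \<pi> = \<pi> and V = V', OF bij\<pi> V']
  note bq = bij_pot[where V = V, OF V] and bq' = bij_pot[where V = V', OF V']
  have gens: "\<exists>\<tau>. bij \<tau> \<and> (\<forall>t. act (skew \<pi> V) z (?p 0, t) = (?p 0, \<tau> t) \<and>
      act (skew \<pi> V') z (?p 0, t) = (?p 0, \<tau> t))" if z: "fr z \<in> vdiff w ` A" for z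
  proof -
    obtain a b where ab: "(a, b) \<in> A" "fr z = pre w a - pre w b" using z by (auto simp: vdiff_def)
    have le: "a \<le> length w" "b \<le> length w" using A ab(1) by auto
    have fz: "fr z = fr (take a w @ winv (take b w))" using ab(2) by (simp add: pre_def)
    let ?\<tau> = "inv (?q b) \<circ> ?q a"
    have "act (skew \<pi> V) z (?p 0, t) = (?p 0, ?\<tau> t)" for t
      using act_cong_fr[OF fz bs] pair[OF V le AP[OF ab(1)]] by simp
    moreover have "act (skew \<pi> V') z (?p 0, t) = (?p 0, ?\<tau> t)" for t
      using act_cong_fr[OF fz bs'] pair[OF V' le AP[OF ab(1)]] eq[OF ab(1)]
      by (simp add: fun_eq_iff)
    moreover have "bij ?\<tau>" by (intro bij_comp bij_imp_bij_inv bq)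
    ultimately show ?thesis by blast
  qed
  have same: "inv (?q b) (?q a t) = inv (?q' b) (?q' a t)"
    if "a \<le> length w" "b \<le> length w" "?p a = ?p b" for a b t
  proof -
    have "\<exists>\<tau>. bij \<tau> \<and> (\<forall>t. act (skew \<pi> V) (take a w @ winv (take b w)) (?p 0, t) = (?p 0, \<tau> t) \<and>
      act (skew \<pi> V') (take a w @ winv (take b w)) (?p 0, t) = (?p 0, \<tau> t))"
      by (rule sgp_intertwine[OF PA[OF that] bs bs' gens]) (simp_all add: pre_def)
    then obtain \<tau> where "\<And>t. act (skew \<pi> V) (take a w @ winv (take b w)) (?p 0, t) = (?p 0, \<tau> t)"
      "\<And>t. act (skew \<pi> V') (take a w @ winv (take b w)) (?p 0, t) = (?p 0, \<tau> t)" by blast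
    then show ?thesis using pair[where U = V and t = t, OF V that] pair[where U = V' and t = t, OF V' that] by simp
  qed
  have main: "n \<le> length w \<Longrightarrow> ?q n = ?q' n \<and> (\<forall>l\<le>n. ?q l = ?q' l) \<and>
      (\<forall>l<n. V (qedge w ?p l) = V' (qedge w ?p l))" for n
  proof (induction n)
    case 0
    then show ?case by (simp only: pot.simps) simp
  next
    case (Suc n)
    then have IH: "\<And>l. l \<le> n \<Longrightarrow> ?q l = ?q' l" "\<And>l. l < n \<Longrightarrow> V (qedge w ?p l) = V' (qedge w ?p l)"
      by auto
    have Vn: "V (qedge w ?p n) = V' (qedge w ?p n)"
    proof (cases "n \<in> nontree w ?p")
      case True
      \<comment> \<open>The letter ends in the block of an earlier vertex \<open>i\<close>. The
        potentials at \<open>i\<close> agree by induction and the closed walk acts equally, so the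
        potentials after the letter agree, and with them the voltages.\<close>
      then obtain i where i: "i \<le> n" "?p (Suc n) = ?p i" by (auto simp: nontree_def)
      have "inv (?q i) (?q (Suc n) t) = inv (?q i) (?q' (Suc n) t)" for t
        using same[of "Suc n" i t] i Suc.prems IH(1)[OF i(1)] by simp
      then have qq: "?q (Suc n) t = ?q' (Suc n) t" for t
        using bij_is_inj[OF bij_imp_bij_inv[OF bq[of w ?p i]]] by (metis injD)
      let ?v = "\<lambda>V. if snd (w ! n) then V (qedge w ?p n) else inv (V (qedge w ?p n))"
      have "?v V s = ?v V' s" for s
      proof -
        obtain t where "s = ?q n t" using bij_is_surj[OF bq[of w ?p n]] by (metis surjD)
        then show ?thesis using qq[of t] IH(1)[of n] by simp
      qed
      then have "?v V = ?v V'" by (rule ext)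
      then have "V (qedge w ?p n) = V' (qedge w ?p n) \<or> inv (V (qedge w ?p n)) = inv (V' (qedge w ?p n))"
        by (cases "snd (w ! n)") simp_all
      then show ?thesis using inv_inv_eq[OF V] inv_inv_eq[OF V'] by metis
    next
      case False
      show ?thesis
      proof (cases "qedge w ?p n \<in> qedge w ?p ` {..<n}")
        case True
        then obtain l where "l < n" "qedge w ?p n = qedge w ?p l" by auto
        then show ?thesis using IH(2)[of l] by simp
      next
        case new: False
        \<comment> \<open>A newly traversed edge whose letter is outside \<open>nontree\<close>
          belongs to the tree, where the voltages agree by assumption.\<close>
        have "qedge w ?p n \<notin> qedge w ?p ` nontree w ?p"
        proof
          assume "qedge w ?p n \<in> qedge w ?p ` nontree w ?p"
          then obtain l where l: "l \<in> nontree w ?p" "qedge w ?p n = qedge w ?p l" by auto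
          have "qedge w ?p l \<notin> qedge w ?p ` {..<l}" using l(1) by (simp add: nontree_def)
          then have "\<not> n < l" using l(2) by (metis imageI lessThan_iff)
          moreover have "\<not> l < n" using new l(2) by (metis imageI lessThan_iff)
          ultimately show False using l(1) False by simp
        qed
        then show ?thesis by (rule tree)
      qed
    qed
    have "?q (Suc n) = ?q' (Suc n)" unfolding pot.simps Vn IH(1)[OF order_refl] ..
    then show ?case using IH Vn by (auto simp: less_Suc_eq le_Suc_eq)
  qed
  from main[of "length w"] show ?thesis using assms(5) by blast
qed

abbreviation perms :: "nat \<Rightarrow> (nat \<Rightarrow> nat) set" where
  "perms M \<equiv> {f. f permutes {..<M}}"

text \<open>By \<open>act_skew_pair\<close> the representation given by \<open>c\<close> sends
  \<open>vdiff w (a, b)\<close> to this permutation. The restriction to \<open>A\<close> puts the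
  values into the finite set \<open>A \<rightarrow>\<^sub>E perms M\<close>.\<close>

definition rep_of :: "(nat \<Rightarrow> nat \<Rightarrow> nat) \<Rightarrow> nat \<times> nat \<Rightarrow> nat \<Rightarrow> nat" where
  "rep_of c = (\<lambda>ab\<in>A. inv (pot w (blk P) (volt w (blk P) c) (snd ab)) \<circ>
       pot w (blk P) (volt w (blk P) c) (fst ab))"

lemma volt_permutes:
  assumes "c \<in> nontree w (blk P) \<rightarrow>\<^sub>E perms M"
  shows "volt w (blk P) c e permutes {..<M}"
proof (cases "e \<in> qedge w (blk P) ` nontree w (blk P)")
  case True
  then obtain j where "j \<in> nontree w (blk P)" "e = qedge w (blk P) j" by auto
  then show ?thesis using PiE_mem[OF assms, of j] volt_nontree[of j w "blk P" c] by simp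
qed (simp add: volt_def permutes_id)

lemma rep_of_inj: "inj_on rep_of (nontree w (blk P) \<rightarrow>\<^sub>E perms M)"
proof (rule inj_onI)
  let ?N = "nontree w (blk P)"
  fix c c' assume c: "c \<in> ?N \<rightarrow>\<^sub>E perms M" "c' \<in> ?N \<rightarrow>\<^sub>E perms M" and eq: "rep_of c = rep_of c'"
  show "c = c'"
  proof (rule PiE_ext[OF c])
    fix j assume j: "j \<in> ?N"
    have "volt w (blk P) c (qedge w (blk P) j) = volt w (blk P) c' (qedge w (blk P) j)"
    proof (rule representation_determines_voltage)
      show "bij (volt w (blk P) c e)" "bij (volt w (blk P) c' e)" for e
        using volt_permutes[OF c(1)] volt_permutes[OF c(2)] permutes_bij by blast+
      show "volt w (blk P) c e = volt w (blk P) c' e" if "e \<notin> qedge w (blk P) ` ?N" for e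
        using that by (simp add: volt_def)
      show "j < length w" using j by (simp add: nontree_def)
      show "inv (pot w (blk P) (volt w (blk P) c) b) \<circ> pot w (blk P) (volt w (blk P) c) a =
         inv (pot w (blk P) (volt w (blk P) c') b) \<circ> pot w (blk P) (volt w (blk P) c') a"
        if "(a, b) \<in> A" for a b
        using fun_cong[OF eq, of "(a, b)"] that by (simp add: rep_of_def)
    qed
    then show "c j = c' j" by (simp add: volt_nontree[OF j])
  qed
qed

lemma rep_of_in: "rep_of ` (nontree w (blk P) \<rightarrow>\<^sub>E perms M) \<subseteq> A \<rightarrow>\<^sub>E perms M"
  by (auto simp: rep_of_def intro!: permutes_compose permutes_inv pot_permutes volt_permutes)

lemma card_perms_funcset: "finite S \<Longrightarrow> card (S \<rightarrow>\<^sub>E perms M) = fact M ^ card S"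
  by (simp add: card_PiE card_permutations)

lemma finite_perms_funcset: "finite S \<Longrightarrow> finite (S \<rightarrow>\<^sub>E perms M)"
  by (simp add: finite_PiE finite_permutations)

lemma chi_le_card: "chi w P \<le> int (card A)"
proof -
  \<comment> \<open>Two points are enough: \<open>fact 2 = 2\<close>, so comparing powers of 2
    compares the exponents.\<close>
  have "card (nontree w (blk P) \<rightarrow>\<^sub>E perms 2) \<le> card (A \<rightarrow>\<^sub>E perms 2)"
    by (rule card_inj_on_le[OF rep_of_inj rep_of_in]) (simp add: finite_perms_funcset finite_pairs)
  then have "(2::nat) ^ card (nontree w (blk P)) \<le> 2 ^ card A"
    by (simp add: card_perms_funcset finite_pairs)
  then show ?thesis by (simp add: chi_eq_card_nontree[OF P])
qed

lemma ex_representation: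
  assumes "chi w P = int (card A)" and g: "g \<in> A \<rightarrow>\<^sub>E perms M"
  shows "\<exists>\<rho> :: nat \<Rightarrow> nat set \<times> nat \<Rightarrow> nat set \<times> nat. \<exists>B. (\<forall>i. bij (\<rho> i)) \<and>
     (\<forall>(a, b)\<in>A. \<forall>t. act \<rho> (take a w @ winv (take b w)) (B, t) = (B, g (a, b) t))"
proof -
  have "card (nontree w (blk P)) = card A" using assms(1) chi_eq_card_nontree[OF P] by simp
  \<comment> \<open>An injection between finite sets of equal size is onto, so every assignment of
    permutations to the generators occurs.\<close>
  then have "rep_of ` (nontree w (blk P) \<rightarrow>\<^sub>E perms M) = A \<rightarrow>\<^sub>E perms M"
    by (intro card_subset_eq finite_perms_funcset finite_pairs rep_of_in)
      (simp add: card_image[OF rep_of_inj] card_perms_funcset finite_pairs)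
  then have "g \<in> rep_of ` (nontree w (blk P) \<rightarrow>\<^sub>E perms M)" using g by simp
  then obtain c where c: "c \<in> nontree w (blk P) \<rightarrow>\<^sub>E perms M" "rep_of c = g" by (auto simp only: image_iff)
  obtain \<pi> where \<pi>: "\<And>i. \<pi> i permutes blk P ` {..length w}"
    "\<And>i u v. (i, u, v) \<in> trail_img w (blk P) \<Longrightarrow> \<pi> i u = v"
    using fol unfolding folded_iff[OF P] by (rule det_graph_trail_img_extends) blast
  have bij\<pi>: "bij (\<pi> i)" for i using \<pi>(1) permutes_bij by blast
  let ?V = "volt w (blk P) c"
  have bV: "bij (?V e)" for e using volt_permutes[OF c(1)] permutes_bij by blast
  have "act (skew \<pi> ?V) (take a w @ winv (take b w)) (blk P 0, t) = (blk P 0, g (a, b) t)"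
    if ab: "(a, b) \<in> A" for a b t
  proof -
    have le: "a \<le> length w" "b \<le> length w" using A ab(1) by auto
    show ?thesis
    proof (rule trans[OF act_skew_pair])
      show "(blk P 0, inv (pot w (blk P) ?V b) (pot w (blk P) ?V a t)) = (blk P 0, g (a, b) t)"
        using c(2) ab by (auto simp: rep_of_def)
    qed (use bij\<pi> \<pi>(2) bV le AP[OF ab] in auto)
  qed
  then show ?thesis
    by (intro exI[of _ "skew \<pi> ?V"] exI[of _ "blk P 0"] conjI allI bij_skew bij\<pi> bV) auto
qed

end

section \<open>Sizes of generating sets and freeness\<close>

lemma generates_imp_chi_le:
  assumes "generates w E P"
  shows "chi w P \<le> int (card E)"
proof -
  have E: "E \<subseteq> vertex_pairs w" and PE: "P = coset_part w (pair_gens w E)"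
    using assms generates_iff by auto
  have "vertex_pairs w = (\<lambda>(a, b). {a, b}) ` ({..length w} \<times> {..length w})"
    by (force simp: vertex_pairs_def)
  \<comment> \<open>One ordered pair is chosen for each unordered one, so that
    \<open>card A = card E\<close>; the other order would only give the inverse element.\<close>
  then obtain A where A: "A \<subseteq> {..length w} \<times> {..length w}" "inj_on (\<lambda>(a, b). {a, b}) A"
      "E = (\<lambda>(a, b). {a, b}) ` A"
    using E subset_image_inj[of E "\<lambda>(a, b). {a, b}"] by auto
  have P: "partition_on (trail_vertices w) P" and fol: "folded w P"
    by (simp_all add: PE partition_coset folded_coset)
  have "pair_gens w E \<subseteq> sgp (vdiff w ` A)"
  proof
    fix x assume "x \<in> pair_gens w E"
    then obtain a b where x: "x = pre w a - pre w b" "{a, b} \<in> E" by (auto simp: pair_gens_def)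
    then have "(a, b) \<in> A \<or> (b, a) \<in> A" using A(3) by (auto simp: doubleton_eq_iff)
    then have "vdiff w (a, b) \<in> vdiff w ` A \<or> vdiff w (b, a) \<in> vdiff w ` A" by blast
    then have "x \<in> sgp (vdiff w ` A) \<or> - x \<in> sgp (vdiff w ` A)"
      using x(1) by (auto simp: vdiff_def intro: sgp.gen)
    then show "x \<in> sgp (vdiff w ` A)" by (simp add: sgp_uminus_iff)
  qed
  then have sub: "sgp (pair_gens w E) \<subseteq> sgp (vdiff w ` A)" by (rule sgp_least)
  have "chi w P \<le> int (card A)"
  proof (rule chi_le_card[OF P fol A(1)])
    fix a b assume "(a, b) \<in> A"
    then have le: "a \<le> length w" "b \<le> length w" and "{a, b} \<in> E" using A by auto
    then have "pre w a - pre w b \<in> sgp (pair_gens w E)" by (auto simp: pair_gens_def intro!: sgp.gen)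
    then show "blk P a = blk P b" using blk_coset[OF le] PE by simp
  next
    fix a b assume "a \<le> length w" "b \<le> length w" "blk P a = blk P b"
    then show "pre w a - pre w b \<in> sgp (vdiff w ` A)" using blk_coset sub PE by blast
  qed
  also have "card A = card E" unfolding A(3) by (rule card_image[OF A(2), symmetric])
  finally show ?thesis .
qed

text \<open>When \<open>chi\<close> equals the number of generators, these can be sent to arbitrary
  permutations. Sending them to permutations under which the reduced word \<open>Y\<close> moves a
  point shows that \<open>Y\<close> is no relation unless it is empty.\<close>

lemma chi_2_imp_free_pair:
  assumes ab: "a \<le> length w" "b \<le> length w"
    and chi: "chi w (coset_part w {fr w, pre w a - pre w b}) = 2"
  shows "free_pair (fr w) (pre w a - pre w b)"
  unfolding free_pair_def
proof (intro allI impI)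
  let ?u = "fr w" and ?x = "pre w a - pre w b"
  define P where "P = coset_part w {?u, ?x}"
  define A where "A = {(length w, 0), (a, b)}"
  have vA: "vdiff w ` A = {?u, ?x}" by (simp add: A_def vdiff_def pre_length)
  have P: "partition_on (trail_vertices w) P" and fol: "folded w P"
    by (simp_all add: P_def partition_coset folded_coset)
  have A: "A \<subseteq> {..length w} \<times> {..length w}" using ab by (auto simp: A_def)
  have AP: "blk P c = blk P d" if "(c, d) \<in> A" for c d
  proof -
    have "vdiff w (c, d) \<in> vdiff w ` A" using that by blast
    then have "pre w c - pre w d \<in> sgp {?u, ?x}" unfolding vA by (auto simp: vdiff_def intro: sgp.gen)
    then show ?thesis using blk_coset[of c w d] A that by (auto simp: P_def)
  qed
  have PA: "pre w c - pre w d \<in> sgp (vdiff w ` A)"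
    if "c \<le> length w" "d \<le> length w" "blk P c = blk P d" for c d
    using that blk_coset[of c w d] by (simp add: vA P_def)
  have chiA: "chi w P \<le> int (card A)" by (rule chi_le_card[OF P fol A AP PA])
  \<comment> \<open>If the two pairs coincided, \<open>A\<close> would have one element and
    \<open>chi\<close> could not be 2.\<close>
  then have card: "chi w P = int (card A)" and ne: "(length w, 0) \<noteq> (a, b)"
    using chi by (auto simp: A_def P_def card_insert_if split: if_splits)
  fix Y assume Y: "reduced Y" "fst ` set Y \<subseteq> {0, 1}" "word_val (pair_val ?u ?x) Y = 0"
  obtain \<sigma> :: "nat \<Rightarrow> nat \<Rightarrow> nat" where \<sigma>: "\<And>i. \<sigma> i permutes {..length Y}" "act \<sigma> Y 0 = length Y"
    using reduced_action[OF Y(1)] by blast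
  define g where "g = (\<lambda>cd\<in>A. if cd = (a, b) then \<sigma> 1 else \<sigma> 0)"
  have "g \<in> A \<rightarrow>\<^sub>E {f. f permutes {..<Suc (length Y)}}"
    using \<sigma>(1) by (auto simp: g_def lessThan_Suc_atMost)
  from ex_representation[OF P fol A AP PA card this]
  obtain \<rho> :: "nat \<Rightarrow> nat set \<times> nat \<Rightarrow> nat set \<times> nat" and B where \<rho>: "\<And>i. bij (\<rho> i)"
    "\<And>c d t. (c, d) \<in> A \<Longrightarrow> act \<rho> (take c w @ winv (take d w)) (B, t) = (B, g (c, d) t)"
    by blast
  define zx where "zx = take a w @ winv (take b w)"
  have act0: "act \<rho> w (B, t) = (B, \<sigma> 0 t)" for t
    using \<rho>(2)[of "length w" 0 t] ne by (auto simp: A_def g_def)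
  have act1: "act \<rho> zx (B, t) = (B, \<sigma> 1 t)" for t
    using \<rho>(2)[of a b t] by (auto simp: A_def g_def zx_def)
  have ainv: "act \<rho> (winv z) (B, t) = (B, inv (\<sigma> i) t)"
    if "\<And>t. act \<rho> z (B, t) = (B, \<sigma> i t)" for z i t
    using that[of "inv (\<sigma> i) t"] act_winv(1)[of \<rho> z "(B, inv (\<sigma> i) t)", OF \<rho>(1)]
      permutes_inverses(1)[OF \<sigma>(1)] by simp
  define sub where "sub l = (let z = (if fst l = 0 then w else zx) in if snd l then z else winv z)"
    for l :: "nat \<times> bool"
  have actsub: "act \<rho> (sub l) (B, t) = (B, lact \<sigma> l t)" if "fst l \<in> {0, 1}" for l t
    using that act0 act1 ainv[of w 0] ainv[of zx 1] by (auto simp: sub_def Let_def lact_def)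
  have actY: "act \<rho> (concat (map sub Z)) (B, t) = (B, act \<sigma> Z t)" if "fst ` set Z \<subseteq> {0, 1}" for Z t
    using that by (induction Z arbitrary: t) (auto simp: actsub)
  have frsub: "fr (sub l) = (if snd l then pair_val ?u ?x (fst l) else - pair_val ?u ?x (fst l))" for l
    by (simp add: sub_def Let_def pair_val_def zx_def pre_def)
  have "fr (concat (map sub Z)) = word_val (pair_val ?u ?x) Z" for Z
    by (induction Z) (auto simp: frsub)
  then have "fr (concat (map sub Y)) = fr []" using Y(3) by simp
  then have "act \<rho> (concat (map sub Y)) (B, 0) = act \<rho> [] (B, 0)" by (rule act_cong_fr) (rule \<rho>(1))
  then have "act \<sigma> Y 0 = 0" using actY[OF Y(2)] by simp
  then show "Y = []" using \<sigma>(2) by simp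
qed

subsection \<open>Components of forests\<close>

lemma walk_mono: "walk R u z v \<Longrightarrow> R \<subseteq> R' \<Longrightarrow> walk R' u z v"
  by (induction z arbitrary: u) (auto simp: step_def split: if_splits)

text \<open>Induction on the edges: in a forest every edge joins two components and lowers their
  number by one. A forest is described by the absence of nonempty reduced closed walks, and
  \<open>f\<close> names the component of a vertex.\<close>

lemma forest_components:
  fixes R :: "(nat \<times> 'v \<times> 'v) set"
  assumes "finite R" "finite D"
    and "\<And>i u v. (i, u, v) \<in> R \<Longrightarrow> u \<in> D \<and> v \<in> D" "det_graph R"
    and "\<And>u z. u \<in> D \<Longrightarrow> reduced z \<Longrightarrow> walk R u z u \<Longrightarrow> z = []"
  shows "\<exists>f :: 'v \<Rightarrow> 'v. card (f ` D) + card R = card D \<and>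
    (\<forall>u\<in>D. \<forall>v\<in>D. f u = f v \<longleftrightarrow> (\<exists>z. walk R u z v))"
  using assms(1,3-)
proof (induction rule: finite_induct)
  case empty
  have "\<not> step {} u l v" for u v :: 'v and l by (simp add: step_def)
  then have "z = []" if "walk {} u z v" for u z and v :: 'v using that by (cases z) auto
  then have "u = v \<longleftrightarrow> (\<exists>z. walk {} u z v)" for u v :: 'v
    by (metis walk.simps(1))
  then show ?case by (intro exI[of _ id]) simp
next
  case (insert e R)
  obtain i a b where e: "e = (i, a, b)" by (metis surj_pair)
  have ab: "a \<in> D" "b \<in> D" using insert.prems(1)[of i a b] e by auto
  have mono: "walk (insert e R) u z v" if "walk R u z v" for u z v
    using walk_mono[OF that] by blast
  have "\<exists>f :: 'v \<Rightarrow> 'v. card (f ` D) + card R = card D \<and>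
    (\<forall>u\<in>D. \<forall>v\<in>D. f u = f v \<longleftrightarrow> (\<exists>z. walk R u z v))"
  proof (rule insert.IH)
    show "u \<in> D \<and> v \<in> D" if "(i, u, v) \<in> R" for i u v using insert.prems(1) that by blast
    show "det_graph R" using insert.prems(2) det_graph_subset by blast
    show "z = []" if "u \<in> D" "reduced z" "walk R u z u" for u z
      using insert.prems(3) that mono by blast
  qed
  then obtain f :: "'v \<Rightarrow> 'v" where f: "card (f ` D) + card R = card D"
    "\<And>u v. u \<in> D \<Longrightarrow> v \<in> D \<Longrightarrow> f u = f v \<longleftrightarrow> (\<exists>z. walk R u z v)" by blast
  have fab: "f a \<noteq> f b"
  proof
    assume "f a = f b"
    then obtain y where y: "walk R a y b" using f(2) ab by blast
    have "det_graph R" using insert.prems(2) det_graph_subset by blast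
    from reduced_walk[OF this y] obtain z where z: "reduced z" "walk R a z b" by blast
    \<comment> \<open>If \<open>z\<close> ended with the letter of the new edge, determinism would
      make its last edge the new one, which is not in \<open>R\<close>. So returning along the new
      edge gives a reduced closed walk.\<close>
    have "reduced (z @ [(i, False)])"
    proof (cases z rule: rev_cases)
      case (snoc y l)
      have "l \<noteq> (i, True)"
      proof
        assume "l = (i, True)"
        then obtain t where "(i, t, b) \<in> R" using z(2) snoc by (auto simp: step_def)
        then have "t = a" using insert.prems(2) e unfolding det_graph_iff by blast
        then show False using insert.hyps(2) e \<open>(i, t, b) \<in> R\<close> by simp
      qed
      then show ?thesis using z(1) snoc by (cases l) (auto simp: successively_append_iff linv_def)
    qed simp
    moreover have "walk (insert e R) a (z @ [(i, False)]) a"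
      using mono[OF z(2)] e by (auto simp: step_def)
    ultimately show False using insert.prems(3)[OF ab(1)] by blast
  qed
  define f' where "f' u = (if f u = f b then f a else f u)" for u
  have "f' ` D = f ` D - {f b}"
    using ab fab by (auto simp: f'_def image_iff)
  then have "card (f' ` D) = card (f ` D) - 1" using ab assms(2) by simp
  moreover have "card (f ` D) > 0" using ab assms(2) by (auto simp: card_gt_0_iff)
  ultimately have 1: "card (f' ` D) + card (insert e R) = card D"
    using f(1) insert.hyps by simp
  have edge: "f' s = f' t" if "(j, s, t) \<in> insert e R" for j s t
  proof (cases "(j, s, t) = e")
    case True
    then show ?thesis using e by (simp add: f'_def)
  next
    case False
    then have R: "(j, s, t) \<in> R" using that by simp
    then have "walk R s [(j, True)] t" by (simp add: step_def)
    then have "f s = f t" using f(2) insert.prems(1)[of j s t] R by blast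
    then show ?thesis by (simp add: f'_def)
  qed
  have walk_f': "f' u = f' v" if "walk (insert e R) u z v" for u z v
    using that
  proof (induction z arbitrary: u)
    case (Cons l z)
    then obtain t where "step (insert e R) u l t" "walk (insert e R) t z v" by auto
    then show ?case using Cons.IH[of t] edge by (auto simp: step_def split: if_splits)
  qed simp
  have w: "\<exists>z. walk (insert e R) u z v" if "u \<in> D" "v \<in> D" "f u = f v" for u v
    using f(2) that mono by blast
  have w_sym: "\<exists>z. walk (insert e R) v z u" if "\<exists>z. walk (insert e R) u z v" for u v
    using that walk_winv[of "insert e R" v _ u] by blast
  have w_trans: "\<exists>z. walk (insert e R) u z t"
    if uvt: "\<exists>z. walk (insert e R) u z v" "\<exists>z. walk (insert e R) v z t" for u v t
  proof -
    obtain y z where "walk (insert e R) u y v" "walk (insert e R) v z t" using uvt by blast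
    then have "walk (insert e R) u (y @ z) t" by auto
    then show ?thesis by blast
  qed
  have wab: "\<exists>z. walk (insert e R) a z b"
    by (rule exI[of _ "[(i, True)]"]) (simp add: step_def e)
  have "\<exists>z. walk (insert e R) u z v" if uv: "u \<in> D" "v \<in> D" "f' u = f' v" for u v
  proof -
    consider "f u = f v" | "f u = f a" "f v = f b" | "f u = f b" "f v = f a"
      using uv(3) by (auto simp: f'_def split: if_splits)
    then show ?thesis
    proof cases
      case 1
      then show ?thesis using w uv by blast
    next
      case 2
      show ?thesis
        by (rule w_trans[OF w_trans[OF w[OF uv(1) ab(1) 2(1)] wab] w_sym[OF w[OF uv(2) ab(2) 2(2)]]])
    next
      case 3
      show ?thesis
        by (rule w_sym, rule w_trans[OF w_trans[OF w[OF uv(2) ab(1) 3(2)] wab] w_sym[OF w[OF uv(1) ab(2) 3(1)]]])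
    qed
  qed
  then show ?case using 1 walk_f' by (intro exI[of _ f']) blast
qed

text \<open>Each fibre of \<open>g\<close> is the union of exactly two fibres of \<open>f\<close>,
  those of \<open>d\<close> and of \<open>s d\<close>.\<close>

lemma card_two_to_one:
  assumes D: "finite D" and s: "\<And>d. d \<in> D \<Longrightarrow> s d \<in> D"
    and g: "\<And>d d'. d \<in> D \<Longrightarrow> d' \<in> D \<Longrightarrow> g d' = g d \<longleftrightarrow> f d' = f d \<or> f d' = f (s d)"
    and ne: "\<And>d. d \<in> D \<Longrightarrow> f d \<noteq> f (s d)"
  shows "card (f ` D) = 2 * card (g ` D)"
proof -
  have "f ` D = (\<Union>y\<in>g ` D. f ` {d \<in> D. g d = y})" by auto
  also have "card \<dots> = (\<Sum>y\<in>g ` D. card (f ` {d \<in> D. g d = y}))"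
  proof (rule card_UN_disjoint)
    show "\<forall>y\<in>g ` D. \<forall>y'\<in>g ` D. y \<noteq> y' \<longrightarrow> f ` {d \<in> D. g d = y} \<inter> f ` {d \<in> D. g d = y'} = {}"
      using g by blast
  qed (use D in auto)
  also have "\<dots> = (\<Sum>y\<in>g ` D. 2)"
  proof (rule sum.cong[OF refl])
    fix y assume "y \<in> g ` D"
    then obtain d where d: "d \<in> D" "y = g d" by blast
    have "f ` {d' \<in> D. g d' = y} = {f d, f (s d)}"
      using g[OF d(1)] d s[OF d(1)] by auto
    then show "card (f ` {d \<in> D. g d = y}) = 2" using ne[OF d(1)] by simp
  qed
  finally show ?thesis by simp
qed

subsection \<open>Quotients of type A\<close>

text \<open>Rewrites sums in a noncommutative group to right-nested words and cancels neighbouring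
  inverses.\<close>

lemmas group_normalize = diff_conv_add_uminus minus_add minus_minus add.assoc minus_add_cancel
  add_minus_cancel left_minus right_minus add_0_left add_0_right minus_zero

lemma realizable_coset: "fr w \<in> sgp S \<Longrightarrow> realizable w (coset_part w S)"
  using blk_coset[of 0 w "length w" S] sgp_uminus_iff[of "fr w" S]
  by (simp add: realizable_iff partition_coset folded_coset pre_length)

lemma coset_part_cong: "sgp S = sgp T \<Longrightarrow> coset_part w S = coset_part w T"
  by (simp add: coset_part_def)

lemma sgp_eqI: "S \<subseteq> sgp T \<Longrightarrow> T \<subseteq> sgp S \<Longrightarrow> sgp S = sgp T"
  by (intro antisym sgp_least)

text \<open>The quotient of the cyclic subgroup generated by \<open>w\<close>; in the overview it is
  the one generated by the two ends of the trail.\<close>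

definition cyc :: "word \<Rightarrow> nat set set" where
  "cyc w = coset_part w {fr w}"

definition two_gen :: "word \<Rightarrow> nat \<Rightarrow> nat \<Rightarrow> nat set set" where
  "two_gen w a b = coset_part w {fr w, pre w a - pre w b}"

lemma sgp_pair_gens:
  "sgp (pair_gens w {{0, length w}, {a, b}}) = sgp {fr w, pre w a - pre w b}"
proof (rule sgp_eqI)
  let ?S = "{fr w, pre w a - pre w b}"
  show "pair_gens w {{0, length w}, {a, b}} \<subseteq> sgp ?S"
  proof
    fix x assume "x \<in> pair_gens w {{0, length w}, {a, b}}"
    then have "x \<in> ?S \<or> - x \<in> ?S"
      by (auto simp: pair_gens_def doubleton_eq_iff pre_length)
    then have "x \<in> sgp ?S \<or> - x \<in> sgp ?S" by (auto intro: sgp.gen)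
    then show "x \<in> sgp ?S" by (simp add: sgp_uminus_iff)
  qed
  have mem: "pre w c - pre w d \<in> pair_gens w {{0, length w}, {a, b}}"
    if "{c, d} \<in> {{0, length w}, {a, b}}" for c d
    unfolding pair_gens_def by (intro CollectI exI[of _ c] exI[of _ d] conjI refl that)
  have "pre w (length w) - pre w 0 \<in> pair_gens w {{0, length w}, {a, b}}"
    "pre w a - pre w b \<in> pair_gens w {{0, length w}, {a, b}}"
    by (rule mem, simp add: insert_commute)+
  then show "?S \<subseteq> sgp (pair_gens w {{0, length w}, {a, b}})"
    by (auto simp: pre_length intro: sgp.gen)
qed

lemma generates_two_gen:
  assumes "a \<le> length w" "b \<le> length w"
  shows "generates w {{0, length w}, {a, b}} (two_gen w a b)"
proof -
  have "{{0, length w}, {a, b}} \<subseteq> vertex_pairs w" using assms by (auto simp: vertex_pairs_def)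
  then show ?thesis
    using coset_part_cong[OF sgp_pair_gens[of w a b]] by (simp add: generates_iff two_gen_def)
qed

lemma two_gen_same: "blk (cyc w) a = blk (cyc w) b \<Longrightarrow> a \<le> length w \<Longrightarrow> b \<le> length w \<Longrightarrow>
    two_gen w a b = cyc w"
  unfolding two_gen_def cyc_def
  by (rule coset_part_cong, rule sgp_eqI) (auto intro: sgp.gen simp: blk_coset)

lemma generates_cyc: "generates w {{0, length w}} (cyc w)"
  using generates_two_gen[of 0 w "length w"] two_gen_same[of w 0 "length w"]
    blk_coset[of 0 w "length w" "{fr w}"]
  by (simp add: cyc_def pre_length sgp_uminus_iff sgp.gen)

lemma realizable_cyc: "realizable w (cyc w)"
  unfolding cyc_def by (rule realizable_coset) (simp add: sgp.gen)

lemma realizable_two_gen: "realizable w (two_gen w a b)"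
  unfolding two_gen_def by (rule realizable_coset) (simp add: sgp.gen)

lemma blk_two_gen: "a \<le> length w \<Longrightarrow> b \<le> length w \<Longrightarrow> blk (two_gen w a b) a = blk (two_gen w a b) b"
  unfolding two_gen_def by (simp add: blk_coset sgp.gen)

lemma smallest_generating_setI:
  assumes "generates w E P" "int (card E) \<le> chi w P"
  shows "smallest_generating_set w E P"
  using assms generates_imp_chi_le unfolding smallest_generating_set_def
  by (meson of_nat_le_iff order_trans)

text \<open>The counting bound \<open>generates_imp_chi_le\<close> meets the spanning tree
  construction \<open>ex_generating_set\<close>.\<close>

lemma card_smallest_generating_set:
  assumes "smallest_generating_set w E P"
  shows "int (card E) = chi w P"
proof -
  have g: "generates w E P" using assms by (simp add: smallest_generating_set_def)
  then have P: "partition_on (trail_vertices w) P" "folded w P"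
    by (auto simp: generates_def admissible_def)
  obtain E' where "generates w E' P" "int (card E') = chi w P" using ex_generating_set[OF P] by blast
  then have "int (card E) \<le> chi w P" using assms by (auto simp: smallest_generating_set_def)
  then show ?thesis using generates_imp_chi_le[OF g] by simp
qed

lemma generates_finite: "generates w E P \<Longrightarrow> finite E"
proof -
  assume "generates w E P"
  then have "E \<subseteq> Pow {..length w}" by (auto simp: generates_iff vertex_pairs_def)
  then show "finite E" by (rule finite_subset) simp
qed

lemma realizable_chi_nonneg: "realizable w P \<Longrightarrow> chi w P \<ge> 0"
  using chi_eq_card_nontree realizable_iff by simp

text \<open>A smallest generating set has \<open>chi w P\<close> elements, so here it is
  empty.\<close>

lemma realizable_chi_0_type_B:
  assumes "chi w P = 0" shows "type_B w P"
  unfolding type_B_def type_A_def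
proof
  assume "\<exists>E. smallest_generating_set w E P \<and> {0, length w} \<in> E"
  then obtain E where E: "smallest_generating_set w E P" "{0, length w} \<in> E" by blast
  then have "card E = 0" using card_smallest_generating_set[OF E(1)] assms by simp
  moreover have "finite E" using E(1) generates_finite by (auto simp: smallest_generating_set_def)
  ultimately show False using E(2) by simp
qed

text \<open>A one-element generating set that contains the pair of the two ends consists of this
  pair and generates \<open>cyc w\<close>. Conversely one pair bounds \<open>chi w (cyc w)\<close>
  by 1, and the assumption excludes 0.\<close>

lemma chi_1_type_A_iff:
  assumes "\<And>P. realizable w P \<Longrightarrow> chi w P \<noteq> 0"
  shows "chi w P = 1 \<and> type_A w P \<longleftrightarrow> P = cyc w"
proof
  assume P: "chi w P = 1 \<and> type_A w P"
  then obtain E where E: "smallest_generating_set w E P" "{0, length w} \<in> E"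
    by (auto simp: type_A_def)
  then have "card E = 1" using card_smallest_generating_set[OF E(1)] P by simp
  then have "E = {{0, length w}}" using E(2) by (auto simp: card_1_singleton_iff)
  then have "generates w {{0, length w}} P" using E(1) by (simp add: smallest_generating_set_def)
  then show "P = cyc w" using generates_cyc[of w] by (simp add: generates_iff)
next
  assume P: "P = cyc w"
  have "chi w P \<le> 1" using generates_imp_chi_le[OF generates_cyc[of w]] P by simp
  moreover have "chi w P \<noteq> 0" "chi w P \<ge> 0"
    using assms realizable_cyc realizable_chi_nonneg[OF realizable_cyc] P by auto
  ultimately have "chi w P = 1" by simp
  moreover have "smallest_generating_set w {{0, length w}} P"
    using smallest_generating_setI[OF generates_cyc] \<open>chi w P = 1\<close> P by simp
  ultimately show "chi w P = 1 \<and> type_A w P" by (auto simp: type_A_def)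
qed

section \<open>The graph of pairs\<close>

lemma sgp_sing_walk:
  assumes "x \<in> sgp {fr w}" "walk R b w b"
  shows "\<exists>z. fr z = x \<and> walk R b z b"
  using assms(1)
proof induction
  case zero
  show ?case by (intro exI[of _ "[]"]) simp
next
  case (gen s)
  then show ?case using assms(2) by (intro exI[of _ w]) simp
next
  case (plus x y)
  then obtain zx zy where "fr zx = x" "walk R b zx b" "fr zy = y" "walk R b zy b" by blast
  then show ?case by (intro exI[of _ "zx @ zy"]) auto
next
  case (uminus x)
  then obtain zx where "fr zx = x" "walk R b zx b" by blast
  then show ?case by (intro exI[of _ "winv zx"]) simp
qed

lemma reduced_replicate: "reduced (replicate k l)"
  by (induction k) (auto simp: successively_Cons hd_replicate)

lemma linv_pair: "linv (i, \<alpha>) = (i, \<not> \<alpha>)"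
  by (simp add: linv_def)

lemma winv_replicate: "winv (replicate k l) = replicate k (linv l)"
  by (simp add: winv_def)

text \<open>The fibre product of the graph with itself without the diagonal. Inequality is demanded
  at the origin; determinism carries it to the terminus (\<open>step_neq\<close>).\<close>

definition pair_graph :: "(nat \<times> 'v \<times> 'v) set \<Rightarrow> (nat \<times> ('v \<times> 'v) \<times> ('v \<times> 'v)) set" where
  "pair_graph R = {(i, (u, v), (u', v')) |i u v u' v'. (i, u, u') \<in> R \<and> (i, v, v') \<in> R \<and> u \<noteq> v}"

lemma det_graphD: "det_graph R \<Longrightarrow> step R u l v \<Longrightarrow> step R u l v' \<Longrightarrow> v = v'"
  unfolding det_graph_def by blast

lemma step_neq:
  assumes "det_graph R" "step R u l u'" "step R v l v'" "u \<noteq> v"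
  shows "u' \<noteq> v'"
proof
  assume "u' = v'"
  then have "step R v' (linv l) u" "step R v' (linv l) v" using assms by simp_all
  then show False using det_graphD[OF assms(1)] assms(4) by blast
qed

lemma step_pair_graph:
  assumes "det_graph R"
  shows "step (pair_graph R) (u, v) l (u', v') \<longleftrightarrow> step R u l u' \<and> step R v l v' \<and> u \<noteq> v"
proof -
  have "step (pair_graph R) (u, v) l (u', v') \<longleftrightarrow>
      step R u l u' \<and> step R v l v' \<and> (if snd l then u \<noteq> v else u' \<noteq> v')"
    by (auto simp: step_def pair_graph_def)
  moreover have "u \<noteq> v \<longleftrightarrow> u' \<noteq> v'" if "step R u l u'" "step R v l v'"
    using that step_neq[OF assms, of u l u' v v'] step_neq[OF assms, of u' "linv l" u v' v] by auto
  ultimately show ?thesis by auto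
qed

lemma det_graph_pair_graph: "det_graph R \<Longrightarrow> det_graph (pair_graph R)"
  unfolding det_graph_def[of "pair_graph R"]
  by (auto simp: step_pair_graph dest: det_graphD)

lemma walk_pair_graph:
  assumes "det_graph R" "u \<noteq> v"
  shows "walk (pair_graph R) (u, v) z (u', v') \<longleftrightarrow> walk R u z u' \<and> walk R v z v'"
  using assms(2)
proof (induction z arbitrary: u v)
  case (Cons l z)
  show ?case
  proof
    assume "walk (pair_graph R) (u, v) (l # z) (u', v')"
    then obtain s t where st: "step (pair_graph R) (u, v) l (s, t)" "walk (pair_graph R) (s, t) z (u', v')"
      by auto
    then have "step R u l s" "step R v l t" by (simp_all add: step_pair_graph[OF assms(1)])
    moreover then have "s \<noteq> t" using step_neq[OF assms(1)] Cons.prems by blast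
    ultimately show "walk R u (l # z) u' \<and> walk R v (l # z) v'" using Cons.IH[of s t] st(2) by auto
  next
    assume "walk R u (l # z) u' \<and> walk R v (l # z) v'"
    then obtain s t where st: "step R u l s" "walk R s z u'" "step R v l t" "walk R t z v'" by auto
    then have "s \<noteq> t" using step_neq[OF assms(1)] Cons.prems by blast
    then show "walk (pair_graph R) (u, v) (l # z) (u', v')"
      using Cons.IH[of s t] st Cons.prems
      by (auto simp: step_pair_graph[OF assms(1)])
  qed
qed simp


text \<open>An edge of the graph of pairs is an ordered pair of distinct equally labelled edges of
  \<open>R\<close>: by determinism such edges have distinct origins.\<close>

lemma card_pair_graph:
  assumes fin: "finite R" and det: "det_graph R" and lab: "\<And>i u v. (i, u, v) \<in> R \<Longrightarrow> i \<in> I" and "finite I"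
  shows "card (pair_graph R) =
    (\<Sum>i\<in>I. card {(u, v). (i, u, v) \<in> R} * (card {(u, v). (i, u, v) \<in> R} - 1))"
proof -
  define E where "E i = {(u, v). (i, u, v) \<in> R}" for i
  have finE: "finite (E i)" for i
  proof -
    have "E i = (\<lambda>e. (fst (snd e), snd (snd e))) ` {e \<in> R. fst e = i}" by (force simp: E_def)
    then show ?thesis using fin by simp
  qed
  define h :: "nat \<times> ('a \<times> 'a) \<times> ('a \<times> 'a) \<Rightarrow> nat \<times> ('a \<times> 'a) \<times> ('a \<times> 'a)"
    where "h = (\<lambda>(i, (u, u'), (v, v')). (i, (u, v), (u', v')))"
  have "pair_graph R = h ` (SIGMA i:I. SIGMA e:E i. E i - {e})"
  proof (intro set_eqI iffI)
    fix x assume "x \<in> pair_graph R"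
    then obtain i u v u' v' where x: "x = (i, (u, v), (u', v'))" "(i, u, u') \<in> R" "(i, v, v') \<in> R" "u \<noteq> v"
      by (auto simp: pair_graph_def)
    then have "(i, (u, u'), (v, v')) \<in> (SIGMA i:I. SIGMA e:E i. E i - {e})"
      using lab by (auto simp: E_def)
    moreover have "x = h (i, (u, u'), (v, v'))" using x by (simp add: h_def)
    ultimately show "x \<in> h ` (SIGMA i:I. SIGMA e:E i. E i - {e})" by (rule rev_image_eqI)
  next
    fix x assume "x \<in> h ` (SIGMA i:I. SIGMA e:E i. E i - {e})"
    then obtain y where y: "x = h y" "y \<in> (SIGMA i:I. SIGMA e:E i. E i - {e})" by blast
    obtain i u u' v v' where y_eq: "y = (i, (u, u'), (v, v'))" by (metis surj_pair)
    have uv: "(i, u, u') \<in> R" "(i, v, v') \<in> R" "(v, v') \<noteq> (u, u')"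
      using y(2) unfolding y_eq by (simp_all add: E_def)
    then have "u \<noteq> v" using det unfolding det_graph_iff by blast
    then show "x \<in> pair_graph R" using uv y(1) by (simp add: y_eq h_def pair_graph_def)
  qed
  moreover have "inj h" by (auto simp: inj_def h_def)
  ultimately have "card (pair_graph R) = card (SIGMA i:I. SIGMA e:E i. E i - {e})"
    using card_image[OF inj_on_subset[OF \<open>inj h\<close>]] by auto
  also have "\<dots> = (\<Sum>i\<in>I. \<Sum>e\<in>E i. card (E i - {e}))"
    using finE assms(4) by (simp add: card_SigmaI)
  also have "\<dots> = (\<Sum>i\<in>I. card (E i) * (card (E i) - 1))"
    using finE by (intro sum.cong refl) simp
  finally show ?thesis by (simp add: E_def)
qed

section \<open>Components of the graph of pairs and quotients of type A\<close>

definition type_A_2 :: "word \<Rightarrow> nat set set set" where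
  "type_A_2 w = {P. realizable w P \<and> type_A w P \<and> chi w P = 2}"

context
  fixes w :: word
  assumes chi_ne_0: "\<And>P. realizable w P \<Longrightarrow> chi w P \<noteq> 0"
    and chi_1: "\<And>P. realizable w P \<Longrightarrow> chi w P = 1 \<Longrightarrow> P = cyc w"
begin

abbreviation (input) cblk :: "nat \<Rightarrow> nat set" where
  "cblk \<equiv> blk (cyc w)"

text \<open>Two generators give at most 2. The value 0 is excluded by assumption, and 1 because it
  would force the quotient to be \<open>cyc w\<close>, which keeps \<open>a\<close> and
  \<open>b\<close> apart.\<close>

lemma chi_two_gen:
  assumes "a \<le> length w" "b \<le> length w" "cblk a \<noteq> cblk b"
  shows "chi w (two_gen w a b) = 2"
proof -
  let ?P = "two_gen w a b"
  have "chi w ?P \<le> int (card {{0, length w}, {a, b}})"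
    by (rule generates_imp_chi_le[OF generates_two_gen[OF assms(1,2)]])
  also have "\<dots> \<le> 2" by (simp add: card_insert_if)
  finally have "chi w ?P \<le> 2" .
  moreover have "chi w ?P \<noteq> 0" "chi w ?P \<ge> 0"
    using chi_ne_0 realizable_two_gen realizable_chi_nonneg by blast+
  moreover have "chi w ?P \<noteq> 1"
    using chi_1[OF realizable_two_gen] blk_two_gen[OF assms(1,2)] assms(3) by metis
  ultimately show ?thesis by linarith
qed

lemma type_A_2_iff:
  "P \<in> type_A_2 w \<longleftrightarrow>
     (\<exists>a b. a \<le> length w \<and> b \<le> length w \<and> cblk a \<noteq> cblk b \<and> P = two_gen w a b)"
    (is "_ \<longleftrightarrow> ?r")
proof
  assume "P \<in> type_A_2 w"
  then obtain E where E: "smallest_generating_set w E P" "{0, length w} \<in> E" and chi: "chi w P = 2"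
    by (auto simp: type_A_2_def type_A_def)
  then have "card E = 2" using card_smallest_generating_set[OF E(1)] by simp
  then obtain e where e: "E = {{0, length w}, e}" using E(2) by (auto simp: card_2_iff)
  have gen: "generates w E P" using E(1) by (simp add: smallest_generating_set_def)
  then have "e \<in> vertex_pairs w" using e by (simp add: generates_iff)
  then obtain a b where ab: "e = {a, b}" "a \<le> length w" "b \<le> length w"
    by (auto simp: vertex_pairs_def)
  have "P = two_gen w a b"
    using gen generates_two_gen[OF ab(2,3)] e ab(1) by (simp add: generates_iff)
  moreover have "cblk a \<noteq> cblk b"
  proof
    assume "cblk a = cblk b"
    then have "P = cyc w" using two_gen_same[of w a b] ab \<open>P = two_gen w a b\<close> by simp
    then show False using generates_imp_chi_le[OF generates_cyc[of w]] chi by simp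
  qed
  ultimately show ?r
    using ab(2,3) by (intro exI[of _ a] exI[of _ b] conjI)
next
  assume ?r
  then obtain a b where ab: "a \<le> length w" "b \<le> length w" "cblk a \<noteq> cblk b" "P = two_gen w a b"
    by blast
  have chi: "chi w P = 2" using chi_two_gen ab by simp
  have "smallest_generating_set w {{0, length w}, {a, b}} P"
    by (rule smallest_generating_setI) (use generates_two_gen ab chi in \<open>auto simp: card_insert_if\<close>)
  then show "P \<in> type_A_2 w" using chi ab(4) realizable_two_gen by (auto simp: type_A_2_def type_A_def)
qed

abbreviation (input) cyc_graph :: "(nat \<times> nat set \<times> nat set) set" where
  "cyc_graph \<equiv> trail_img w (cblk)"

abbreviation (input) cyc_walk :: "nat \<Rightarrow> word \<Rightarrow> nat \<Rightarrow> bool" where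
  "cyc_walk a z b \<equiv> walk cyc_graph (cblk a) z (cblk b)"

lemma det_graph_cyc: "det_graph cyc_graph"
  using realizable_cyc[of w] folded_iff[of w "cyc w"] by (simp add: realizable_iff)

lemma walk_cyc_sgp:
  assumes "cyc_walk a z b" "a \<le> length w" "b \<le> length w"
  shows "pre w a + fr z - pre w b \<in> sgp {fr w}"
proof (rule walk_pre[where p = "cblk", OF _ assms])
  show "pre w a - pre w b \<in> sgp {fr w}"
    if "a \<le> length w" "b \<le> length w" "cblk a = cblk b" for a b
    using that(3) blk_coset[OF that(1,2), of "{fr w}"] by (simp add: cyc_def)
qed

lemma free_pair_diff:
  assumes "a \<le> length w" "b \<le> length w" "cblk a \<noteq> cblk b"
  shows "free_pair (fr w) (pre w a - pre w b)"
  using chi_2_imp_free_pair[OF assms(1,2)] chi_two_gen[OF assms] by (simp add: two_gen_def)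

text \<open>The two walks yield powers p and q of \<open>w\<close>. With x the difference of the
  prefixes, swapping would give q = x^-1 p x^-1, which is impossible for a free pair.\<close>

lemma pair_graph_no_swap:
  assumes ab: "a \<le> length w" "b \<le> length w" "cblk a \<noteq> cblk b"
    and walk: "cyc_walk a z b" "cyc_walk b z a"
  shows False
proof -
  define x where "x = pre w a - pre w b"
  define p where "p = pre w a + fr z - pre w b"
  define q where "q = pre w b + fr z - pre w a"
  have "p \<in> sgp {fr w}" "q \<in> sgp {fr w}"
    using walk_cyc_sgp[OF walk(1) ab(1,2)] walk_cyc_sgp[OF walk(2) ab(2,1)] by (simp_all add: p_def q_def)
  then obtain k \<alpha> l \<beta> where pq: "p = word_val (pair_val (fr w) x) (replicate k (0, \<alpha>))"
    "q = word_val (pair_val (fr w) x) (replicate l (0, \<beta>))" using sgp_sing_power by metis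
  \<comment> \<open>Reduced even if a power is empty, because two letters for x^-1 do not
    cancel.\<close>
  define Y where "Y = (1, False) # replicate k (0, \<alpha>) @ [(1, False)] @ winv (replicate l (0, \<beta>))"
  have "q = - x + p + - x"
    by (simp only: p_def q_def x_def group_normalize)
  then have "word_val (pair_val (fr w) x) Y = 0"
    by (simp add: Y_def flip: pq) (simp only: group_normalize)
  moreover have "reduced Y"
    unfolding Y_def by (auto simp: successively_Cons successively_append_iff reduced_replicate
       hd_append hd_replicate linv_pair winv_replicate)
  moreover have "fst ` set Y \<subseteq> {0, 1}"
    by (auto simp: Y_def winv_replicate linv_pair)
  ultimately have "Y = []" using free_pair_diff[OF ab] unfolding free_pair_def x_def by blast
  then show False by (simp add: Y_def)
qed

text \<open>Closed walks with word \<open>z\<close> at both vertices make two conjugates p and q of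
  \<open>z\<close> powers of \<open>w\<close>, with q = x^-1 p x. For nontrivial \<open>z\<close>
  this is a relation in a free pair.\<close>

lemma pair_graph_acyclic:
  assumes ab: "a \<le> length w" "b \<le> length w" "cblk a \<noteq> cblk b" and red: "reduced z"
    and walk: "cyc_walk a z a" "cyc_walk b z b"
  shows "z = []"
proof (rule ccontr)
  assume "z \<noteq> []"
  then have z0: "fr z \<noteq> 0" using reduced_fr_eq_0[OF red] by blast
  define x where "x = pre w a - pre w b"
  define p where "p = pre w a + fr z - pre w a"
  define q where "q = pre w b + fr z - pre w b"
  have "p \<in> sgp {fr w}" "q \<in> sgp {fr w}"
    using walk_cyc_sgp[OF walk(1) ab(1,1)] walk_cyc_sgp[OF walk(2) ab(2,2)] by (simp_all add: p_def q_def)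
  then obtain k \<alpha> l \<beta> where pq: "p = word_val (pair_val (fr w) x) (replicate k (0, \<alpha>))"
    "q = word_val (pair_val (fr w) x) (replicate l (0, \<beta>))" using sgp_sing_power by metis
  have "fr z = - pre w a + p + pre w a" "fr z = - pre w b + q + pre w b"
    by (simp_all only: p_def q_def group_normalize)
  then have "p \<noteq> 0" "q \<noteq> 0" using z0 by (auto simp only: group_normalize)
  \<comment> \<open>The power between the letters for x^-1 and x must not be empty, or they would
    cancel.\<close>
  then have kl: "k \<noteq> 0" "l \<noteq> 0" by (metis pq replicate_0 word_val.simps(1))+
  define Y where "Y = (1, False) # replicate k (0, \<alpha>) @ [(1, True)] @ winv (replicate l (0, \<beta>))"
  have "q = - x + p + x"
    by (simp only: p_def q_def x_def group_normalize)
  then have "word_val (pair_val (fr w) x) Y = 0"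
    by (simp add: Y_def flip: pq) (simp only: group_normalize)
  moreover have "reduced Y"
    unfolding Y_def using kl by (auto simp: successively_Cons successively_append_iff reduced_replicate
       hd_append hd_replicate linv_pair winv_replicate)
  moreover have "fst ` set Y \<subseteq> {0, 1}"
    by (auto simp: Y_def winv_replicate linv_pair)
  ultimately have "Y = []" using free_pair_diff[OF ab] unfolding free_pair_def x_def by blast
  then show False by (simp add: Y_def)
qed

text \<open>Multiplying the second generator by powers of \<open>w\<close> on either side keeps the
  subgroup.\<close>

lemma two_gen_cong:
  assumes "p \<in> sgp {fr w}" "q \<in> sgp {fr w}" "pre w c - pre w d = p + (pre w a - pre w b) + q"
  shows "two_gen w a b = two_gen w c d"
  unfolding two_gen_def
proof (rule coset_part_cong, rule sgp_eqI)
  have pq: "p \<in> sgp {fr w, y}" "q \<in> sgp {fr w, y}" for y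
    using assms(1,2) sgp_mono[of "{fr w}" "{fr w, y}"] by auto
  have "pre w a - pre w b = - p + (pre w c - pre w d) + - q"
    unfolding assms(3) by (simp only: group_normalize)
  also have "\<dots> \<in> sgp {fr w, pre w c - pre w d}"
    by (intro sgp.plus sgp.uminus pq) (simp add: sgp.gen)
  finally show "{fr w, pre w a - pre w b} \<subseteq> sgp {fr w, pre w c - pre w d}" by (simp add: sgp.gen)
  have "pre w c - pre w d \<in> sgp {fr w, pre w a - pre w b}"
    unfolding assms(3) by (intro sgp.plus pq) (simp add: sgp.gen)
  then show "{fr w, pre w c - pre w d} \<subseteq> sgp {fr w, pre w a - pre w b}" by (simp add: sgp.gen)
qed

lemma two_gen_swap: "two_gen w b a = two_gen w a b"
  unfolding two_gen_def
proof (rule coset_part_cong, rule sgp_eqI)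
  have "pre w c - pre w d \<in> sgp {fr w, pre w d - pre w c}" for c d
    by (rule sgp_sym) (simp add: sgp.gen)
  then show "{fr w, pre w b - pre w a} \<subseteq> sgp {fr w, pre w a - pre w b}"
    "{fr w, pre w a - pre w b} \<subseteq> sgp {fr w, pre w b - pre w a}" by (simp_all add: sgp.gen)
qed

text \<open>Both prefixes acquire left factors that are powers of \<open>w\<close> and the common
  right factor \<open>z\<close>, which disappears from their difference.\<close>

lemma pair_walk_imp_two_gen_eq:
  assumes "a \<le> length w" "b \<le> length w" "c \<le> length w" "d \<le> length w"
    and walk: "cyc_walk a z c" "cyc_walk b z d"
  shows "two_gen w a b = two_gen w c d"
proof -
  define p where "p = pre w a + fr z - pre w c"
  define q where "q = pre w b + fr z - pre w d"
  have "p \<in> sgp {fr w}" "q \<in> sgp {fr w}"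
    using walk_cyc_sgp[OF walk(1) assms(1,3)] walk_cyc_sgp[OF walk(2) assms(2,4)]
    by (simp_all add: p_def q_def)
  then show ?thesis
  proof (intro two_gen_cong[of "- p" q] sgp.uminus)
    show "pre w c - pre w d = - p + (pre w a - pre w b) + q"
      by (simp only: p_def q_def group_normalize)
  qed
qed

text \<open>The equation provides two words of equal value, read by walks through the block of 0
  from \<open>c\<close> to \<open>a\<close> and from \<open>d\<close> to \<open>b\<close>. Free
  reduction keeps the ends of both walks and makes the words equal, so one word serves both.\<close>

lemma translate_imp_pair_walk:
  assumes le: "a \<le> length w" "b \<le> length w" "c \<le> length w" "d \<le> length w"
    and pq: "p \<in> sgp {fr w}" "q \<in> sgp {fr w}" "pre w c - pre w d = p + (pre w a - pre w b) + q"
  shows "\<exists>z. cyc_walk c z a \<and> cyc_walk d z b"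
proof -
  let ?R = cyc_graph and ?p = "cblk"
  have loop: "walk ?R (?p 0) w (?p 0)"
    using walk_trail_img_take[of "length w" w ?p] realizable_cyc[of w] by (simp add: realizable_iff)
  obtain zp where zp: "fr zp = p" "walk ?R (?p 0) zp (?p 0)"
    using sgp_sing_walk[OF pq(1) loop] by blast
  obtain zq where zq: "fr zq = q" "walk ?R (?p 0) zq (?p 0)"
    using sgp_sing_walk[OF pq(2) loop] by blast
  note take = walk_trail_img_take[of _ w ?p]
  define z1 where "z1 = winv (take c w) @ zp @ take a w"
  define z2 where "z2 = winv (take d w) @ winv zq @ take b w"
  have "walk ?R (?p c) z1 (?p a)" "walk ?R (?p d) z2 (?p b)"
    using take[OF le(1)] take[OF le(2)] take[OF le(3)] take[OF le(4)] zp(2) zq(2)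
    unfolding z1_def z2_def walk_append walk_winv by blast+
  then obtain z1' z2' where z': "reduced z1'" "fr z1' = fr z1" "walk ?R (?p c) z1' (?p a)"
    "reduced z2'" "fr z2' = fr z2" "walk ?R (?p d) z2' (?p b)"
    using reduced_walk[OF det_graph_cyc] by metis
  have "pre w c = pre w c - pre w d + pre w d" by simp
  also have "\<dots> = p + (pre w a - pre w b) + q + pre w d" unfolding pq(3) ..
  finally have "fr z1 = fr z2"
    by (simp only: z1_def z2_def fr_append fr_winv zp(1) zq(1) pre_def[symmetric] group_normalize)
  then have "z1' = z2'" using z' reduced_fr_inj by metis
  then show ?thesis using z' by blast
qed

text \<open>Up to powers of \<open>w\<close>, \<open>free_pair_second_generator\<close> leaves only
  the difference for \<open>a\<close>, \<open>b\<close> and its inverse; the inverse belongs to the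
  swapped pair.\<close>

lemma two_gen_eq_imp_pair_walk:
  assumes le: "a \<le> length w" "b \<le> length w" "c \<le> length w" "d \<le> length w"
    and ne: "cblk a \<noteq> cblk b" "cblk c \<noteq> cblk d"
    and eq: "two_gen w c d = two_gen w a b"
  shows "\<exists>z. cyc_walk c z a \<and> cyc_walk d z b \<or>
     cyc_walk c z b \<and> cyc_walk d z a"
proof -
  let ?x = "pre w a - pre w b" and ?y = "pre w c - pre w d"
  have "?y \<in> sgp {fr w, ?x}"
    using blk_two_gen[OF le(3,4)] blk_coset[OF le(3,4), of "{fr w, ?x}"] eq by (simp add: two_gen_def)
  moreover have "?x \<in> sgp {fr w, ?y}"
    using blk_two_gen[OF le(1,2)] blk_coset[OF le(1,2), of "{fr w, ?y}"] eq[symmetric] by (simp add: two_gen_def)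
  moreover have "?y \<notin> sgp {fr w}" using ne(2) blk_coset[OF le(3,4)] by (simp add: cyc_def)
  ultimately obtain p q where pq: "p \<in> sgp {fr w}" "q \<in> sgp {fr w}" "?y = p + ?x + q \<or> ?y = p + - ?x + q"
    using free_pair_second_generator[OF free_pair_diff[OF le(1,2) ne(1)]] by blast
  from pq(3) show ?thesis
  proof
    assume "?y = p + ?x + q"
    then show ?thesis using translate_imp_pair_walk[OF le pq(1,2)] by blast
  next
    assume "?y = p + - ?x + q"
    then have "?y = p + (pre w b - pre w a) + q" by simp
    then show ?thesis using translate_imp_pair_walk[OF le(2,1,3,4) pq(1,2)] by blast
  qed
qed

text \<open>The graph of pairs of \<open>cyc w\<close> is a forest, so vertices minus edges count
  its components. A quotient of type A corresponds to the component of a pair together with that of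
  the swapped pair, hence the factor 2.\<close>

lemma card_type_A_2:
  assumes I: "finite I" "fst ` set w \<subseteq> I"
  shows "2 * card (type_A_2 w) + (\<Sum>i\<in>I. card {(U, V). (i, U, V) \<in> quotient_edges w (cyc w)} *
      (card {(U, V). (i, U, V) \<in> quotient_edges w (cyc w)} - 1)) =
    card (cyc w) * (card (cyc w) - 1)"
proof -
  let ?R = cyc_graph and ?p = "cblk"
  have part: "partition_on (trail_vertices w) (cyc w)" by (simp add: cyc_def partition_coset)
  note mem = mem_partition_iff[OF part]
  have finP: "finite (cyc w)" by (simp add: cyc_def coset_part_def)
  define D where "D = (SIGMA U:cyc w. cyc w - {U})"
  have cardD: "card D = card (cyc w) * (card (cyc w) - 1)"
    using finP by (simp add: D_def card_SigmaI)
  have finD: "finite D" using finP by (simp add: D_def)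
  have finR: "finite ?R" by (simp add: trail_img_eq)
  have inP: "U \<in> cyc w \<and> V \<in> cyc w \<and> i \<in> I" if "(i, U, V) \<in> ?R" for i U V
    using that I(2) blk_in[OF part] unfolding trail_img_eq qedge_def
    by (force split: if_splits)
  define rep where "rep U = (SOME a. a \<le> length w \<and> U = ?p a)" for U
  have rep: "rep U \<le> length w \<and> U = ?p (rep U)" if "U \<in> cyc w" for U
    unfolding rep_def by (rule someI_ex) (use that mem in blast)
  have finPG: "finite (pair_graph ?R)"
  proof (rule finite_subset)
    show "pair_graph ?R \<subseteq> I \<times> ((cyc w \<times> cyc w) \<times> (cyc w \<times> cyc w))"
      using inP by (auto simp: pair_graph_def)
  qed (use I(1) finP in simp)
  have "\<exists>f :: nat set \<times> nat set \<Rightarrow> nat set \<times> nat set. card (f ` D) + card (pair_graph ?R) = card D \<and>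
    (\<forall>d\<in>D. \<forall>d'\<in>D. f d = f d' \<longleftrightarrow> (\<exists>z. walk (pair_graph ?R) d z d'))"
  proof (rule forest_components[OF finPG finD])
    show "d \<in> D \<and> d' \<in> D" if "(i, d, d') \<in> pair_graph ?R" for i d d'
    proof -
      obtain U V U' V' where e: "d = (U, V)" "d' = (U', V')" "(i, U, U') \<in> ?R" "(i, V, V') \<in> ?R" "U \<noteq> V"
        using \<open>(i, d, d') \<in> pair_graph ?R\<close> by (auto simp: pair_graph_def)
      then have "U' \<noteq> V'" using det_graph_cyc unfolding det_graph_iff by blast
      then show ?thesis using e inP[OF e(3)] inP[OF e(4)] by (auto simp: D_def)
    qed
    show "det_graph (pair_graph ?R)" by (rule det_graph_pair_graph[OF det_graph_cyc])
    show "z = []" if d: "d \<in> D" "reduced z" "walk (pair_graph ?R) d z d" for d z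
    proof -
      obtain U V where UV: "d = (U, V)" "U \<in> cyc w" "V \<in> cyc w" "U \<noteq> V" using d(1) by (auto simp: D_def)
      have "walk ?R U z U" "walk ?R V z V"
        using d(3) UV walk_pair_graph[OF det_graph_cyc UV(4)] by simp_all
      then show ?thesis using pair_graph_acyclic[of "rep U" "rep V" z] rep[OF UV(2)] rep[OF UV(3)] UV(4) d(2) by simp
    qed
  qed
  then obtain f :: "nat set \<times> nat set \<Rightarrow> nat set \<times> nat set"
    where f: "card (f ` D) + card (pair_graph ?R) = card D"
    "\<And>d d'. d \<in> D \<Longrightarrow> d' \<in> D \<Longrightarrow> f d = f d' \<longleftrightarrow> (\<exists>z. walk (pair_graph ?R) d z d')" by blast
  have f_iff: "f (U, V) = f (U', V') \<longleftrightarrow> (\<exists>z. walk ?R U z U' \<and> walk ?R V z V')"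
    if "(U, V) \<in> D" "(U', V') \<in> D" for U V U' V'
  proof -
    have "U \<noteq> V" using that(1) by (auto simp: D_def)
    then show ?thesis using f(2)[OF that] walk_pair_graph[OF det_graph_cyc] by simp
  qed
  define g where "g = (\<lambda>(U, V). two_gen w (rep U) (rep V))"
  have "card (f ` D) = 2 * card (g ` D)"
  proof (rule card_two_to_one[where s = prod.swap, OF finD])
    show "prod.swap d \<in> D" if "d \<in> D" for d using that by (auto simp: D_def)
    show "f d \<noteq> f (prod.swap d)" if d: "d \<in> D" for d
    proof
      assume eq: "f d = f (prod.swap d)"
      obtain U V where UV: "d = (U, V)" "U \<in> cyc w" "V \<in> cyc w" "U \<noteq> V" using d by (auto simp: D_def)
      have "(U, V) \<in> D" "(V, U) \<in> D" using UV by (auto simp: D_def)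
      then obtain z where "walk ?R U z V" "walk ?R V z U" using eq f_iff UV(1) by auto
      then show False using pair_graph_no_swap[of "rep U" "rep V" z] rep[OF UV(2)] rep[OF UV(3)] UV(4) by simp
    qed
    show "g d' = g d \<longleftrightarrow> f d' = f d \<or> f d' = f (prod.swap d)" if d: "d \<in> D" "d' \<in> D" for d d'
    proof -
      obtain U V where UV: "d = (U, V)" "U \<in> cyc w" "V \<in> cyc w" "U \<noteq> V" using d(1) by (auto simp: D_def)
      obtain U' V' where UV': "d' = (U', V')" "U' \<in> cyc w" "V' \<in> cyc w" "U' \<noteq> V'" using d(2) by (auto simp: D_def)
      have inD: "(U, V) \<in> D" "(V, U) \<in> D" "(U', V') \<in> D" using UV UV' by (auto simp: D_def)
      note r = rep[OF UV(2)] rep[OF UV(3)] rep[OF UV'(2)] rep[OF UV'(3)]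
      show ?thesis
      proof
        assume "g d' = g d"
        then have "two_gen w (rep U') (rep V') = two_gen w (rep U) (rep V)" by (simp add: g_def UV UV')
        then obtain z where "walk ?R U' z U \<and> walk ?R V' z V \<or> walk ?R U' z V \<and> walk ?R V' z U"
          using two_gen_eq_imp_pair_walk[of "rep U" "rep V" "rep U'" "rep V'"] r UV(4) UV'(4) by auto
        then show "f d' = f d \<or> f d' = f (prod.swap d)"
          using f_iff[OF inD(3,1)] f_iff[OF inD(3,2)] UV(1) UV'(1) by auto
      next
        assume "f d' = f d \<or> f d' = f (prod.swap d)"
        then obtain z where "walk ?R U' z U \<and> walk ?R V' z V \<or> walk ?R U' z V \<and> walk ?R V' z U"
          using f_iff[OF inD(3,1)] f_iff[OF inD(3,2)] UV(1) UV'(1) by auto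
        then show "g d' = g d"
          using pair_walk_imp_two_gen_eq[of "rep U'" "rep V'" "rep U" "rep V" z]
            pair_walk_imp_two_gen_eq[of "rep U'" "rep V'" "rep V" "rep U" z] r
            two_gen_swap[of "rep U" "rep V"]
          by (auto simp: g_def UV UV')
      qed
    qed
  qed
  moreover have "g ` D = type_A_2 w"
  proof (intro set_eqI iffI)
    fix P assume "P \<in> g ` D"
    then obtain U V where UV: "P = two_gen w (rep U) (rep V)" "U \<in> cyc w" "V \<in> cyc w" "U \<noteq> V"
      by (auto simp: D_def g_def)
    show "P \<in> type_A_2 w" unfolding type_A_2_iff
      by (intro exI[of _ "rep U"] exI[of _ "rep V"]) (use UV rep[OF UV(2)] rep[OF UV(3)] in simp)
  next
    fix P assume "P \<in> type_A_2 w"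
    then obtain a b where ab: "a \<le> length w" "b \<le> length w" "?p a \<noteq> ?p b" "P = two_gen w a b"
      unfolding type_A_2_iff by blast
    have in_: "?p a \<in> cyc w" "?p b \<in> cyc w" using ab blk_in[OF part] by auto
    \<comment> \<open>The empty walk shows that the quotient does not depend on the choice of
      representatives.\<close>
    have "P = g (?p a, ?p b)"
      using pair_walk_imp_two_gen_eq[of a b "rep (?p a)" "rep (?p b)" "[]"] ab
        rep[OF in_(1)] rep[OF in_(2)] by (simp add: g_def)
    then show "P \<in> g ` D" using in_ ab(3) by (auto simp: D_def)
  qed
  moreover have "card (pair_graph ?R) = (\<Sum>i\<in>I. card {(U, V). (i, U, V) \<in> quotient_edges w (cyc w)} *
      (card {(U, V). (i, U, V) \<in> quotient_edges w (cyc w)} - 1))"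
    unfolding quotient_edges_eq[OF part]
    by (rule card_pair_graph[OF finR det_graph_cyc _ I(1)]) (use inP in blast)
  ultimately show ?thesis using f(1) cardD by simp
qed

end

subsection \<open>The expected number of fixed points\<close>

text \<open>Fix one extension \<open>f\<close>; all extensions are \<open>f\<close> composed with
  the permutations of \<open>A - Domain R\<close>.\<close>

lemma card_permutes_extending:
  assumes A: "finite A" and R: "R \<subseteq> A \<times> A"
    and inj: "\<And>u v u' v'. (u, v) \<in> R \<Longrightarrow> (u', v') \<in> R \<Longrightarrow> u = u' \<longleftrightarrow> v = v'"
  shows "card {p. p permutes A \<and> (\<forall>(u, v)\<in>R. p u = v)} = fact (card A - card R)"
proof -
  obtain f where f: "f permutes A" "\<forall>(u, v)\<in>R. f u = v"
    using partial_injection_extends[OF A R inj] by blast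
  have "{p. p permutes A \<and> (\<forall>(u, v)\<in>R. p u = v)} = (\<lambda>q. f \<circ> q) ` {q. q permutes (A - Domain R)}"
  proof (intro set_eqI iffI)
    fix p assume p: "p \<in> {p. p permutes A \<and> (\<forall>(u, v)\<in>R. p u = v)}"
    have "inv f \<circ> p permutes A" using p f(1) by (simp add: permutes_compose permutes_inv)
    moreover have "(inv f \<circ> p) u = u" if u: "u \<in> A - (A - Domain R)" for u
    proof -
      obtain v where "(u, v) \<in> R" using u by blast
      then have "p u = f u" using p f(2) by fastforce
      then show ?thesis using permutes_inverses(2)[OF f(1)] by simp
    qed
    ultimately have "inv f \<circ> p permutes (A - Domain R)" by (rule permutes_superset)
    moreover have "p = f \<circ> (inv f \<circ> p)" using permutes_inverses(1)[OF f(1)] by (simp add: fun_eq_iff)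
    ultimately show "p \<in> (\<lambda>q. f \<circ> q) ` {q. q permutes (A - Domain R)}" by blast
  next
    fix p assume "p \<in> (\<lambda>q. f \<circ> q) ` {q. q permutes (A - Domain R)}"
    then obtain q where q: "p = f \<circ> q" "q permutes (A - Domain R)" by blast
    have "q permutes A" using q(2) by (rule permutes_subset) simp
    then have "p permutes A" using q(1) f(1) by (simp add: permutes_compose)
    moreover have "p u = v" if "(u, v) \<in> R" for u v
    proof -
      have "q u = u" using that by (intro permutes_not_in[OF q(2)]) blast
      then show ?thesis using f(2) that q(1) by auto
    qed
    ultimately show "p \<in> {p. p permutes A \<and> (\<forall>(u, v)\<in>R. p u = v)}" by blast
  qed
  moreover have "inj_on (\<lambda>q. f \<circ> q) {q. q permutes (A - Domain R)}"
    using permutes_inj[OF f(1)] by (auto simp: inj_on_def fun_eq_iff dest: injD)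
  ultimately have "card {p. p permutes A \<and> (\<forall>(u, v)\<in>R. p u = v)} = card {q. q permutes (A - Domain R)}"
    by (simp add: card_image)
  also have "\<dots> = fact (card (A - Domain R))" using A by (simp add: card_permutations)
  also have "card (A - Domain R) = card A - card (Domain R)"
    using R A by (intro card_Diff_subset) (auto intro: finite_subset)
  also have "card (Domain R) = card R"
  proof -
    have "inj_on fst R" using inj by (auto simp: inj_on_def)
    then show ?thesis by (simp add: Domain_fst card_image)
  qed
  finally show ?thesis .
qed

definition edge_count :: "word \<Rightarrow> nat set set \<Rightarrow> nat \<Rightarrow> nat" where
  "edge_count w P i = card {(U, V). (i, U, V) \<in> quotient_edges w P}"

text \<open>Stating the condition on the edges of the trail treats inverse letters without inverse
  permutations, as their edges point backwards.\<close>

definition trajectories :: "word \<Rightarrow> nat \<Rightarrow> (nat \<Rightarrow> nat \<Rightarrow> nat) \<Rightarrow> (nat \<Rightarrow> nat) set" where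
  "trajectories w n \<sigma> = {t \<in> {..length w} \<rightarrow>\<^sub>E {1..n}. t 0 = t (length w) \<and>
     (\<forall>(i, a, b)\<in>trail_edges w. \<sigma> i (t a) = t b)}"

lemma word_perm_append: "word_perm \<sigma> (a @ b) x = word_perm \<sigma> b (word_perm \<sigma> a x)"
  by (induction a arbitrary: x) auto

lemma trail_edges_iff:
  "(i, a, b) \<in> trail_edges w \<longleftrightarrow> (\<exists>j<length w. fst (w ! j) = i \<and>
     (if snd (w ! j) then a = j \<and> b = Suc j else a = Suc j \<and> b = j))"
proof -
  have "trail_edges w = qedge w (\<lambda>j. j) ` {..<length w}"
    using trail_img_eq[of w "\<lambda>j. j"] by (simp add: trail_img_def)
  then show ?thesis by (auto simp: qedge_def image_iff Bex_def split: if_splits)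
qed

text \<open>Every position determines the next one, so a fixed point is the start of exactly one
  closed trajectory.\<close>

lemma num_fixed_points_eq_trajectories:
  assumes w: "word_over k w" and \<sigma>: "\<sigma> \<in> perm_tuples k n"
  shows "num_fixed_points w n \<sigma> = card (trajectories w n \<sigma>)"
proof -
  have perm: "\<sigma> (fst (w ! j)) permutes {1..n}" if "j < length w" for j
  proof -
    have "w ! j \<in> set w" using that by simp
    then have "fst (w ! j) \<in> {1..k}" using bspec[OF w[unfolded word_over_def]] by (fastforce simp: case_prod_beta)
    then show ?thesis using PiE_mem[OF \<sigma>[unfolded perm_tuples_def]] by auto
  qed
  define tr where "tr x = (\<lambda>j\<in>{..length w}. word_perm \<sigma> (take j w) x)" for x
  have step: "word_perm \<sigma> (take (Suc j) w) x = letter_perm \<sigma> (w ! j) (word_perm \<sigma> (take j w) x)"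
    if "j < length w" for j x
    using that by (simp add: take_Suc_conv_app_nth word_perm_append)
  have lperm: "letter_perm \<sigma> (w ! j) permutes {1..n}" if "j < length w" for j
    using perm[OF that] by (cases "w ! j") (auto simp: permutes_inv)
  have inN: "word_perm \<sigma> (take j w) x \<in> {1..n}" if "x \<in> {1..n}" "j \<le> length w" for x j
    using that(2)
  proof (induction j)
    case (Suc j)
    then show ?case using permutes_in_image[OF lperm[of j]] step[of j x] by simp
  qed (use that in simp)
  have edge: "\<sigma> i (tr x a) = tr x b" if e: "(i, a, b) \<in> trail_edges w" for i a b x
  proof -
    obtain j where j: "j < length w" "fst (w ! j) = i"
      "if snd (w ! j) then a = j \<and> b = Suc j else a = Suc j \<and> b = j"
      using e unfolding trail_edges_iff by blast
    show ?thesis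
      using j step[OF j(1), of x] permutes_inverses(1)[OF perm[OF j(1)]]
      by (cases "w ! j") (auto simp: tr_def split: if_splits)
  qed
  have tr_unique: "t j = word_perm \<sigma> (take j w) (t 0)"
    if t: "t \<in> trajectories w n \<sigma>" "j \<le> length w" for t j
    using t(2)
  proof (induction j)
    case (Suc j)
    have j: "j < length w" using Suc.prems by simp
    have "t (Suc j) = letter_perm \<sigma> (w ! j) (t j)"
    proof (cases "snd (w ! j)")
      case True
      then have "(fst (w ! j), j, Suc j) \<in> trail_edges w" unfolding trail_edges_iff using j by auto
      then show ?thesis using t(1) True unfolding trajectories_def by (cases "w ! j") fastforce
    next
      case False
      then have "(fst (w ! j), Suc j, j) \<in> trail_edges w" unfolding trail_edges_iff using j by auto
      then have "\<sigma> (fst (w ! j)) (t (Suc j)) = t j" using t(1) unfolding trajectories_def by fastforce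
      then have "t (Suc j) = inv (\<sigma> (fst (w ! j))) (t j)"
        using permutes_inverses(2)[OF perm[OF j], of "t (Suc j)"] by simp
      then show ?thesis using False by (cases "w ! j") auto
    qed
    then show ?case using Suc.IH j step[OF j] by simp
  qed simp
  have "bij_betw tr {x \<in> {1..n}. word_perm \<sigma> w x = x} (trajectories w n \<sigma>)"
  proof (rule bij_betw_byWitness[where f' = "\<lambda>t. t 0"])
    show "\<forall>x\<in>{x \<in> {1..n}. word_perm \<sigma> w x = x}. tr x 0 = x" by (simp add: tr_def)
    show "\<forall>t\<in>trajectories w n \<sigma>. tr (t 0) = t"
    proof
      fix t assume t: "t \<in> trajectories w n \<sigma>"
      show "tr (t 0) = t"
      proof
        fix j show "tr (t 0) j = t j"
        proof (cases "j \<le> length w")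
          case True
          then show ?thesis using tr_unique[OF t True] by (simp add: tr_def)
        next
          case False
          then show ?thesis using t by (auto simp: tr_def trajectories_def PiE_def extensional_def)
        qed
      qed
    qed
    show "tr ` {x \<in> {1..n}. word_perm \<sigma> w x = x} \<subseteq> trajectories w n \<sigma>"
    proof
      fix t assume "t \<in> tr ` {x \<in> {1..n}. word_perm \<sigma> w x = x}"
      then obtain x where x: "x \<in> {1..n}" "word_perm \<sigma> w x = x" "t = tr x" by blast
      have "t \<in> {..length w} \<rightarrow>\<^sub>E {1..n}" unfolding x(3) tr_def using inN[OF x(1)] by auto
      moreover have "t 0 = t (length w)" using x by (simp add: tr_def)
      ultimately show "t \<in> trajectories w n \<sigma>" using edge x(3) by (auto simp: trajectories_def)
    qed
    show "(\<lambda>t. t 0) ` trajectories w n \<sigma> \<subseteq> {x \<in> {1..n}. word_perm \<sigma> w x = x}"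
    proof
      fix x assume "x \<in> (\<lambda>t. t 0) ` trajectories w n \<sigma>"
      then obtain t where t: "t \<in> trajectories w n \<sigma>" "x = t 0" by blast
      have "t 0 \<in> {1..n}" using t(1) PiE_mem[of t "{..length w}" "\<lambda>_. {1..n}" 0]
        by (simp add: trajectories_def)
      moreover have "word_perm \<sigma> w (t 0) = t 0"
        using tr_unique[OF t(1), of "length w"] t(1) by (simp add: trajectories_def)
      ultimately show "x \<in> {x \<in> {1..n}. word_perm \<sigma> w x = x}" using t(2) by simp
    qed
  qed
  then show ?thesis unfolding num_fixed_points_def by (rule bij_betw_same_card)
qed

section \<open>Trajectories sorted by their coincidences\<close>

definition kernel_maps :: "word \<Rightarrow> nat \<Rightarrow> nat set set \<Rightarrow> (nat \<Rightarrow> nat) set" where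
  "kernel_maps w n P = {t \<in> {..length w} \<rightarrow>\<^sub>E {1..n}.
     \<forall>a\<le>length w. \<forall>b\<le>length w. t a = t b \<longleftrightarrow> blk P a = blk P b}"

text \<open>Such a map is an injection of the blocks into {1..n}. With more than n blocks the
  truncated factor for i = n is 0, as it should be.\<close>

lemma card_kernel_maps:
  assumes P: "partition_on (trail_vertices w) P"
  shows "card (kernel_maps w n P) = (\<Prod>i<card P. n - i)"
proof -
  have fin: "finite P" using partition_eq_image[OF P] by (metis finite_atMost finite_imageI)
  define H where "H = {h \<in> P \<rightarrow>\<^sub>E {1..n}. inj_on h P}"
  define m where "m h = (\<lambda>j\<in>{..length w}. h (blk P j))" for h :: "nat set \<Rightarrow> nat"
  have "bij_betw m H (kernel_maps w n P)"
    unfolding bij_betw_def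
  proof
    show "inj_on m H"
    proof (rule inj_onI)
      fix h h' assume h: "h \<in> H" "h' \<in> H" "m h = m h'"
      show "h = h'"
      proof (rule PiE_ext[of h P "\<lambda>_. {1..n}"])
        show "h \<in> P \<rightarrow>\<^sub>E {1..n}" "h' \<in> P \<rightarrow>\<^sub>E {1..n}" using h by (auto simp: H_def)
        fix U assume "U \<in> P"
        then obtain a where a: "a \<le> length w" "U = blk P a" using mem_partition_iff[OF P] by blast
        then show "h U = h' U" using fun_cong[OF h(3), of a] by (simp add: m_def)
      qed
    qed
    show "m ` H = kernel_maps w n P"
    proof (intro set_eqI iffI)
      fix t assume "t \<in> m ` H"
      then obtain h where h: "h \<in> H" "t = m h" by blast
      have "h (blk P a) = h (blk P b) \<longleftrightarrow> blk P a = blk P b" if "a \<le> length w" "b \<le> length w" for a b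
        using h(1) blk_in[OF P] that by (auto simp: H_def dest: inj_onD)
      moreover have "h (blk P a) \<in> {1..n}" if "a \<le> length w" for a
        using h(1) blk_in[OF P that] by (auto simp: H_def)
      ultimately show "t \<in> kernel_maps w n P" unfolding h(2) by (auto simp: kernel_maps_def m_def)
    next
      fix t assume t: "t \<in> kernel_maps w n P"
      define rep where "rep U = (SOME a. a \<le> length w \<and> U = blk P a)" for U
      have rep: "rep U \<le> length w \<and> U = blk P (rep U)" if "U \<in> P" for U
        unfolding rep_def by (rule someI_ex) (use that mem_partition_iff[OF P] in blast)
      define h where "h = (\<lambda>U\<in>P. t (rep U))"
      have tN: "t a \<in> {1..n}" if "a \<le> length w" for a
        using t that PiE_mem[of t "{..length w}" "\<lambda>_. {1..n}" a] by (simp add: kernel_maps_def)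
      have tk: "t a = t b \<longleftrightarrow> blk P a = blk P b" if "a \<le> length w" "b \<le> length w" for a b
        using t that by (simp add: kernel_maps_def)
      have "h \<in> P \<rightarrow>\<^sub>E {1..n}" unfolding h_def using rep tN by auto
      moreover have "inj_on h P"
      proof (rule inj_onI)
        fix U V assume UV: "U \<in> P" "V \<in> P" "h U = h V"
        then have "t (rep U) = t (rep V)" by (simp add: h_def)
        then show "U = V" using tk rep[OF UV(1)] rep[OF UV(2)] by metis
      qed
      moreover have "t = m h"
      proof
        fix j show "t j = m h j"
        proof (cases "j \<le> length w")
          case True
          have b: "blk P j \<in> P" using blk_in[OF P True] by simp
          have "t j = t (rep (blk P j))" using tk[OF True] rep[OF b] by metis
          then show ?thesis using True b by (simp add: m_def h_def)
        next
          case False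
          then show ?thesis using t by (auto simp: m_def kernel_maps_def PiE_def extensional_def)
        qed
      qed
      ultimately show "t \<in> m ` H" by (auto simp: H_def)
    qed
  qed
  then have "card (kernel_maps w n P) = card H" by (rule bij_betw_same_card[symmetric])
  also have "\<dots> = (\<Prod>i = 0..<card P. n - i)"
    unfolding H_def using fin card_inj_on_subset_funcset[of P "{1..n}" P] by simp
  finally show ?thesis by (simp add: atLeast0LessThan)
qed


lemma card_image_same_kernel:
  assumes "\<And>x y. x \<in> E \<Longrightarrow> y \<in> E \<Longrightarrow> f x = f y \<longleftrightarrow> g x = g y"
  shows "card (f ` E) = card (g ` E)"
proof -
  define h where "h u = g (inv_into E f u)" for u
  have h: "h (f x) = g x" if "x \<in> E" for x
  proof -
    have "inv_into E f (f x) \<in> E" "f (inv_into E f (f x)) = f x"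
      using that by (auto intro: inv_into_into f_inv_into_f)
    then show ?thesis unfolding h_def using assms that by blast
  qed
  have "bij_betw h (f ` E) (g ` E)"
    unfolding bij_betw_def
  proof
    show "inj_on h (f ` E)" using h assms by (auto simp: inj_on_def)
    show "h ` f ` E = g ` E" using h by (simp add: image_image)
  qed
  then show ?thesis by (rule bij_betw_same_card)
qed

lemma ex_kernel_partition:
  "\<exists>P. partition_on (trail_vertices w) P \<and>
     (\<forall>a\<le>length w. \<forall>b\<le>length w. t a = t b \<longleftrightarrow> blk P a = blk P b)"
proof -
  define K where "K a = {b. b \<le> length w \<and> t b = t a}" for a
  define P where "P = K ` {..length w}"
  have self: "a \<in> K a" if "a \<le> length w" for a using that by (simp add: K_def)
  have P: "partition_on (trail_vertices w) P"
  proof (rule partition_onI)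
    show "\<Union> P = trail_vertices w" using self by (auto simp: P_def K_def)
    show "disjnt U V" if "U \<in> P" "V \<in> P" "U \<noteq> V" for U V
      using that by (auto simp: P_def K_def disjnt_def)
    show "{} \<notin> P" using self by (auto simp: P_def)
  qed
  have "t a = t b \<longleftrightarrow> blk P a = blk P b" if "a \<le> length w" "b \<le> length w" for a b
  proof -
    have "blk P a = K a" "blk P b = K b" using blk_eq[OF P] self that by (auto simp: P_def)
    then show ?thesis using self[OF that(1)] self[OF that(2)] by (auto simp: K_def)
  qed
  then show ?thesis using P by blast
qed

lemma trail_edges_le: "(i, a, b) \<in> trail_edges w \<Longrightarrow> a \<le> length w \<and> b \<le> length w"
  by (auto simp: trail_edges_iff split: if_splits)

lemma det_graph_trail_img_iff:
  "det_graph (trail_img w q) \<longleftrightarrow> (\<forall>i a b a' b'. (i, a, b) \<in> trail_edges w \<longrightarrow>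
      (i, a', b') \<in> trail_edges w \<longrightarrow> (q a = q a' \<longleftrightarrow> q b = q b'))"
  unfolding det_graph_iff trail_img_def by (fastforce simp: image_iff)

lemma det_graph_same_kernel:
  assumes "\<And>a b. a \<le> length w \<Longrightarrow> b \<le> length w \<Longrightarrow> t a = t b \<longleftrightarrow> p a = p b"
  shows "det_graph (trail_img w t) \<longleftrightarrow> det_graph (trail_img w p)"
  unfolding det_graph_trail_img_iff using assms trail_edges_le by meson

lemma finite_perm_tuples: "finite (perm_tuples k n)"
  by (simp add: perm_tuples_def finite_PiE finite_permutations)

lemma card_perm_tuples: "card (perm_tuples k n) = fact n ^ k"
  by (simp add: perm_tuples_def card_PiE card_permutations)

lemma finite_realizable_quotients: "finite (realizable_quotients w)"
proof (rule finite_subset)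
  show "realizable_quotients w \<subseteq> Pow (Pow {..length w})"
    by (auto simp: realizable_quotients_def realizable_def partition_on_def trail_vertices_def)
qed simp

text \<open>The labels are independent of each other. For each label the permutations extend a
  partial injection; if determinism fails for some label, there are none.\<close>

lemma card_compatible_tuples:
  assumes w: "word_over k w" and t: "t \<in> {..length w} \<rightarrow>\<^sub>E {1..n}"
  shows "card {\<sigma> \<in> perm_tuples k n. \<forall>(i, a, b)\<in>trail_edges w. \<sigma> i (t a) = t b} =
    (if det_graph (trail_img w t)
     then \<Prod>i\<in>{1..k}. fact (n - card ((\<lambda>(a, b). (t a, t b)) ` {(a, b). (i, a, b) \<in> trail_edges w})) else 0)"
    (is "card ?C = _")
proof -
  define R where "R i = (\<lambda>(a, b). (t a, t b)) ` {(a, b). (i, a, b) \<in> trail_edges w}" for i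
  have lab: "i \<in> {1..k}" if "(i, a, b) \<in> trail_edges w" for i a b
  proof -
    obtain j where "j < length w" "fst (w ! j) = i" using \<open>(i, a, b) \<in> trail_edges w\<close> unfolding trail_edges_iff by blast
    then have "w ! j \<in> set w" "fst (w ! j) = i" by auto
    then show ?thesis using bspec[OF w[unfolded word_over_def]] by (fastforce simp: case_prod_beta)
  qed
  have tN: "t a \<in> {1..n}" if "a \<le> length w" for a
    using t that PiE_mem[of t "{..length w}" "\<lambda>_. {1..n}" a] by simp
  have RN: "R i \<subseteq> {1..n} \<times> {1..n}" for i
    using tN trail_edges_le by (fastforce simp: R_def)
  have mem: "(i, u, v) \<in> trail_img w t \<longleftrightarrow> (u, v) \<in> R i" for i u v
    by (auto simp: trail_img_def R_def image_iff Bex_def)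
  have C: "?C = (\<Pi>\<^sub>E i\<in>{1..k}. {p. p permutes {1..n} \<and> (\<forall>(u, v)\<in>R i. p u = v)})" (is "_ = ?D")
  proof (intro set_eqI iffI)
    fix \<sigma> assume "\<sigma> \<in> ?C"
    then have \<sigma>: "\<sigma> \<in> perm_tuples k n" "\<And>i a b. (i, a, b) \<in> trail_edges w \<Longrightarrow> \<sigma> i (t a) = t b" by auto
    then show "\<sigma> \<in> ?D" unfolding perm_tuples_def PiE_iff by (auto simp: R_def)
  next
    fix \<sigma> assume \<sigma>: "\<sigma> \<in> ?D"
    have "\<sigma> i (t a) = t b" if e: "(i, a, b) \<in> trail_edges w" for i a b
    proof -
      have "(t a, t b) \<in> R i" using e by (auto simp: R_def)
      moreover have "\<forall>(u, v)\<in>R i. \<sigma> i u = v" using PiE_mem[OF \<sigma> lab[OF e]] by simp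
      ultimately show ?thesis by fastforce
    qed
    moreover have "\<sigma> \<in> perm_tuples k n" using \<sigma> unfolding perm_tuples_def PiE_iff by auto
    ultimately show "\<sigma> \<in> ?C" by auto
  qed
  show ?thesis
  proof (cases "det_graph (trail_img w t)")
    case True
    have "card {p. p permutes {1..n} \<and> (\<forall>(u, v)\<in>R i. p u = v)} = fact (n - card (R i))" for i
    proof -
      have "card {p. p permutes {1..n} \<and> (\<forall>(u, v)\<in>R i. p u = v)} = fact (card {1..n} - card (R i))"
        by (rule card_permutes_extending) (use RN True in \<open>auto simp: det_graph_iff mem\<close>)
      then show ?thesis by simp
    qed
    then have "card ?C = (\<Prod>i\<in>{1..k}. fact (n - card (R i)))" unfolding C by (simp add: card_PiE)
    then show ?thesis using True by (simp add: R_def)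
  next
    case False
    then obtain i u v u' v' where uv: "(u, v) \<in> R i" "(u', v') \<in> R i" "\<not> (u = u' \<longleftrightarrow> v = v')"
      unfolding det_graph_iff mem by blast
    have "i \<in> {1..k}" using uv(1) lab by (auto simp: R_def)
    have "{p. p permutes {1..n} \<and> (\<forall>(u, v)\<in>R i. p u = v)} = {}"
    proof (rule ccontr)
      assume "{p. p permutes {1..n} \<and> (\<forall>(u, v)\<in>R i. p u = v)} \<noteq> {}"
      then obtain p where p: "p permutes {1..n}" "\<forall>(u, v)\<in>R i. p u = v" by blast
      then have "p u = v" "p u' = v'" using uv by auto
      then show False using uv(3) permutes_inj[OF p(1)] by (auto dest: injD)
    qed
    then have "?C = {}" unfolding C PiE_eq_empty_iff using \<open>i \<in> {1..k}\<close> by blast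
    then have "card ?C = 0" by (simp only: card.empty)
    then show ?thesis using False by simp
  qed
qed

text \<open>Double counting of a tuple together with one of its closed trajectories; the number of
  tuples compatible with a given trajectory depends only on its coincidences.\<close>

lemma sum_num_fixed_points:
  assumes w: "word_over k w"
  shows "(\<Sum>\<sigma>\<in>perm_tuples k n. num_fixed_points w n \<sigma>) =
    (\<Sum>P\<in>realizable_quotients w. (\<Prod>i<card P. n - i) * (\<Prod>i\<in>{1..k}. fact (n - edge_count w P i)))"
proof -
  let ?Q = "realizable_quotients w"
  define T where "T = {t \<in> {..length w} \<rightarrow>\<^sub>E {1..n}. t 0 = t (length w)}"
  define C where "C t \<sigma> \<longleftrightarrow> (\<forall>(i, a, b)\<in>trail_edges w. \<sigma> i (t a) = t b)" for t :: "nat \<Rightarrow> nat" and \<sigma>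
  define c where "c t i = card ((\<lambda>(a, b). (t a, t b)) ` {(a, b). (i, a, b) \<in> trail_edges w})"
    for t :: "nat \<Rightarrow> nat" and i
  have finT: "finite T" unfolding T_def by (rule finite_subset[OF _ finite_PiE[of "{..length w}" "\<lambda>_. {1..n}"]]) auto
  have "(\<Sum>\<sigma>\<in>perm_tuples k n. num_fixed_points w n \<sigma>) =
      (\<Sum>\<sigma>\<in>perm_tuples k n. card {t \<in> T. C t \<sigma>})"
    by (intro sum.cong refl) (simp add: num_fixed_points_eq_trajectories[OF w] trajectories_def T_def C_def)
  also have "\<dots> = (\<Sum>\<sigma>\<in>perm_tuples k n. \<Sum>t\<in>T. if C t \<sigma> then 1 else 0)"
    by (simp only: card_eq_sum sum.inter_filter[OF finT])
  also have "\<dots> = (\<Sum>t\<in>T. \<Sum>\<sigma>\<in>perm_tuples k n. if C t \<sigma> then 1 else 0)" by (rule sum.swap)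
  also have "\<dots> = (\<Sum>t\<in>T. card {\<sigma> \<in> perm_tuples k n. C t \<sigma>})"
    by (simp only: card_eq_sum sum.inter_filter[OF finite_perm_tuples])
  also have "\<dots> = (\<Sum>t\<in>T. if det_graph (trail_img w t) then \<Prod>i\<in>{1..k}. fact (n - c t i) else 0)"
    by (intro sum.cong refl) (simp add: T_def C_def c_def card_compatible_tuples[OF w])
  also have "\<dots> = (\<Sum>t\<in>{t \<in> T. det_graph (trail_img w t)}. \<Prod>i\<in>{1..k}. fact (n - c t i))"
    by (rule sum.inter_filter[OF finT, symmetric])
  \<comment> \<open>The pattern of coincidences of such a map is a realizable quotient, and every
    map with a realizable pattern is of this kind.\<close>
  also have "{t \<in> T. det_graph (trail_img w t)} = (\<Union>P\<in>?Q. kernel_maps w n P)"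
  proof (intro set_eqI iffI)
    fix t assume t: "t \<in> {t \<in> T. det_graph (trail_img w t)}"
    obtain P where P: "partition_on (trail_vertices w) P"
      "\<forall>a\<le>length w. \<forall>b\<le>length w. t a = t b \<longleftrightarrow> blk P a = blk P b"
      using ex_kernel_partition[of w t] by blast
    have "det_graph (trail_img w (blk P))"
      using t det_graph_same_kernel[of w t "blk P"] P(2) by simp
    then have "realizable w P" using P t by (simp add: realizable_iff folded_iff[OF P(1)] T_def)
    moreover have "t \<in> kernel_maps w n P" using P(2) t by (simp add: kernel_maps_def T_def)
    ultimately show "t \<in> (\<Union>P\<in>?Q. kernel_maps w n P)"
      by (auto simp: realizable_quotients_def)
  next
    fix t assume "t \<in> (\<Union>P\<in>?Q. kernel_maps w n P)"
    then obtain P where P: "realizable w P" "t \<in> kernel_maps w n P" by (auto simp: realizable_quotients_def)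
    then have "det_graph (trail_img w t)"
      using det_graph_same_kernel[of w t "blk P"] folded_iff[of w P]
      by (simp add: realizable_iff kernel_maps_def)
    then show "t \<in> {t \<in> T. det_graph (trail_img w t)}"
      using P by (simp add: T_def kernel_maps_def realizable_iff)
  qed
  also have "(\<Sum>t\<in>\<dots>. \<Prod>i\<in>{1..k}. fact (n - c t i)) =
      (\<Sum>P\<in>?Q. \<Sum>t\<in>kernel_maps w n P. \<Prod>i\<in>{1..k}. fact (n - c t i))"
  proof (rule sum.UNION_disjoint)
    show "\<forall>P\<in>?Q. finite (kernel_maps w n P)"
    proof
      show "finite (kernel_maps w n P)" for P unfolding kernel_maps_def
        by (rule finite_subset[OF _ finite_PiE[of "{..length w}" "\<lambda>_. {1..n}"]]) auto
    qed
    show "\<forall>P\<in>?Q. \<forall>Q\<in>?Q. P \<noteq> Q \<longrightarrow>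
        kernel_maps w n P \<inter> kernel_maps w n Q = {}"
    proof (intro ballI impI, rule ccontr)
      fix P Q assume PQ: "P \<in> ?Q" "Q \<in> ?Q" "P \<noteq> Q"
        "kernel_maps w n P \<inter> kernel_maps w n Q \<noteq> {}"
      then obtain t where "t \<in> kernel_maps w n P" "t \<in> kernel_maps w n Q" by blast
      then have "P = Q" using PQ(1,2)
        by (intro partition_eqI[of w]) (simp_all add: realizable_quotients_def realizable_iff kernel_maps_def)
      then show False using PQ(3) by simp
    qed
  qed (rule finite_realizable_quotients)
  also have "\<dots> = (\<Sum>P\<in>?Q.
      (\<Prod>i<card P. n - i) * (\<Prod>i\<in>{1..k}. fact (n - edge_count w P i)))"
  proof (rule sum.cong[OF refl])
    fix P assume "P \<in> ?Q"
    then have P: "partition_on (trail_vertices w) P" by (simp add: realizable_quotients_def realizable_iff)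
    have "c t i = edge_count w P i" if t: "t \<in> kernel_maps w n P" for t i
    proof -
      let ?E = "{(a, b). (i, a, b) \<in> trail_edges w}"
      have "c t i = card ((\<lambda>(a, b). (blk P a, blk P b)) ` ?E)"
        unfolding c_def
        by (rule card_image_same_kernel) (use t trail_edges_le in \<open>force simp: kernel_maps_def\<close>)
      also have "(\<lambda>(a, b). (blk P a, blk P b)) ` ?E = {(U, V). (i, U, V) \<in> quotient_edges w P}"
        unfolding quotient_edges_eq[OF P] trail_img_def by (auto simp: image_iff Bex_def)
      finally show ?thesis by (simp add: edge_count_def)
    qed
    then have "(\<Sum>t\<in>kernel_maps w n P. \<Prod>i\<in>{1..k}. fact (n - c t i)) =
        (\<Sum>t\<in>kernel_maps w n P. \<Prod>i\<in>{1..k}. fact (n - edge_count w P i) :: nat)"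
      by (intro sum.cong refl prod.cong) simp
    then show "(\<Sum>t\<in>kernel_maps w n P. \<Prod>i\<in>{1..k}. fact (n - c t i)) =
        (\<Prod>i<card P. n - i) * (\<Prod>i\<in>{1..k}. fact (n - edge_count w P i))"
      by (simp add: card_kernel_maps[OF P])
  qed
  finally show ?thesis .
qed

subsection \<open>Expansion in powers of $1/n$\<close>

abbreviation (input) fps_term :: "int fps \<Rightarrow> nat \<Rightarrow> nat \<Rightarrow> real" where
  "fps_term A n i \<equiv> real_of_int (fps_nth A i) / real n ^ i"

text \<open>Absolute convergence is part of the notion, so that products expand by the Cauchy
  product. The coefficients are integers because \<open>fp_coeff\<close> asks for an integer
  sequence.\<close>

definition expands :: "nat \<Rightarrow> int fps \<Rightarrow> (nat \<Rightarrow> real) \<Rightarrow> bool" where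
  "expands L A g \<longleftrightarrow> (\<forall>n\<ge>L. summable (\<lambda>i. norm (fps_term A n i)) \<and>
     (\<lambda>i. fps_term A n i) sums g n)"

lemma expands_finite:
  assumes "\<And>i. i > K \<Longrightarrow> fps_nth A i = 0"
  shows "expands L A (\<lambda>n. \<Sum>i\<le>K. fps_term A n i)"
  unfolding expands_def
proof (intro allI impI conjI)
  fix n :: nat
  show "summable (\<lambda>i. norm (fps_term A n i))"
    by (rule summable_finite[of "{..K}"]) (use assms in auto)
  show "(\<lambda>i. fps_term A n i) sums (\<Sum>i\<le>K. fps_term A n i)"
    by (rule sums_finite) (use assms in auto)
qed

lemma expands_1: "expands L 1 (\<lambda>n. 1)"
  using expands_finite[of 0 1 L] by simp

lemma expands_X: "expands L fps_X (\<lambda>n. 1 / real n)"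
  using expands_finite[of 1 fps_X L] by simp

lemma expands_linear: "expands L (1 - of_nat c * fps_X) (\<lambda>n. 1 - real c / real n)"
proof -
  have eq: "(1 - of_nat c * fps_X :: int fps) = 1 - fps_const (int c) * fps_X"
    by (simp add: fps_of_nat)
  show ?thesis
    unfolding eq using expands_finite[of 1 "1 - fps_const (int c) * fps_X" L] by simp
qed

lemma expandsD:
  assumes "expands L A f" "n \<ge> L"
  shows "summable (\<lambda>i. norm (fps_term A n i))"
    "(\<lambda>i. fps_term A n i) sums f n"
  using assms by (auto simp: expands_def)

lemma expands_add:
  assumes A: "expands L A f" and B: "expands L B g"
  shows "expands L (A + B) (\<lambda>n. f n + g n)"
  unfolding expands_def
proof (intro allI impI conjI)
  fix n assume n: "n \<ge> L"
  have eq: "fps_term (A + B) n i =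
     fps_term A n i + fps_term B n i" for i
    by (simp add: add_divide_distrib)
  have "summable (\<lambda>i. norm (fps_term A n i) + norm (fps_term B n i))"
    by (rule summable_add[OF expandsD(1)[OF A n] expandsD(1)[OF B n]])
  then show "summable (\<lambda>i. norm (fps_term (A + B) n i))"
    by (rule summable_comparison_test'[where N = 0]) (simp only: eq real_norm_def abs_idempotent abs_triangle_ineq)
  show "(\<lambda>i. fps_term (A + B) n i) sums (f n + g n)"
    unfolding eq by (rule sums_add[OF expandsD(2)[OF A n] expandsD(2)[OF B n]])
qed

lemma expands_uminus: "expands L A f \<Longrightarrow> expands L (- A) (\<lambda>n. - f n)"
  unfolding expands_def by (auto dest: sums_minus)

lemma expands_diff: "expands L A f \<Longrightarrow> expands L B g \<Longrightarrow> expands L (A - B) (\<lambda>n. f n - g n)"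
  using expands_add[of L A f "- B" "\<lambda>n. - g n"] expands_uminus[of L B g] by simp

lemma expands_mult:
  assumes "expands L A f" "expands L B g"
  shows "expands L (A * B) (\<lambda>n. f n * g n)"
  unfolding expands_def
proof (intro allI impI conjI)
  fix n assume n: "n \<ge> L"
  define a where "a i = fps_term A n i" for i
  define b where "b i = fps_term B n i" for i
  have a: "summable (\<lambda>i. norm (a i))" "a sums f n" and b: "summable (\<lambda>i. norm (b i))" "b sums g n"
    using assms n by (auto simp: expands_def a_def[abs_def] b_def[abs_def])
  have eq: "fps_term (A * B) n i = (\<Sum>j\<le>i. a j * b (i - j))" for i
  proof -
    have "fps_term (A * B) n i =
        (\<Sum>j\<le>i. real_of_int (fps_nth A j) * real_of_int (fps_nth B (i - j)) / real n ^ i)"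
      by (simp add: fps_mult_nth atLeast0AtMost sum_divide_distrib)
    also have "\<dots> = (\<Sum>j\<le>i. a j * b (i - j))"
    proof (rule sum.cong[OF refl])
      fix j assume "j \<in> {..i}"
      then have "real n ^ i = real n ^ j * real n ^ (i - j)" by (simp flip: power_add)
      then show "real_of_int (fps_nth A j) * real_of_int (fps_nth B (i - j)) / real n ^ i = a j * b (i - j)"
        by (simp add: a_def b_def)
    qed
    finally show ?thesis .
  qed
  have "summable (\<lambda>i. \<Sum>j\<le>i. norm (a j) * norm (b (i - j)))"
    using summable_Cauchy_product[of "\<lambda>i. norm (a i)" "\<lambda>i. norm (b i)"] a b by simp
  then show "summable (\<lambda>i. norm (fps_term (A * B) n i))"
  proof (rule summable_comparison_test'[where N = 0])
    fix i
    have "norm (\<Sum>j\<le>i. a j * b (i - j)) \<le> (\<Sum>j\<le>i. norm (a j) * norm (b (i - j)))"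
      by (rule order_trans[OF norm_sum]) (simp add: abs_mult)
    then show "norm (norm (fps_term (A * B) n i)) \<le> (\<Sum>j\<le>i. norm (a j) * norm (b (i - j)))"
      unfolding eq by simp
  qed
  have "(\<lambda>i. \<Sum>j\<le>i. a j * b (i - j)) sums ((\<Sum>i. a i) * (\<Sum>i. b i))"
    by (rule Cauchy_product_sums[OF a(1) b(1)])
  then show "(\<lambda>i. fps_term (A * B) n i) sums (f n * g n)"
    unfolding eq using sums_unique[OF a(2)] sums_unique[OF b(2)] by simp
qed

lemma expands_sum:
  "finite S \<Longrightarrow> (\<And>x. x \<in> S \<Longrightarrow> expands L (A x) (f x)) \<Longrightarrow> expands L (\<Sum>x\<in>S. A x) (\<lambda>n. \<Sum>x\<in>S. f x n)"
proof (induction rule: finite_induct)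
  case empty
  show ?case using expands_finite[of 0 0 L] by simp
qed (simp add: expands_add)

lemma expands_prod:
  "finite S \<Longrightarrow> (\<And>x. x \<in> S \<Longrightarrow> expands L (A x) (f x)) \<Longrightarrow> expands L (\<Prod>x\<in>S. A x) (\<lambda>n. \<Prod>x\<in>S. f x n)"
  by (induction rule: finite_induct) (simp_all add: expands_mult expands_1)

lemma expands_power: "expands L A f \<Longrightarrow> expands L (A ^ m) (\<lambda>n. f n ^ m)"
  by (induction m) (simp_all add: expands_mult expands_1)

text \<open>The formal inverse of 1 - c X, that is, the expansion of n / (n - c).\<close>

definition geo :: "nat \<Rightarrow> int fps" where
  "geo c = Abs_fps (\<lambda>i. int c ^ i)"

lemma expands_geo:
  assumes "c < L" shows "expands L (geo c) (\<lambda>n. 1 / (1 - real c / real n))"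
  unfolding expands_def
proof (intro allI impI conjI)
  fix n assume "n \<ge> L"
  then have lt: "norm (real c / real n) < 1" using assms by simp
  have eq: "fps_term (geo c) n i = (real c / real n) ^ i" for i
    by (simp add: geo_def power_divide)
  show "summable (\<lambda>i. norm (fps_term (geo c) n i))"
    unfolding eq norm_power using lt by (intro summable_geometric) simp
  show "(\<lambda>i. fps_term (geo c) n i) sums (1 / (1 - real c / real n))"
    unfolding eq by (rule geometric_sums[OF lt])
qed


text \<open>The identity theorem at the points 1/n. Once the coefficients below \<open>k\<close>
  vanish, multiplying by the \<open>k\<close>-th power of n leaves a power series in 1/n that
  vanishes at these points, and continuity at 0 gives its constant term \<open>a k\<close>.\<close>

lemma sums_inverse_powers_unique:
  fixes a :: "nat \<Rightarrow> real"
  assumes a: "\<And>n. n \<ge> L \<Longrightarrow> (\<lambda>i. a i / real n ^ i) sums 0"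
  shows "a k = 0"
proof (induction k rule: less_induct)
  case (less k)
  define c where "c i = a (i + k)" for i
  have c: "(\<lambda>i. c i * (1 / real n) ^ i) sums 0" if n: "n \<ge> max L 1" for n
  proof -
    have "(\<lambda>i. a (i + k) / real n ^ (i + k)) sums 0"
    proof -
      have "(\<Sum>i<k. a i / real n ^ i) = 0" using less by (intro sum.neutral) simp
      then show ?thesis
        using a[of n] n sums_iff_shift[of "\<lambda>i. a i / real n ^ i" k 0] by simp
    qed
    then have "(\<lambda>i. real n ^ k * (a (i + k) / real n ^ (i + k))) sums (real n ^ k * 0)"
      by (rule sums_mult)
    moreover have "real n ^ k * (a (i + k) / real n ^ (i + k)) = c i * (1 / real n) ^ i" for i
      using n by (simp add: c_def power_add power_divide)
    ultimately show ?thesis by simp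
  qed
  define f where "f x = (\<Sum>i. c i * x ^ i)" for x :: real
  \<comment> \<open>Convergence at the single point \<open>1 / real (max L 1)\<close> already gives
    a positive radius.\<close>
  have "isCont f 0"
    unfolding f_def by (rule isCont_powser[where K = "1 / real (max L 1)"])
      (use c[of "max L 1"] in \<open>auto simp: sums_iff\<close>)
  moreover have "(\<lambda>n. 1 / real n) \<longlonglongrightarrow> 0" by (rule lim_const_over_n)
  ultimately have "(\<lambda>n. f (1 / real n)) \<longlonglongrightarrow> f 0" by (rule isCont_tendsto_compose)
  moreover have "eventually (\<lambda>n. f (1 / real n) = 0) sequentially"
    using eventually_ge_at_top[of "max L 1"]
    by eventually_elim (use c in \<open>auto simp: f_def sums_iff\<close>)
  ultimately have "(\<lambda>n. 0 :: real) \<longlonglongrightarrow> f 0" by (rule Lim_transform_eventually)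
  then have "f 0 = 0" by (simp add: LIMSEQ_const_iff)
  then show ?case using powser_zero[of c] by (simp add: f_def c_def)
qed

lemma fps_nth_1_mult: "fps_nth (A * B) 1 = fps_nth A 0 * fps_nth B 1 + fps_nth A 1 * fps_nth B 0"
  by (simp add: fps_mult_nth)

lemma fps_nth_0_prod:
  "finite S \<Longrightarrow> (\<And>x. x \<in> S \<Longrightarrow> fps_nth (A x) 0 = 1) \<Longrightarrow>
     fps_nth (\<Prod>x\<in>S. A x) 0 = (1 :: 'a :: comm_ring_1)"
  by (induction rule: finite_induct) simp_all

lemma fps_nth_1_prod:
  "finite S \<Longrightarrow> (\<And>x. x \<in> S \<Longrightarrow> fps_nth (A x) 0 = 1) \<Longrightarrow>
     fps_nth (\<Prod>x\<in>S. A x) 1 = (\<Sum>x\<in>S. fps_nth (A x) 1 :: 'a :: comm_ring_1)"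
proof (induction rule: finite_induct)
  case (insert x S)
  then show ?case using fps_nth_0_prod[of S A] by (simp only: prod.insert sum.insert fps_nth_1_mult) simp
qed simp

text \<open>The quotient of falling factorials that belongs to \<open>P\<close>, with all powers of
  n pulled out.\<close>

definition quotient_series :: "nat \<Rightarrow> word \<Rightarrow> nat set set \<Rightarrow> int fps" where
  "quotient_series k w P = (\<Prod>i<card P. 1 - of_nat i * fps_X) *
     (\<Prod>l\<in>{1..k}. \<Prod>j<edge_count w P l. geo j)"

lemma sum_lessThan_int: "2 * (\<Sum>i<v. int i) = int v * (int v - 1)"
  by (induction v) (simp_all add: algebra_simps)

lemma fps_nth_linear: "fps_nth (1 - of_nat i * fps_X :: int fps) 0 = 1"
  "fps_nth (1 - of_nat i * fps_X :: int fps) (Suc 0) = - int i"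
  by (simp_all add: fps_mult_nth fps_of_nat[symmetric] numeral_eq_Suc)

text \<open>To the coefficient of 1/n each linear factor contributes -i and each geometric series j.
  Doubling avoids binomial coefficients and matches the ordered pairs in
  \<open>card_type_A_2\<close>.\<close>

lemma quotient_series_coeff:
  "fps_nth (quotient_series k w P) 0 = 1"
  "2 * fps_nth (quotient_series k w P) 1 =
     (\<Sum>l\<in>{1..k}. int (edge_count w P l) * (int (edge_count w P l) - 1)) - int (card P) * (int (card P) - 1)" (is ?c1)
proof -
  let ?A = "\<Prod>i<card P. 1 - of_nat i * fps_X :: int fps"
  let ?B = "\<lambda>l. \<Prod>j<edge_count w P l. geo j"
  have A: "fps_nth ?A 0 = 1" "fps_nth ?A 1 = - (\<Sum>i<card P. int i)"
    using fps_nth_0_prod[of "{..<card P}" "\<lambda>i. 1 - of_nat i * fps_X :: int fps"]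
      fps_nth_1_prod[of "{..<card P}" "\<lambda>i. 1 - of_nat i * fps_X :: int fps"]
    by (simp_all add: fps_nth_linear sum_negf)
  have B: "fps_nth (?B l) 0 = 1" "fps_nth (?B l) 1 = (\<Sum>j<edge_count w P l. int j)" for l
    using fps_nth_0_prod[of "{..<edge_count w P l}" geo] fps_nth_1_prod[of "{..<edge_count w P l}" geo]
    by (simp_all add: geo_def)
  have C: "fps_nth (\<Prod>l\<in>{1..k}. ?B l) 0 = 1"
    "fps_nth (\<Prod>l\<in>{1..k}. ?B l) 1 = (\<Sum>l\<in>{1..k}. \<Sum>j<edge_count w P l. int j)"
    using fps_nth_0_prod[of "{1..k}" ?B] fps_nth_1_prod[of "{1..k}" ?B] B by simp_all
  show "fps_nth (quotient_series k w P) 0 = 1"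
    unfolding quotient_series_def fps_mult_nth_0 A C by simp
  have "fps_nth (quotient_series k w P) 1 =
      (\<Sum>l\<in>{1..k}. \<Sum>j<edge_count w P l. int j) - (\<Sum>i<card P. int i)"
    unfolding quotient_series_def fps_nth_1_mult A C by simp
  then have "2 * fps_nth (quotient_series k w P) 1 =
      (\<Sum>l\<in>{1..k}. 2 * (\<Sum>j<edge_count w P l. int j)) - 2 * (\<Sum>i<card P. int i)"
    by (simp add: sum_distrib_left)
  then show ?c1
    unfolding sum_lessThan_int .
qed

section \<open>The expectation as a power series in 1/n\<close>

lemma word_over_labels: "word_over k w \<Longrightarrow> fst ` set w \<subseteq> {1..k}"
  by (fastforce simp: word_over_def)

lemma finite_quotient_edges:
  assumes "partition_on (trail_vertices w) P" shows "finite (quotient_edges w P)"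
  by (simp add: quotient_edges_eq[OF assms] trail_img_eq)

lemma sum_edge_count:
  assumes w: "word_over k w" and P: "partition_on (trail_vertices w) P"
  shows "(\<Sum>i\<in>{1..k}. edge_count w P i) = card (quotient_edges w P)"
proof -
  let ?Q = "quotient_edges w P"
  have eq: "?Q = (SIGMA i:{1..k}. {(U, V). (i, U, V) \<in> ?Q})"
  proof -
    have "i \<in> {1..k}" if "(i, U, V) \<in> ?Q" for i U V
    proof -
      have "i \<in> fst ` set w"
        using that by (auto simp: quotient_edges_eq[OF P] trail_img_eq qedge_def split: if_splits)
      then show ?thesis using word_over_labels[OF w] by blast
    qed
    then show ?thesis by auto
  qed
  have "finite {(U, V). (i, U, V) \<in> ?Q}" for i
    by (rule finite_subset[OF _ finite_imageI[OF finite_quotient_edges[OF P], of snd]]) force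
  then have "card (SIGMA i:{1..k}. {(U, V). (i, U, V) \<in> ?Q}) =
      (\<Sum>i\<in>{1..k}. card {(U, V). (i, U, V) \<in> ?Q})"
    by (intro card_SigmaI) auto
  then show ?thesis using arg_cong[OF eq, of card] by (simp add: edge_count_def)
qed

text \<open>Makes every factor n - j with j below an edge count positive as soon as n is at least
  the length of \<open>w\<close>.\<close>

lemma edge_count_le:
  assumes w: "word_over k w" and P: "partition_on (trail_vertices w) P" and l: "l \<in> {1..k}"
  shows "edge_count w P l \<le> length w"
proof -
  have "edge_count w P l \<le> (\<Sum>i\<in>{1..k}. edge_count w P i)"
    using l by (intro member_le_sum) auto
  also have "\<dots> = card (quotient_edges w P)" by (rule sum_edge_count[OF w P])
  also have "\<dots> \<le> length w"
    unfolding quotient_edges_eq[OF P] trail_img_eq using card_image_le[of "{..<length w}"] by fastforce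
  finally show ?thesis .
qed

lemma fact_div_fact_eq:
  assumes "e \<le> n" shows "fact (n - e) / fact n = (1 / (\<Prod>j<e. real n - real j) :: real)"
  using assms
proof (induction e)
  case (Suc e)
  have "fact (n - e) = (real n - real e) * fact (n - Suc e)"
    using Suc.prems by (simp add: Suc_diff_Suc fact_reduce[of "n - e"] of_nat_diff)
  moreover have "real n - real e \<noteq> 0" using Suc.prems by simp
  ultimately have "fact (n - Suc e) / fact n = (fact (n - e) / fact n) / (real n - real e)" by simp
  then show ?case using Suc by simp
qed simp

lemma expected_fixed_points_eq:
  assumes w: "word_over k w" and n: "length w \<le> n"
  shows "expected_fixed_points k w n = (\<Sum>P\<in>realizable_quotients w.
    (\<Prod>i<card P. real n - real i) / (\<Prod>l\<in>{1..k}. \<Prod>j<edge_count w P l. real n - real j))"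
proof -
  have ne: "perm_tuples k n \<noteq> {}"
    using card_perm_tuples[of k n] by (metis card.empty fact_nonzero power_not_zero)
  have "expected_fixed_points k w n = (\<Sum>\<sigma>\<in>perm_tuples k n. real (num_fixed_points w n \<sigma>)) / card (perm_tuples k n)"
    unfolding expected_fixed_points_def by (rule integral_pmf_of_set[OF ne finite_perm_tuples])
  also have "(\<Sum>\<sigma>\<in>perm_tuples k n. real (num_fixed_points w n \<sigma>)) =
      real (\<Sum>\<sigma>\<in>perm_tuples k n. num_fixed_points w n \<sigma>)" by simp
  also have "\<dots> / card (perm_tuples k n) = (\<Sum>P\<in>realizable_quotients w.
      real (\<Prod>i<card P. n - i) * (\<Prod>l\<in>{1..k}. fact (n - edge_count w P l) / fact n))"
    unfolding sum_num_fixed_points[OF w] card_perm_tuples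
    by (simp add: sum_divide_distrib prod_dividef)
  also have "\<dots> = (\<Sum>P\<in>realizable_quotients w.
    (\<Prod>i<card P. real n - real i) / (\<Prod>l\<in>{1..k}. \<Prod>j<edge_count w P l. real n - real j))"
  proof (rule sum.cong[OF refl])
    fix P assume "P \<in> realizable_quotients w"
    then have P: "partition_on (trail_vertices w) P" by (simp add: realizable_quotients_def realizable_iff)
    have "real (\<Prod>i<card P. n - i) = (\<Prod>i<card P. real n - real i)"
    proof (cases "card P \<le> n")
      case True
      then show ?thesis by (simp add: of_nat_diff)
    next
      case False
      \<comment> \<open>Both products contain the factor for i = n.\<close>
      then have "(\<Prod>i<card P. n - i) = 0" "(\<Prod>i<card P. real n - real i) = 0"
        by (auto simp: prod_zero_iff intro!: bexI[of _ n])
      then show ?thesis by (simp only: of_nat_0)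
    qed
    moreover have "(\<Prod>l\<in>{1..k}. fact (n - edge_count w P l) / fact n) =
        (\<Prod>l\<in>{1..k}. 1 / (\<Prod>j<edge_count w P l. real n - real j))"
      using edge_count_le[OF w P] n by (intro prod.cong refl fact_div_fact_eq) (meson order_trans)
    ultimately show "real (\<Prod>i<card P. n - i) * (\<Prod>l\<in>{1..k}. fact (n - edge_count w P l) / fact n) =
      (\<Prod>i<card P. real n - real i) / (\<Prod>l\<in>{1..k}. \<Prod>j<edge_count w P l. real n - real j)"
      by (simp add: prod_dividef)
  qed
  finally show ?thesis .
qed

lemma prod_shift: "real n > 0 \<Longrightarrow> (\<Prod>i<v. real n - real i) = real n ^ v * (\<Prod>i<v. 1 - real i / real n)"
  by (induction v) (simp_all add: field_simps)

text \<open>Dividing by n turns the exponent v - e into -\<open>chi\<close>, and the subtracted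
  expectation 1 becomes \<open>fps_X\<close>.\<close>

definition fp_series :: "nat \<Rightarrow> word \<Rightarrow> int fps" where
  "fp_series k w = (\<Sum>P\<in>realizable_quotients w. fps_X ^ nat (chi w P) * quotient_series k w P) - fps_X"

lemma fp_series_expands:
  assumes w: "word_over k w"
  shows "expands (max 1 (length w)) (fp_series k w) (\<lambda>n. (expected_fixed_points k w n - 1) / real n)"
proof -
  let ?L = "max 1 (length w)"
  define T where "T P n = (1 / real n) ^ nat (chi w P) * ((\<Prod>i<card P. 1 - real i / real n) *
     (\<Prod>l\<in>{1..k}. \<Prod>j<edge_count w P l. 1 / (1 - real j / real n)))" for P n
  have ex: "expands ?L (fps_X ^ nat (chi w P) * quotient_series k w P) (T P)"
    if "P \<in> realizable_quotients w" for P
    unfolding T_def quotient_series_def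
  proof (intro expands_mult expands_power expands_X expands_prod expands_linear expands_geo finite_lessThan finite_atLeastAtMost)
    fix l j assume "l \<in> {1..k}" "j \<in> {..<edge_count w P l}"
    moreover have "partition_on (trail_vertices w) P"
      using that by (simp add: realizable_quotients_def realizable_iff)
    ultimately show "j < ?L" using edge_count_le[OF w, of P l] by simp
  qed
  have "expands ?L (fp_series k w) (\<lambda>n. (\<Sum>P\<in>realizable_quotients w. T P n) - 1 / real n)"
    unfolding fp_series_def
    by (intro expands_diff expands_sum expands_X finite_realizable_quotients ex)
  moreover have "(\<Sum>P\<in>realizable_quotients w. T P n) - 1 / real n = (expected_fixed_points k w n - 1) / real n"
    if n: "n \<ge> ?L" for n
  proof -
    have n0: "real n > 0" using n by simp
    have "T P n = (\<Prod>i<card P. real n - real i) /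
        (\<Prod>l\<in>{1..k}. \<Prod>j<edge_count w P l. real n - real j) / real n"
      if PR: "P \<in> realizable_quotients w" for P
    proof -
      have R: "realizable w P" using PR by (simp add: realizable_quotients_def)
      then have P: "partition_on (trail_vertices w) P" by (simp add: realizable_iff)
      define c where "c = nat (chi w P)"
      have "int c = chi w P" using realizable_chi_nonneg[OF R] by (simp add: c_def)
      \<comment> \<open>Balances the powers of n: e of them in the denominator and one more from the
        division by n, against v in the numerator.\<close>
      then have c: "(\<Sum>l\<in>{1..k}. edge_count w P l) + 1 = card P + c"
        unfolding sum_edge_count[OF w P] chi_def by simp
      define A where "A = (\<Prod>i<card P. 1 - real i / real n)"
      define B where "B = (\<Prod>l\<in>{1..k}. \<Prod>j<edge_count w P l. 1 - real j / real n)"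
      have "(\<Prod>l\<in>{1..k}. \<Prod>j<edge_count w P l. real n - real j) =
          real n ^ (\<Sum>l\<in>{1..k}. edge_count w P l) * B"
        unfolding B_def prod_shift[OF n0] prod.distrib power_sum ..
      then have "(\<Prod>i<card P. real n - real i) /
        (\<Prod>l\<in>{1..k}. \<Prod>j<edge_count w P l. real n - real j) / real n =
        real n ^ card P * A / (real n ^ ((\<Sum>l\<in>{1..k}. edge_count w P l) + 1) * B)"
        unfolding A_def prod_shift[OF n0] by simp
      also have "\<dots> = real n ^ card P * A / (real n ^ card P * real n ^ c * B)"
        unfolding c power_add by simp
      also have "\<dots> = A / (real n ^ c * B)" using n0 by simp
      also have "\<dots> = (1 / real n) ^ c * (A * (1 / B))" by (simp add: power_divide)
      also have "1 / B = (\<Prod>l\<in>{1..k}. \<Prod>j<edge_count w P l. 1 / (1 - real j / real n))"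
        unfolding B_def by (simp add: prod_dividef)
      finally show ?thesis unfolding T_def A_def c_def by simp
    qed
    then have "(\<Sum>P\<in>realizable_quotients w. T P n) = expected_fixed_points k w n / real n"
      using expected_fixed_points_eq[OF w, of n] n by (simp add: sum_divide_distrib)
    then show ?thesis by (simp add: diff_divide_distrib)
  qed
  ultimately show ?thesis by (simp add: expands_def)
qed

lemma fp_coeff_eq:
  assumes w: "word_over k w" shows "fp_coeff k w = fps_nth (fp_series k w)"
  unfolding fp_coeff_def
proof (rule the_equality)
  show fp: "\<forall>n. 1 \<le> n \<and> length w \<le> n \<longrightarrow> (\<lambda>i. fps_term (fp_series k w) n i)
      sums ((expected_fixed_points k w n - 1) / real n)"
    using fp_series_expands[OF w] by (simp add: expands_def)
  fix a :: "nat \<Rightarrow> int"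
  assume a: "\<forall>n. 1 \<le> n \<and> length w \<le> n \<longrightarrow>
    (\<lambda>i. real_of_int (a i) / real n ^ i) sums ((expected_fixed_points k w n - 1) / real n)"
  have "real_of_int (a i) - real_of_int (fps_nth (fp_series k w) i) = 0" for i
  proof (rule sums_inverse_powers_unique[where L = "max 1 (length w)"])
    fix n assume "max 1 (length w) \<le> n"
    then have "(\<lambda>i. real_of_int (a i) / real n ^ i - fps_term (fp_series k w) n i) sums
        ((expected_fixed_points k w n - 1) / real n - (expected_fixed_points k w n - 1) / real n)"
      using a fp by (intro sums_diff) auto
    then show "(\<lambda>i. (real_of_int (a i) - real_of_int (fps_nth (fp_series k w) i)) / real n ^ i) sums 0"
      by (simp add: diff_divide_distrib)
  qed
  then show "a = fps_nth (fp_series k w)" by (intro ext) simp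
qed

text \<open>If the expectation is constantly 1, all coefficients vanish by uniqueness and the
  infimum over the empty set is infinite, so one formula covers both cases of
  \<open>phi\<close>.\<close>

lemma phi_eq:
  assumes w: "word_over k w"
  shows "phi k w = (INF i \<in> {i. fps_nth (fp_series k w) i \<noteq> 0}. enat i)"
proof (cases "\<forall>n\<ge>1. expected_fixed_points k w n = 1")
  case True
  have "real_of_int (fps_nth (fp_series k w) i) = 0" for i
  proof (rule sums_inverse_powers_unique[where L = "max 1 (length w)"])
    fix n assume n: "max 1 (length w) \<le> n"
    then show "(\<lambda>i. fps_term (fp_series k w) n i) sums 0"
      using fp_series_expands[OF w] True by (auto simp: expands_def)
  qed
  then have "{i. fps_nth (fp_series k w) i \<noteq> 0} = {}" by simp
  then show ?thesis using True by (simp add: phi_def top_enat_def)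
next
  case False
  then show ?thesis unfolding phi_def fp_coeff_eq[OF w] by (rule if_not_P)
qed

lemma enat_INF_eq_2:
  "(INF i \<in> S. enat i) = 2 \<longleftrightarrow> 0 \<notin> S \<and> 1 \<notin> S \<and> (2::nat) \<in> S" (is "?I = 2 \<longleftrightarrow> _")
proof
  assume I: "?I = 2"
  have le: "2 \<le> i" if "i \<in> S" for i
  proof -
    have "?I \<le> enat i" using that by (rule INF_lower)
    then show ?thesis unfolding I by (simp add: numeral_eq_enat)
  qed
  have "2 \<in> S"
  proof (rule ccontr)
    assume "2 \<notin> S"
    then have "3 \<le> i" if "i \<in> S" for i using le[OF that] that by (cases "i = 2") auto
    then have "3 \<le> ?I" by (intro INF_greatest) (simp add: numeral_eq_enat)
    then show False unfolding I by (simp add: numeral_eq_enat)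
  qed
  then show "0 \<notin> S \<and> 1 \<notin> S \<and> 2 \<in> S" using le by force
next
  assume S: "0 \<notin> S \<and> 1 \<notin> S \<and> 2 \<in> S"
  show "?I = 2"
  proof (rule antisym)
    show "?I \<le> 2" using S INF_lower[of 2 S enat] by (simp add: numeral_eq_enat)
    show "2 \<le> ?I"
    proof (rule INF_greatest)
      fix i assume "i \<in> S"
      then have "i \<noteq> 0" "i \<noteq> 1" using S by metis+
      then show "2 \<le> enat i" by (simp add: numeral_eq_enat)
    qed
  qed
qed


section \<open>The first three coefficients\<close>

lemma fps_nth_X_power_mult_low:
  fixes U :: "int fps"
  shows "fps_nth (fps_X ^ c * U) 0 = (if c = 0 then fps_nth U 0 else 0)"
    "fps_nth (fps_X ^ c * U) 1 = (if c = 0 then fps_nth U 1 else if c = 1 then fps_nth U 0 else 0)"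
    "fps_nth (fps_X ^ c * U) 2 =
      (if c = 0 then fps_nth U 2 else if c = 1 then fps_nth U 1 else if c = 2 then fps_nth U 0 else 0)"
  by (auto simp: fps_X_power_mult_nth)

theorem theorem1:
  fixes k :: nat and w :: word
  assumes "k \<ge> 1" and "word_over k w"
  shows "phi k w = 2 \<longleftrightarrow> beta w = 2"
proof -
  let ?Q = "realizable_quotients w"
  \<comment> \<open>The aim is that each of the first three coefficients equals the size of
    \<open>B j\<close>, as long as the preceding ones vanish.\<close>
  define B where "B j = {P \<in> ?Q. type_B w P \<and> chi w P = int j}" for j
  define c where "c P = nat (chi w P)" for P
  have c: "chi w P = int (c P)" if "P \<in> ?Q" for P
    using that realizable_chi_nonneg by (simp add: c_def realizable_quotients_def)
  have fin: "finite ?Q" by (rule finite_realizable_quotients)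
  have finB: "finite (B j)" for j using fin by (simp add: B_def)
  let ?U = "quotient_series k w" and ?a = "fps_nth (fp_series k w)"
  have a: "?a j = (\<Sum>P\<in>?Q. fps_nth (fps_X ^ c P * ?U P) j) - fps_nth fps_X j" for j
    by (simp add: fp_series_def fps_sum_nth c_def)
  have "beta w = (INF P \<in> {P \<in> ?Q. type_B w P}. enat (c P))" by (simp add: beta_def c_def)
  also have "\<dots> = (INF i \<in> {j. B j \<noteq> {}}. enat i)"
  proof -
    have "c ` {P \<in> ?Q. type_B w P} = {j. B j \<noteq> {}}" using c by (auto simp: B_def)
    then show ?thesis by (metis image_image)
  qed
  finally have beta: "beta w = 2 \<longleftrightarrow> B 0 = {} \<and> B 1 = {} \<and> B 2 \<noteq> {}"
    by (simp add: enat_INF_eq_2)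
  have phi: "phi k w = 2 \<longleftrightarrow> ?a 0 = 0 \<and> ?a 1 = 0 \<and> ?a 2 \<noteq> 0"
    by (simp add: phi_eq[OF assms(2)] enat_INF_eq_2)
  have a0: "?a 0 = int (card {P \<in> ?Q. c P = 0})"
    unfolding a fps_nth_X_power_mult_low(1) quotient_series_coeff(1)
    by (simp add: sum.If_cases[OF fin] Int_def)
  show ?thesis
  proof (cases "\<exists>P\<in>?Q. c P = 0")
    case True
    \<comment> \<open>A quotient with \<open>chi\<close> 0 is of type B, so both invariants are
      0.\<close>
    then obtain P where P: "P \<in> ?Q" "c P = 0" by blast
    then have "type_B w P" using realizable_chi_0_type_B c by simp
    then have "B 0 \<noteq> {}" using P c by (auto simp: B_def)
    moreover have "?a 0 \<noteq> 0" unfolding a0 using P fin by (auto simp: card_eq_0_iff)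
    ultimately show ?thesis using phi beta by simp
  next
    case False
    have c0: "c P \<noteq> 0" if "P \<in> ?Q" for P using False that by (auto simp only: bex_simps)
    have ne0: "chi w P \<noteq> 0" if "realizable w P" for P
      using c0[of P] c[of P] that by (simp add: realizable_quotients_def)
    have "B 0 = {}" using c c0 by (auto simp: B_def)
    have "?a 0 = 0" unfolding a0 using c0 fin by (auto simp: card_eq_0_iff)
    have cyc: "cyc w \<in> ?Q" "c (cyc w) = 1" "type_A w (cyc w)"
      using chi_1_type_A_iff[OF ne0, of "cyc w"] realizable_cyc
      by (simp_all add: realizable_quotients_def c_def)
    have C1: "{P \<in> ?Q. c P = 1} = insert (cyc w) (B 1)"
    proof (intro set_eqI iffI)
      fix P assume P: "P \<in> {P \<in> ?Q. c P = 1}"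
      then have "chi w P = 1" using c by simp
      then show "P \<in> insert (cyc w) (B 1)"
        using P chi_1_type_A_iff[OF ne0, of P] by (auto simp: B_def type_B_def)
    next
      fix P assume "P \<in> insert (cyc w) (B 1)"
      then show "P \<in> {P \<in> ?Q. c P = 1}" using cyc by (auto simp: B_def c_def)
    qed
    have "cyc w \<notin> B 1" using cyc by (simp add: B_def type_B_def)
    \<comment> \<open>The quotient \<open>cyc w\<close> contributes 1 here, which the subtracted
      \<open>fps_X\<close> cancels.\<close>
    have "?a 1 = int (card {P \<in> ?Q. c P = 1}) - 1"
    proof -
      have "(\<Sum>P\<in>?Q. fps_nth (fps_X ^ c P * ?U P) 1) = (\<Sum>P\<in>?Q. if c P = 1 then 1 else 0)"
        by (intro sum.cong refl) (simp only: fps_nth_X_power_mult_low(2) c0 quotient_series_coeff(1) if_False)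
      then show ?thesis unfolding a by (simp add: sum.If_cases[OF fin] Int_def)
    qed
    then have a1: "?a 1 = int (card (B 1))" unfolding C1 using \<open>cyc w \<notin> B 1\<close> finB by simp
    show ?thesis
    proof (cases "B 1 = {}")
      case False
      then have "?a 1 \<noteq> 0" using a1 finB by simp
      then show ?thesis using phi beta False by simp
    next
      case True
      \<comment> \<open>With \<open>B 1\<close> empty, \<open>cyc w\<close> is alone at
        \<open>chi\<close> 1; together with \<open>ne0\<close> this is the setting of
        \<open>card_type_A_2\<close>.\<close>
      have only: "P = cyc w" if "realizable w P" "chi w P = 1" for P
        using C1 True that by (auto simp: realizable_quotients_def c_def)
      have C2: "{P \<in> ?Q. c P = 2} = type_A_2 w \<union> B 2" "type_A_2 w \<inter> B 2 = {}"
        using c by (auto simp: type_A_2_def B_def type_B_def realizable_quotients_def c_def)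
      have "type_A_2 w \<subseteq> ?Q" by (auto simp: type_A_2_def realizable_quotients_def)
      then have finA: "finite (type_A_2 w)" using fin finite_subset by blast
      \<comment> \<open>At order 2 a quotient with \<open>chi\<close> 1 enters through its first
        correction, one with \<open>chi\<close> 2 through its leading coefficient 1.\<close>
      have "?a 2 = (\<Sum>P\<in>?Q. (if c P = 1 then fps_nth (?U P) 1 else 0) + (if c P = 2 then 1 else 0))"
      proof -
        have "(\<Sum>P\<in>?Q. fps_nth (fps_X ^ c P * ?U P) 2) =
           (\<Sum>P\<in>?Q. (if c P = 1 then fps_nth (?U P) 1 else 0) + (if c P = 2 then 1 else 0))"
        proof (rule sum.cong[OF refl])
          fix P assume "P \<in> ?Q"
          show "fps_nth (fps_X ^ c P * ?U P) 2 =
             (if c P = 1 then fps_nth (?U P) 1 else 0) + (if c P = 2 then 1 else 0)"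
            unfolding fps_nth_X_power_mult_low(3) quotient_series_coeff(1)
            using c0[OF \<open>P \<in> ?Q\<close>] by simp
        qed
        then show ?thesis unfolding a by simp
      qed
      also have "\<dots> = (\<Sum>P\<in>{P \<in> ?Q. c P = 1}. fps_nth (?U P) 1) + int (card {P \<in> ?Q. c P = 2})"
        by (simp add: sum.distrib sum.If_cases[OF fin] Int_def)
      also have "(\<Sum>P\<in>{P \<in> ?Q. c P = 1}. fps_nth (?U P) 1) = fps_nth (?U (cyc w)) 1"
        unfolding C1 True by simp
      also have "int (card {P \<in> ?Q. c P = 2}) = int (card (type_A_2 w)) + int (card (B 2))"
        unfolding C2(1) using card_Un_disjoint[OF finA finB C2(2)] by simp
      finally have a2: "?a 2 = fps_nth (?U (cyc w)) 1 + (int (card (type_A_2 w)) + int (card (B 2)))" .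
      define e where "e l = edge_count w (cyc w) l" for l
      define v where "v = card (cyc w)"
      have nat_int: "int (x * (x - 1)) = int x * (int x - 1)" for x :: nat
        by (cases x) (simp_all add: algebra_simps)
      have "2 * card (type_A_2 w) + (\<Sum>l\<in>{1..k}. e l * (e l - 1)) = v * (v - 1)"
        unfolding e_def v_def edge_count_def
        by (rule card_type_A_2[OF ne0 only _ word_over_labels[OF assms(2)]]) simp_all
      then have "int (2 * card (type_A_2 w) + (\<Sum>l\<in>{1..k}. e l * (e l - 1))) = int (v * (v - 1))"
        by (simp only:)
      then have "2 * int (card (type_A_2 w)) + (\<Sum>l\<in>{1..k}. int (e l) * (int (e l) - 1)) =
          int v * (int v - 1)"
        by (simp only: of_nat_add of_nat_sum nat_int of_nat_mult[of 2 "card (type_A_2 w)"] of_nat_numeral)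
      \<comment> \<open>The correction of \<open>cyc w\<close> cancels the quotients of type A
        exactly and leaves the count of \<open>B 2\<close>.\<close>
      then have "2 * fps_nth (?U (cyc w)) 1 = - (2 * int (card (type_A_2 w)))"
        unfolding quotient_series_coeff(2) e_def v_def by linarith
      then have "?a 2 = int (card (B 2))" using a2 by linarith
      then have "?a 2 \<noteq> 0 \<longleftrightarrow> B 2 \<noteq> {}" using finB by simp
      then show ?thesis using phi beta \<open>?a 0 = 0\<close> \<open>B 0 = {}\<close> a1 True by simp
    qed
  qed
qed

end
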